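(* Suppose that all assumptions (A1)--(A9) listed in the context hold, with the requirement on $\alpha$ in (A4) strengthened to $\alpha>4$, and that the identifiability condition $$\forall \varepsilon>0, \quad \inf_{\theta\in\Theta:\,|\theta-\theta_0|\geq\varepsilon} R(\theta) > R(\theta_0)$$ holds. Let additionally $\theta_0$ be an interior point of $\Theta$. Assume that $h\asymp n^{-\gamma}$ with $$\frac{1}{2\alpha}<\gamma<\frac18 .$$ Let $$v(x)=2\dot{\mu}(x;\theta_0)\mu(x;\theta_0)\pi(x;\theta_0)w(x)+\left[\dot{\mu}(x;\theta_0)\pi(x;\theta_0)w(x)\right]'\sigma^2(x).$$ If $$\ddot{R}(\theta_0)\neq 0,\quad \operatorname{Var}[v(Z_0)]+2\sum_{j=1}^\infty\operatorname{Cov}[v(Z_0),v(Z_j)]>0,\quad \|v^{(\alpha)}\|_\infty<\infty,$$ and for some $\delta>0$, $$\mathbb{E}[|Z_j|^{2+\delta}]<\infty,\quad \sum_{k=1}^\infty(\alpha_\Delta(k))^{\delta/(2+\delta)}<\infty,$$ then $\sqrt{n+1}(\hat{\theta}_n-\theta_0)$ converges in distribution to $\mathcal{N}(0,s^2)$ as $n\to\infty$, where $$s^2=\frac{\operatorname{Var}[v(Z_0)]+2\sum_{j=1}^\infty\operatorname{Cov}[v(Z_0),v(Z_j)]}{(\ddot{R}(\theta_0))^2}.$$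
   Context: Setting. On a probability space $(\Omega,\mathcal{F},\mathbb{P})$ let $W=(W_t)_{t\ge 0}$ be a Brownian motion and $\xi$ a random variable independent of $W$. Consider the stochastic differential equation $$dX_t=\mu(X_t;\theta)\,dt+\sigma(X_t)\,dW_t,\qquad X_0=\xi,$$ with $\theta\in\Theta\subset\mathbb{R}$ an unknown parameter. The true value is $\theta_0\in\Theta$, and $X$ is the solution for $\theta=\theta_0$ with $\xi\sim\pi(\cdot;\theta_0)$, where $\pi(\cdot;\theta)$ is the invariant density. One observes $Z_j=X_{j\Delta}$, $j=0,\ldots,n$, with $\Delta>0$ fixed. All convergence is as $n\to\infty$. Notation. A dot denotes a derivative with respect to $\theta$ (so $\ddot R$ is the second derivative of $R$), a prime a derivative with respect to $x$; $\pi^{(\alpha)}$, $v^{(\alpha)}$ are the $\alpha$-th derivatives with respect to $x$; $\stackrel{(i)}{\mu}$ is the $i$-th derivative of $\mu$ with respect to $\theta$ (with $\stackrel{(0)}{\mu}=\mu$). $a_n\asymp b_n$ means that the sequences are asymptotically of the same order. Mixing coefficients: $$\alpha_{\Delta}(k)=\sup_{m\ge 0}\ \sup_{A\in\sigma(Z_j,\,j\le m),\ B\in\sigma(Z_j,\,j\ge m+k)}|\mathbb{P}(AB)-\mathbb{P}(A)\mathbb{P}(B)|;$$ the sequence is $\alpha$-mixing if $\alpha_\Delta(k)\to0$. Estimator. With a kernel $K$ and bandwidth $h=h_n>0$, $$\hat{\pi}(x)=\frac{1}{(n+1)h}\sum_{j=0}^nK\left(\frac{x-Z_j}{h}\right),$$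 $$R_n(\theta)=\int_{\mathbb{R}}\left(\mu(x;\theta)\hat{\pi}(x)-\tfrac12[\sigma^2(x)\hat{\pi}(x)]'\right)^2w(x)\,dx,$$ and $\hat{\theta}_n$ is a (measurable) minimiser of $R_n$ over $\Theta$, $\hat\theta_n=\operatorname{argmin}_{\theta\in\Theta}R_n(\theta)$. The limit criterion is $$R(\theta)=\int_{\mathbb{R}}\left(\mu(x;\theta)\pi(x;\theta_0)-\tfrac12[\sigma^2(x)\pi(x;\theta_0)]'\right)^2w(x)\,dx.$$ Assumptions. (A1) $\Theta=[a,b]$ with $a<b$. (A2) $\mu(\cdot;\theta)$ is known up to $\theta$ and $\sigma(\cdot)$ is a known function. There is a unique strong solution $X$ to the equation with respect to $W$ and $\xi$; it is a homogeneous Markov process with transition density $p(t,x,y;\theta)$. It is ergodic with bounded invariant density $\pi(\cdot;\cdot)$ that has a bounded, continuous and integrable derivative $\pi'(\cdot;\cdot)$, and for $\xi\sim\pi(\cdot;\theta)$ it is strictly stationary. Also $\dot\pi(\cdot;\cdot)$ exists. For all $\theta\in\Theta$ the support of $\pi(\cdot;\theta)$ (the state space of $X$) is $\mathbb{R}$. (A3) The sample $X_0,X_\Delta,\ldots$ corresponding to $\theta_0$ is $\alpha$-mixing with $\sum_{k=0}^\infty\alpha_\Delta(k)<\infty$. (A4) For some integer $\alpha>3$ and some constant $L_\theta>0$ (possibly depending on $\theta$), for all $t\in\mathbb{R}$, $\left\{\int_{\mathbb{R}}(\pi^{(\alpha)}(x+t;\theta)-\pi^{(\alpha)}(x;\theta))^2dx\right\}^{1/2}\le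 L_\theta$ (the derivative $\pi^{(\alpha)}$ being understood to exist). (A5) $K$ is symmetric, continuously differentiable, has support $[-1,1]$, and $\int_{-1}^1K(u)du=1$, $\int_{-1}^1u^lK(u)du=0$ for $l=1,\ldots,\alpha$, with the same $\alpha$ as in (A4). (A6) $h=h_n\downarrow0$ and $nh^4\to\infty$ as $n\to\infty$. (A7) $w$ is nonnegative, continuously differentiable, bounded and integrable. (A8) $\sigma$ is differentiable and $\pi(\cdot;\theta_0)$ solves $\mu(x;\theta_0)\pi(x)-\tfrac12[\sigma^2(x)\pi(x)]'=0$ in the unknown function $\pi(\cdot)$. (A9) $\mu(\cdot;\cdot)$ is three times differentiable in $\theta$. The drift and dispersion coefficients and the corresponding derivatives are continuous functions of $x$ and $\theta$. There exist functions $\widetilde\mu_1,\ldots,\widetilde\mu_4$ with $\sup_{\theta\in\Theta}|\stackrel{(i)}{\mu}(x;\theta)|\le\widetilde\mu_{i+1}(x)$ for all $x\in\mathbb{R}$, $i=0,1,2,3$, and a function $\widetilde\mu_5$ with $\sup_{\theta\in\Theta}|\dot\mu'(x;\theta)|\le\widetilde\mu_5(x)$ for all $x\in\mathbb{R}$. The following functions of $x$ are bounded and integrable: $\widetilde\mu_1^2w$, $\sigma^4w$, $\sigma^2(\sigma')^2w$, $\widetilde\mu_2\widetilde\mu_1w$, $\widetilde\mu_5\sigma^2w$, $\widetilde\mu_2^2w$, $\sigma^2w$, $\sigma\sigma'w$, $\widetilde\mu_2\sigma^2w'$, $\widetilde\mu_3\widetilde\mu_1w$, $\widetilde\mu_3\sigma^4w$,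 $\widetilde\mu_3\sigma\sigma'w$, $\widetilde\mu_3\sigma^2w$, $\widetilde\mu_3\widetilde\mu_2w$, $\widetilde\mu_4\widetilde\mu_1w$, $\widetilde\mu_4\sigma\sigma'w$, $\widetilde\mu_4\sigma^2w$, $\widetilde\mu_2\sigma^2w$, $\widetilde\mu_2\sigma\sigma'w$. Finally, $\lim_{|x|\to\infty}\widetilde\mu_2(x)w(x)\sigma^2(x)=0$. *)

theory Defs
  imports "HOL-Probability.Probability" "HOL-Library.Landau_Symbols"
begin

section \<open>Calculus on the line\<close>

definition times_differentiable :: "nat \<Rightarrow> (real \<Rightarrow> real) \<Rightarrow> bool" where
  "times_differentiable n f \<longleftrightarrow> (\<forall>k<n. \<forall>x. (deriv ^^ k) f differentiable at x)"

definition continuously_differentiable :: "(real \<Rightarrow> real) \<Rightarrow> bool" where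
  "continuously_differentiable f \<longleftrightarrow>
     (\<forall>x. f differentiable at x) \<and> continuous_on UNIV (deriv f)"

definition bounded_integrable :: "(real \<Rightarrow> real) \<Rightarrow> bool" where
  "bounded_integrable f \<longleftrightarrow> bounded (range f) \<and> integrable lborel f"

text \<open>Functions of the parameter are only specified on the compact interval \<open>\<Theta>\<close>, so their
  derivatives are taken relative to \<open>\<Theta>\<close>: one-sided at the endpoints, ordinary in the interior.\<close>

definition param_deriv :: "real set \<Rightarrow> (real \<Rightarrow> real) \<Rightarrow> real \<Rightarrow> real" where
  "param_deriv \<Theta> f \<theta> = vector_derivative f (at \<theta> within \<Theta>)"

definition param_times_differentiable :: "nat \<Rightarrow> real set \<Rightarrow> (real \<Rightarrow> real) \<Rightarrow> bool" where
  "param_times_differentiable n \<Theta> f \<longleftrightarrow>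
     (\<forall>k<n. \<forall>\<theta>\<in>\<Theta>. (param_deriv \<Theta> ^^ k) f differentiable (at \<theta> within \<Theta>))"

section \<open>Random processes\<close>

text \<open>The sub-\<open>\<sigma>\<close>-algebra of \<open>M\<close> generated by the real random variables \<open>Y i\<close>, \<open>i \<in> I\<close>.\<close>

definition generated_algebra :: "'a measure \<Rightarrow> ('i \<Rightarrow> 'a \<Rightarrow> real) \<Rightarrow> 'i set \<Rightarrow> 'a measure" where
  "generated_algebra M Y I =
     sigma (space M) (\<Union>i\<in>I. {Y i -` B \<inter> space M | B. B \<in> sets borel})"

definition strictly_stationary :: "'a measure \<Rightarrow> (real \<Rightarrow> 'a \<Rightarrow> real) \<Rightarrow> bool" where
  "strictly_stationary M X \<longleftrightarrow>
     (\<forall>J s. finite J \<and> J \<subseteq> {0..} \<and> s \<ge> 0 \<longrightarrow>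
        distr M (PiM J (\<lambda>_. borel)) (\<lambda>\<omega>. \<lambda>t\<in>J. X (t + s) \<omega>) =
        distr M (PiM J (\<lambda>_. borel)) (\<lambda>\<omega>. \<lambda>t\<in>J. X t \<omega>))"

definition alpha_coeff :: "'a measure \<Rightarrow> (nat \<Rightarrow> 'a \<Rightarrow> real) \<Rightarrow> nat \<Rightarrow> real" where
  "alpha_coeff M Z k =
     (SUP m. SUP (A, B) \<in> sets (generated_algebra M Z {..m}) \<times> sets (generated_algebra M Z {m + k..}).
        \<bar>measure M (A \<inter> B) - measure M A * measure M B\<bar>)"

definition alpha_mixing :: "'a measure \<Rightarrow> (nat \<Rightarrow> 'a \<Rightarrow> real) \<Rightarrow> bool" where
  "alpha_mixing M Z \<longleftrightarrow> alpha_coeff M Z \<longlonglongrightarrow> 0"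

definition covariance :: "'a measure \<Rightarrow> ('a \<Rightarrow> real) \<Rightarrow> ('a \<Rightarrow> real) \<Rightarrow> real" where
  "covariance M X Y =
     (\<integral>\<omega>. (X \<omega> - integral\<^sup>L M X) * (Y \<omega> - integral\<^sup>L M Y) \<partial>M)"

definition long_run_variance ::
    "'a measure \<Rightarrow> (real \<Rightarrow> real) \<Rightarrow> (nat \<Rightarrow> 'a \<Rightarrow> real) \<Rightarrow> real" where
  "long_run_variance M f Z =
     prob_space.variance M (\<lambda>\<omega>. f (Z 0 \<omega>)) +
     2 * (\<Sum>j. covariance M (\<lambda>\<omega>. f (Z 0 \<omega>)) (\<lambda>\<omega>. f (Z (Suc j) \<omega>)))"

section \<open>Brownian motion and stochastic differential equations\<close>

text \<open>Processes are indexed by \<open>real\<close>; only nonnegative times are meaningful.\<close>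

definition brownian_motion :: "'a measure \<Rightarrow> (real \<Rightarrow> 'a \<Rightarrow> real) \<Rightarrow> bool" where
  "brownian_motion M W \<longleftrightarrow>
     prob_space M \<and>
     (\<forall>t\<ge>0. W t \<in> borel_measurable M) \<and>
     (AE \<omega> in M. W 0 \<omega> = 0) \<and>
     (\<forall>\<omega>\<in>space M. continuous_on {0..} (\<lambda>t. W t \<omega>)) \<and>
     (\<forall>s t. 0 \<le> s \<and> s < t \<longrightarrow>
        distributed M lborel (\<lambda>\<omega>. W t \<omega> - W s \<omega>) (normal_density 0 (sqrt (t - s))) \<and>
        prob_space.indep_set M (sets (vimage_algebra (space M) (\<lambda>\<omega>. W t \<omega> - W s \<omega>) borel))
          (sets (generated_algebra M W {0..s})))"

definition independent_of_process ::
    "'a measure \<Rightarrow> ('a \<Rightarrow> real) \<Rightarrow> (real \<Rightarrow> 'a \<Rightarrow> real) \<Rightarrow> bool" where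
  "independent_of_process M \<xi> W \<longleftrightarrow>
     prob_space.indep_set M (sets (vimage_algebra (space M) \<xi> borel))
       (sets (generated_algebra M W {0..}))"

text \<open>The filtration generated by \<open>\<xi>\<close> and \<open>W\<close>, augmented by the null sets of \<open>M\<close>.\<close>

definition augmented_filtration ::
    "'a measure \<Rightarrow> ('a \<Rightarrow> real) \<Rightarrow> (real \<Rightarrow> 'a \<Rightarrow> real) \<Rightarrow> real \<Rightarrow> 'a measure" where
  "augmented_filtration M \<xi> W t =
     sigma (space M)
       (sets (vimage_algebra (space M) \<xi> borel) \<union> sets (generated_algebra M W {0..t}) \<union>
        null_sets M)"

text \<open>A simple integrand is \<open>\<Sum>i<k. \<eta> i * indicator {\<tau> i<..\<tau> (Suc i)}\<close> with deterministic
  nodes \<open>\<tau>\<close> and bounded, \<open>F (\<tau> i)\<close>-measurable coefficients.\<close>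

definition simple_integrand ::
    "(real \<Rightarrow> 'a measure) \<Rightarrow> nat \<Rightarrow> (nat \<Rightarrow> real) \<Rightarrow> (nat \<Rightarrow> 'a \<Rightarrow> real) \<Rightarrow> bool" where
  "simple_integrand F k \<tau> \<eta> \<longleftrightarrow>
     0 \<le> \<tau> 0 \<and>
     (\<forall>i<k. \<tau> i \<le> \<tau> (Suc i) \<and> \<eta> i \<in> borel_measurable (F (\<tau> i)) \<and>
        bounded (\<eta> i ` space (F (\<tau> i))))"

definition simple_process ::
    "nat \<Rightarrow> (nat \<Rightarrow> real) \<Rightarrow> (nat \<Rightarrow> 'a \<Rightarrow> real) \<Rightarrow> real \<Rightarrow> 'a \<Rightarrow> real" where
  "simple_process k \<tau> \<eta> s \<omega> = (\<Sum>i<k. \<eta> i \<omega> * indicator {\<tau> i<..\<tau> (Suc i)} s)"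

definition simple_ito_integral ::
    "(real \<Rightarrow> 'a \<Rightarrow> real) \<Rightarrow> nat \<Rightarrow> (nat \<Rightarrow> real) \<Rightarrow> (nat \<Rightarrow> 'a \<Rightarrow> real) \<Rightarrow> real \<Rightarrow> 'a \<Rightarrow> real" where
  "simple_ito_integral W k \<tau> \<eta> t \<omega> =
     (\<Sum>i<k. \<eta> i \<omega> * (W (min (\<tau> (Suc i)) t) \<omega> - W (min (\<tau> i) t) \<omega>))"

definition vanishes_in_probability :: "'a measure \<Rightarrow> (nat \<Rightarrow> 'a \<Rightarrow> ennreal) \<Rightarrow> bool" where
  "vanishes_in_probability M Y \<longleftrightarrow>
     (\<forall>\<epsilon>::real. \<epsilon> > 0 \<longrightarrow> (\<lambda>n. measure M {\<omega>\<in>space M. Y n \<omega> > ennreal \<epsilon>}) \<longlonglongrightarrow> 0)"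

text \<open>\<open>I\<close> is a version of the Ito integral of \<open>H\<close> against \<open>W\<close> over \<open>[0, t]\<close>: \<open>H\<close> is progressively
  measurable with almost surely square integrable paths, and \<open>I\<close> is the limit in probability of
  the integrals of simple integrands approximating \<open>H\<close>.\<close>

definition has_ito_integral ::
    "'a measure \<Rightarrow> (real \<Rightarrow> 'a measure) \<Rightarrow> (real \<Rightarrow> 'a \<Rightarrow> real) \<Rightarrow> real \<Rightarrow>
     (real \<Rightarrow> 'a \<Rightarrow> real) \<Rightarrow> ('a \<Rightarrow> real) \<Rightarrow> bool" where
  "has_ito_integral M F W t H I \<longleftrightarrow>
     (\<forall>u\<in>{0..t}. (\<lambda>(s, \<omega>). H s \<omega>) \<in> borel_measurable (restrict_space borel {0..u} \<Otimes>\<^sub>M F u)) \<and>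
     (AE \<omega> in M. set_integrable lborel {0..t} (\<lambda>s. (H s \<omega>)\<^sup>2)) \<and>
     I \<in> borel_measurable M \<and>
     (\<exists>k \<tau> \<eta>. (\<forall>n. simple_integrand F (k n) (\<tau> n) (\<eta> n)) \<and>
        vanishes_in_probability M (\<lambda>n \<omega>.
          \<integral>\<^sup>+s\<in>{0..t}. ennreal ((simple_process (k n) (\<tau> n) (\<eta> n) s \<omega> - H s \<omega>)\<^sup>2) \<partial>lborel) \<and>
        vanishes_in_probability M (\<lambda>n \<omega>.
          ennreal \<bar>simple_ito_integral W (k n) (\<tau> n) (\<eta> n) t \<omega> - I \<omega>\<bar>))"

definition strong_solution ::
    "'a measure \<Rightarrow> (real \<Rightarrow> 'a \<Rightarrow> real) \<Rightarrow> ('a \<Rightarrow> real) \<Rightarrow> (real \<Rightarrow> real) \<Rightarrow> (real \<Rightarrow> real) \<Rightarrow>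
     (real \<Rightarrow> 'a \<Rightarrow> real) \<Rightarrow> bool" where
  "strong_solution M W \<xi> m \<sigma> X \<longleftrightarrow>
     (\<forall>t\<ge>0. X t \<in> borel_measurable (augmented_filtration M \<xi> W t)) \<and>
     (\<forall>\<omega>\<in>space M. continuous_on {0..} (\<lambda>t. X t \<omega>)) \<and>
     (AE \<omega> in M. X 0 \<omega> = \<xi> \<omega>) \<and>
     (\<forall>t\<ge>0. AE \<omega> in M. set_integrable lborel {0..t} (\<lambda>s. m (X s \<omega>))) \<and>
     (\<forall>t\<ge>0. \<exists>I.
        has_ito_integral M (augmented_filtration M \<xi> W) W t (\<lambda>s \<omega>. \<sigma> (X s \<omega>)) I \<and>
        (AE \<omega> in M. X t \<omega> = \<xi> \<omega> + (LINT s:{0..t}|lborel. m (X s \<omega>)) + I \<omega>))"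

text \<open>\<open>q t x y\<close> is the transition density from \<open>x\<close> to \<open>y\<close> over a time span \<open>t\<close>; it does not
  depend on the starting time \<open>s\<close>.\<close>

definition homogeneous_markov ::
    "'a measure \<Rightarrow> (real \<Rightarrow> 'a \<Rightarrow> real) \<Rightarrow> (real \<Rightarrow> real \<Rightarrow> real \<Rightarrow> real) \<Rightarrow> bool" where
  "homogeneous_markov M X q \<longleftrightarrow>
     (\<forall>s\<ge>0. \<forall>t>0. \<forall>B\<in>sets borel.
        AE \<omega> in M.
          real_cond_exp M (generated_algebra M X {0..s}) (\<lambda>\<omega>'. indicator B (X (s + t) \<omega>')) \<omega> =
          (LINT y:B|lborel. q t (X s \<omega>) y))"

definition transition_density :: "(real \<Rightarrow> real \<Rightarrow> real \<Rightarrow> real) \<Rightarrow> bool" where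
  "transition_density q \<longleftrightarrow>
     (\<forall>t>0. (\<lambda>(x, y). q t x y) \<in> borel_measurable (borel \<Otimes>\<^sub>M borel) \<and>
        (\<forall>x. (\<forall>y. q t x y \<ge> 0) \<and> (\<integral>\<^sup>+y. ennreal (q t x y) \<partial>lborel) = 1))"

definition invariant_density :: "(real \<Rightarrow> real \<Rightarrow> real \<Rightarrow> real) \<Rightarrow> (real \<Rightarrow> real) \<Rightarrow> bool" where
  "invariant_density q f \<longleftrightarrow>
     f \<in> borel_measurable borel \<and> (\<forall>x. f x \<ge> 0) \<and> (\<integral>\<^sup>+x. ennreal (f x) \<partial>lborel) = 1 \<and>
     (\<forall>t>0. AE y in lborel. (\<integral>\<^sup>+x. ennreal (f x * q t x y) \<partial>lborel) = ennreal (f y))"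

text \<open>Pathwise law of large numbers, for bounded Borel test functions.\<close>

definition ergodic_process :: "'a measure \<Rightarrow> (real \<Rightarrow> 'a \<Rightarrow> real) \<Rightarrow> (real \<Rightarrow> real) \<Rightarrow> bool" where
  "ergodic_process M X f \<longleftrightarrow>
     (\<forall>g\<in>borel_measurable borel. bounded (range g) \<longrightarrow>
        (AE \<omega> in M. ((\<lambda>T. (LINT t:{0..T}|lborel. g (X t \<omega>)) / T) \<longlongrightarrow>
           (LINT x|lborel. g x * f x)) at_top))"

text \<open>The initial value is arbitrary (real valued and independent of \<open>W\<close>), not only the stationary one.\<close>

definition ergodic_diffusion_model ::
    "'a measure \<Rightarrow> (real \<Rightarrow> 'a \<Rightarrow> real) \<Rightarrow> real set \<Rightarrow> (real \<Rightarrow> real \<Rightarrow> real) \<Rightarrow> (real \<Rightarrow> real) \<Rightarrow>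
     (real \<Rightarrow> real \<Rightarrow> real \<Rightarrow> real \<Rightarrow> real) \<Rightarrow> (real \<Rightarrow> real \<Rightarrow> real) \<Rightarrow> bool" where
  "ergodic_diffusion_model M W \<Theta> \<mu> \<sigma> p \<pi> \<longleftrightarrow>
     (\<forall>\<theta>\<in>\<Theta>.
        transition_density (\<lambda>t x y. p t x y \<theta>) \<and>
        invariant_density (\<lambda>t x y. p t x y \<theta>) (\<lambda>x. \<pi> x \<theta>) \<and>
        (\<forall>\<xi>. independent_of_process M \<xi> W \<longrightarrow>
           (\<exists>X. strong_solution M W \<xi> (\<lambda>x. \<mu> x \<theta>) \<sigma> X) \<and>
           (\<forall>X Y. strong_solution M W \<xi> (\<lambda>x. \<mu> x \<theta>) \<sigma> X \<and>
                  strong_solution M W \<xi> (\<lambda>x. \<mu> x \<theta>) \<sigma> Y \<longrightarrow>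
              (AE \<omega> in M. \<forall>t\<ge>0. X t \<omega> = Y t \<omega>)) \<and>
           (\<forall>X. strong_solution M W \<xi> (\<lambda>x. \<mu> x \<theta>) \<sigma> X \<longrightarrow>
              homogeneous_markov M X (\<lambda>t x y. p t x y \<theta>) \<and>
              ergodic_process M X (\<lambda>x. \<pi> x \<theta>) \<and>
              (distributed M lborel \<xi> (\<lambda>x. ennreal (\<pi> x \<theta>)) \<longrightarrow> strictly_stationary M X))) \<and>
        bounded (range (\<lambda>x. \<pi> x \<theta>)) \<and>
        continuously_differentiable (\<lambda>x. \<pi> x \<theta>) \<and>
        bounded_integrable (deriv (\<lambda>x. \<pi> x \<theta>)) \<and>
        (\<forall>x. \<pi> x differentiable (at \<theta> within \<Theta>)) \<and>
        closure {x. \<pi> x \<theta> \<noteq> 0} = UNIV)"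

section \<open>Regularity conditions\<close>

definition smooth_invariant_densities :: "real set \<Rightarrow> nat \<Rightarrow> (real \<Rightarrow> real \<Rightarrow> real) \<Rightarrow> bool" where
  "smooth_invariant_densities \<Theta> \<alpha> \<pi> \<longleftrightarrow>
     (\<forall>\<theta>\<in>\<Theta>. times_differentiable \<alpha> (\<lambda>x. \<pi> x \<theta>) \<and>
        (\<exists>L>0. \<forall>t.
           integrable lborel
             (\<lambda>x. ((deriv ^^ \<alpha>) (\<lambda>x. \<pi> x \<theta>) (x + t) - (deriv ^^ \<alpha>) (\<lambda>x. \<pi> x \<theta>) x)\<^sup>2) \<and>
           sqrt (LINT x|lborel.
             ((deriv ^^ \<alpha>) (\<lambda>x. \<pi> x \<theta>) (x + t) - (deriv ^^ \<alpha>) (\<lambda>x. \<pi> x \<theta>) x)\<^sup>2) \<le> L))"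

definition kernel_of_order :: "nat \<Rightarrow> (real \<Rightarrow> real) \<Rightarrow> bool" where
  "kernel_of_order \<alpha> K \<longleftrightarrow>
     (\<forall>u. K (- u) = K u) \<and> continuously_differentiable K \<and>
     closure {u. K u \<noteq> 0} = {-1..1} \<and>
     (LINT u:{-1..1}|lborel. K u) = 1 \<and>
     (\<forall>l\<in>{1..\<alpha>}. (LINT u:{-1..1}|lborel. u ^ l * K u) = 0)"

definition weight_function :: "(real \<Rightarrow> real) \<Rightarrow> bool" where
  "weight_function w \<longleftrightarrow>
     (\<forall>x. w x \<ge> 0) \<and> continuously_differentiable w \<and> bounded_integrable w"

definition coefficient_conditions ::
    "real set \<Rightarrow> (real \<Rightarrow> real \<Rightarrow> real) \<Rightarrow> (real \<Rightarrow> real) \<Rightarrow> (real \<Rightarrow> real) \<Rightarrow> bool" where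
  "coefficient_conditions \<Theta> \<mu> \<sigma> w \<longleftrightarrow>
     (\<forall>x. param_times_differentiable 3 \<Theta> (\<mu> x)) \<and>
     (\<forall>\<theta>\<in>\<Theta>. \<forall>x. (\<lambda>y. param_deriv \<Theta> (\<mu> y) \<theta>) differentiable at x) \<and>
     (\<forall>i\<le>3. continuous_on (UNIV \<times> \<Theta>) (\<lambda>(x, \<theta>). (param_deriv \<Theta> ^^ i) (\<mu> x) \<theta>)) \<and>
     continuous_on (UNIV \<times> \<Theta>) (\<lambda>(x, \<theta>). deriv (\<lambda>y. param_deriv \<Theta> (\<mu> y) \<theta>) x) \<and>
     continuously_differentiable \<sigma> \<and>
     (\<exists>\<mu>1 \<mu>2 \<mu>3 \<mu>4 \<mu>5 :: real \<Rightarrow> real.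
        (\<forall>\<theta>\<in>\<Theta>. \<forall>x.
           \<bar>\<mu> x \<theta>\<bar> \<le> \<mu>1 x \<and>
           \<bar>param_deriv \<Theta> (\<mu> x) \<theta>\<bar> \<le> \<mu>2 x \<and>
           \<bar>(param_deriv \<Theta> ^^ 2) (\<mu> x) \<theta>\<bar> \<le> \<mu>3 x \<and>
           \<bar>(param_deriv \<Theta> ^^ 3) (\<mu> x) \<theta>\<bar> \<le> \<mu>4 x \<and>
           \<bar>deriv (\<lambda>y. param_deriv \<Theta> (\<mu> y) \<theta>) x\<bar> \<le> \<mu>5 x) \<and>
        bounded_integrable (\<lambda>x. (\<mu>1 x)\<^sup>2 * w x) \<and>
        bounded_integrable (\<lambda>x. \<sigma> x ^ 4 * w x) \<and>
        bounded_integrable (\<lambda>x. (\<sigma> x)\<^sup>2 * (deriv \<sigma> x)\<^sup>2 * w x) \<and>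
        bounded_integrable (\<lambda>x. \<mu>2 x * \<mu>1 x * w x) \<and>
        bounded_integrable (\<lambda>x. \<mu>5 x * (\<sigma> x)\<^sup>2 * w x) \<and>
        bounded_integrable (\<lambda>x. (\<mu>2 x)\<^sup>2 * w x) \<and>
        bounded_integrable (\<lambda>x. (\<sigma> x)\<^sup>2 * w x) \<and>
        bounded_integrable (\<lambda>x. \<sigma> x * deriv \<sigma> x * w x) \<and>
        bounded_integrable (\<lambda>x. \<mu>2 x * (\<sigma> x)\<^sup>2 * deriv w x) \<and>
        bounded_integrable (\<lambda>x. \<mu>3 x * \<mu>1 x * w x) \<and>
        bounded_integrable (\<lambda>x. \<mu>3 x * \<sigma> x ^ 4 * w x) \<and>
        bounded_integrable (\<lambda>x. \<mu>3 x * \<sigma> x * deriv \<sigma> x * w x) \<and>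
        bounded_integrable (\<lambda>x. \<mu>3 x * (\<sigma> x)\<^sup>2 * w x) \<and>
        bounded_integrable (\<lambda>x. \<mu>3 x * \<mu>2 x * w x) \<and>
        bounded_integrable (\<lambda>x. \<mu>4 x * \<mu>1 x * w x) \<and>
        bounded_integrable (\<lambda>x. \<mu>4 x * \<sigma> x * deriv \<sigma> x * w x) \<and>
        bounded_integrable (\<lambda>x. \<mu>4 x * (\<sigma> x)\<^sup>2 * w x) \<and>
        bounded_integrable (\<lambda>x. \<mu>2 x * (\<sigma> x)\<^sup>2 * w x) \<and>
        bounded_integrable (\<lambda>x. \<mu>2 x * \<sigma> x * deriv \<sigma> x * w x) \<and>
        ((\<lambda>x. \<mu>2 x * w x * (\<sigma> x)\<^sup>2) \<longlongrightarrow> 0) at_infinity)"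

section \<open>The estimator\<close>

definition kernel_estimator ::
    "(real \<Rightarrow> real) \<Rightarrow> (nat \<Rightarrow> real) \<Rightarrow> (nat \<Rightarrow> 'a \<Rightarrow> real) \<Rightarrow> nat \<Rightarrow> 'a \<Rightarrow> real \<Rightarrow> real" where
  "kernel_estimator K h Z n \<omega> x =
     1 / ((real n + 1) * h n) * (\<Sum>j=0..n. K ((x - Z j \<omega>) / h n))"

text \<open>With \<open>f\<close> the kernel estimator this is the empirical criterion, with \<open>f\<close> the true invariant
  density it is the limit criterion.\<close>

definition criterion ::
    "(real \<Rightarrow> real \<Rightarrow> real) \<Rightarrow> (real \<Rightarrow> real) \<Rightarrow> (real \<Rightarrow> real) \<Rightarrow> (real \<Rightarrow> real) \<Rightarrow> real \<Rightarrow> real" where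
  "criterion \<mu> \<sigma> w f \<theta> =
     (LINT x|lborel. (\<mu> x \<theta> * f x - 1 / 2 * deriv (\<lambda>y. (\<sigma> y)\<^sup>2 * f y) x)\<^sup>2 * w x)"

definition limit_score ::
    "real set \<Rightarrow> (real \<Rightarrow> real \<Rightarrow> real) \<Rightarrow> (real \<Rightarrow> real) \<Rightarrow> (real \<Rightarrow> real) \<Rightarrow>
     (real \<Rightarrow> real \<Rightarrow> real) \<Rightarrow> real \<Rightarrow> real \<Rightarrow> real" where
  "limit_score \<Theta> \<mu> \<sigma> w \<pi> \<theta>\<^sub>0 x =
     2 * param_deriv \<Theta> (\<mu> x) \<theta>\<^sub>0 * \<mu> x \<theta>\<^sub>0 * \<pi> x \<theta>\<^sub>0 * w x +
     deriv (\<lambda>y. param_deriv \<Theta> (\<mu> y) \<theta>\<^sub>0 * \<pi> y \<theta>\<^sub>0 * w y) x * (\<sigma> x)\<^sup>2"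

end

theory Submission
  imports Defs
begin

text \<open>Write \<open>\<pi>\<close> for the invariant density at \<open>\<theta>\<^sub>0\<close>, \<open>e\<close> for the error of the kernel estimator, \<open>N = n + 1\<close> and
  \<open>L f = \<mu> f - (\<sigma>\<^sup>2 f)' / 2\<close>, so that \<open>L \<pi> = 0\<close>. At \<open>\<theta>\<^sub>0\<close> the derivative of the empirical
  criterion is \<open>2 \<integral> L(\<pi> + e) \<mu>\<^sub>\<theta> (\<pi> + e) w\<close>. Its part linear in \<open>e\<close> is, after integrating by parts,
  \<open>\<integral> v (\<pi> + e)\<close>, which up to a bias of order \<open>h\<^sup>\<alpha>\<close> is the sample mean of \<open>v(Z\<^sub>j)\<close>; its quadratic part
  contains \<open>e\<close> and \<open>e e'\<close>, hence integrates by parts to \<open>\<integral> q e\<^sup>2\<close> with \<open>q\<close> integrable, which is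
  \<open>o(1 / sqrt N)\<close> in mean. The assumptions make \<open>v\<close> bounded, so the central limit theorem for bounded
  strongly mixing sequences with summable coefficients applies; it is proved with Bernstein blocks.
  By the same bounds the derivative of the empirical criterion at \<open>\<theta>\<close> differs from its value at
  \<open>\<theta>\<^sub>0\<close> by \<open>(\<theta> - \<theta>\<^sub>0) (R''(\<theta>\<^sub>0) + o(1))\<close>, and it vanishes at the consistent estimator.\<close>

section \<open>Calculus on the line\<close>

text \<open>The smoothness of \<pi> is given only through mean square shifts of its \<alpha>-th
  derivative, whereas the errors are integrated against an envelope \<open>G\<close>, so that bounds
  at each fixed x, uniform in x, are wanted. A function whose derivative has bounded shifts in mean
  square is uniformly close to affine on intervals of length 1; this yields a uniform bias of order
  \<open>h ^ (\<alpha> - 1)\<close>. The lost power is harmless: in the terms multiplied by sqrt N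
  the bias of the density enters only squared, and the linear term carries the bias of
  \<open>v\<close>, which keeps the full power \<alpha>. The variance is estimated crudely, by
  treating kernel sums as sums of bounded mixing variables: order 1 / (N h^2) for the estimate and 1
  / (N h^4) for its derivative. Growth of n h^4 is what makes sqrt N / (N h^2) and 1 / (N h^4)
  vanish. The derivative of the estimate only has to be consistent, because integration by parts
  removes \<open>e'\<close> from the quadratic term at \<open>\<theta>\<^sub>0\<close>. Every
  estimate holds in mean, by Fubini, so no control of the estimate in supremum norm is
  required.\<close>

lemma has_real_derivative_integral:
  fixes f f' :: "real \<Rightarrow> real \<Rightarrow> real"
  assumes deriv: "\<And>x \<theta>. \<theta> \<in> {a..b} \<Longrightarrow> (f x has_real_derivative f' x \<theta>) (at \<theta> within {a..b})"
    and bound: "\<And>x \<theta>. \<theta> \<in> {a..b} \<Longrightarrow> \<bar>f' x \<theta>\<bar> \<le> g x" "integrable lborel g"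
    and int: "\<And>\<theta>. \<theta> \<in> {a..b} \<Longrightarrow> integrable lborel (\<lambda>x. f x \<theta>)"
    and meas: "(\<lambda>x. f' x t) \<in> borel_measurable borel" and t: "t \<in> {a..b}"
  shows "((\<lambda>\<theta>. LINT x|lborel. f x \<theta>) has_real_derivative (LINT x|lborel. f' x t)) (at t within {a..b})"
proof -
  \<comment> \<open>The mean value inequality on the interval makes \<open>g\<close> dominate the
    difference quotients. The limit is then taken along sequences, the form in which dominated
    convergence applies.\<close>
  have lip: "\<bar>f x y - f x t\<bar> \<le> g x * \<bar>y - t\<bar>" if "y \<in> {a..b}" for x y
  proof -
    have "norm (f x y - f x t) \<le> g x * norm (y - t)"
      by (rule field_differentiable_bound[of "{a..b}" "f x" "f' x"]) (use deriv bound that t in auto)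
    then show ?thesis by simp
  qed
  have "((\<lambda>y. ((LINT x|lborel. f x y) - (LINT x|lborel. f x t)) / (y - t)) \<longlongrightarrow> (LINT x|lborel. f' x t))
      (at t within {a..b})"
    unfolding tendsto_at_iff_sequentially comp_def
  proof safe
    fix X :: "nat \<Rightarrow> real"
    assume X: "\<forall>i. X i \<in> {a..b} - {t}" "X \<longlonglongrightarrow> t"
    have "(\<lambda>i. LINT x|lborel. (f x (X i) - f x t) / (X i - t)) \<longlonglongrightarrow> (LINT x|lborel. f' x t)"
    proof (rule integral_dominated_convergence[where w = g])
      show "AE x in lborel. (\<lambda>i. (f x (X i) - f x t) / (X i - t)) \<longlonglongrightarrow> f' x t"
      proof (rule AE_I2)
        fix x
        have "((\<lambda>y. (f x y - f x t) / (y - t)) \<longlongrightarrow> f' x t) (at t within {a..b})"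
          using deriv[OF t, of x] by (simp add: has_field_derivative_iff)
        then show "(\<lambda>i. (f x (X i) - f x t) / (X i - t)) \<longlonglongrightarrow> f' x t"
          using X unfolding tendsto_at_iff_sequentially comp_def by auto
      qed
      show "AE x in lborel. norm ((f x (X i) - f x t) / (X i - t)) \<le> g x" for i
      proof (rule AE_I2)
        fix x
        have "X i \<noteq> t" "X i \<in> {a..b}" using X by auto
        then show "norm ((f x (X i) - f x t) / (X i - t)) \<le> g x"
          using lip[of "X i" x] by (simp add: field_simps)
      qed
      show "(\<lambda>x. (f x (X i) - f x t) / (X i - t)) \<in> borel_measurable lborel" for i
        using int[of "X i"] int[OF t] X by (intro borel_measurable_divide borel_measurable_diff) auto
    qed (use meas bound in auto)
    moreover have "(LINT x|lborel. (f x (X i) - f x t) / (X i - t)) =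
        ((LINT x|lborel. f x (X i)) - (LINT x|lborel. f x t)) / (X i - t)" for i
      using int[of "X i"] int[OF t] X by (simp add: Bochner_Integration.integral_diff)
    ultimately show "(\<lambda>i. ((LINT x|lborel. f x (X i)) - (LINT x|lborel. f x t)) / (X i - t))
        \<longlonglongrightarrow> (LINT x|lborel. f' x t)" by (simp only:)
  qed
  then show ?thesis by (simp add: has_field_derivative_iff)
qed

text \<open>This is how integration by parts is used below: \<open>F\<close> is a product and the
  caller splits \<open>F'\<close>. On \<open>{-n..n}\<close> the fundamental theorem leaves boundary
  terms only, which vanish in the limit.\<close>

lemma integral_derivative_vanishing_at_infinity:
  fixes F F' :: "real \<Rightarrow> real"
  assumes deriv: "\<And>x. (F has_real_derivative F' x) (at x)"
    and cont: "continuous_on UNIV F'" and int: "integrable lborel F'"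
    and lim: "(F \<longlongrightarrow> 0) at_infinity"
  shows "(LINT x|lborel. F' x) = 0"
proof -
  have "(\<lambda>n. LINT x|lborel. F' x * indicator {- real n..real n} x) \<longlonglongrightarrow> (LINT x|lborel. F' x)"
  proof (rule integral_dominated_convergence[where w = "\<lambda>x. \<bar>F' x\<bar>"])
    show "AE x in lborel. (\<lambda>n. F' x * indicator {- real n..real n} x) \<longlonglongrightarrow> F' x"
    proof (rule AE_I2)
      fix x
      have "eventually (\<lambda>n. F' x * indicator {- real n..real n} x = F' x) sequentially"
        using eventually_ge_at_top[of "nat \<lceil>\<bar>x\<bar>\<rceil>"]
        by eventually_elim (auto split: split_indicator)
      then show "(\<lambda>n. F' x * indicator {- real n..real n} x) \<longlonglongrightarrow> F' x"
        by (rule tendsto_eventually)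
    qed
  qed (use int in \<open>auto split: split_indicator\<close>)
  moreover have "(LINT x|lborel. F' x * indicator {- real n..real n} x) = F (real n) - F (- real n)" for n
    by (rule integral_FTC_Icc_real) (use deriv cont in \<open>auto simp: continuous_on_eq_continuous_at\<close>)
  moreover have "(\<lambda>n. F (real n) - F (- real n)) \<longlonglongrightarrow> 0 - 0"
  proof (intro tendsto_diff)
    have "filterlim (\<lambda>n. real n) at_infinity sequentially"
      by (rule filterlim_real_sequentially[THEN filterlim_at_top_imp_at_infinity])
    moreover from this have "filterlim (\<lambda>n. - real n) at_infinity sequentially"
      by (simp add: filterlim_at_infinity[OF order.refl])
    ultimately show "(\<lambda>n. F (real n)) \<longlonglongrightarrow> 0" "(\<lambda>n. F (- real n)) \<longlonglongrightarrow> 0"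
      using lim by (auto intro: filterlim_compose)
  qed
  ultimately show ?thesis
    using LIMSEQ_unique by fastforce
qed

text \<open>The slope \<open>c\<close> stands in for a derivative of order \<open>m + 1\<close>, on
  which there is no pointwise hold; only closeness of \<open>d m\<close> to an affine function is
  used. In the induction the derivative of the remainder is the remainder of the shifted sequence
  \<open>d (Suc k)\<close>, and each integration gains one factor of the distance.\<close>

lemma Taylor_linear_oscillation:
  fixes d :: "nat \<Rightarrow> real \<Rightarrow> real"
  assumes "\<And>k z. k < m \<Longrightarrow> (d k has_real_derivative d (Suc k) z) (at z)"
    and "\<And>z. \<bar>z - x\<bar> \<le> \<rho> \<Longrightarrow> \<bar>d m z - d m x - c * (z - x)\<bar> \<le> C"
    and "\<bar>z - x\<bar> \<le> \<rho>" and "0 \<le> C"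
  shows "\<bar>d 0 z - (\<Sum>k\<le>m. d k x / fact k * (z - x) ^ k) - c / fact (Suc m) * (z - x) ^ Suc m\<bar>
           \<le> C * \<bar>z - x\<bar> ^ m"
  using assms
proof (induction m arbitrary: d z)
  case 0
  then show ?case by simp
next
  case (Suc m)
  define r where "r = (\<lambda>z. d 0 z - (\<Sum>k\<le>Suc m. d k x / fact k * (z - x) ^ k)
      - c / fact (Suc (Suc m)) * (z - x) ^ Suc (Suc m))"
  define r' where "r' = (\<lambda>z. d 1 z - (\<Sum>k\<le>m. d (Suc k) x / fact k * (z - x) ^ k)
      - c / fact (Suc m) * (z - x) ^ Suc m)"
  have r'_bound: "\<bar>r' y\<bar> \<le> C * \<bar>y - x\<bar> ^ m" if "\<bar>y - x\<bar> \<le> \<rho>" for y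
    using Suc.IH[of "\<lambda>k. d (Suc k)" y] Suc.prems that unfolding r'_def by simp
  \<comment> \<open>With the constant term peeled off, each remaining summand differentiates to the
    corresponding summand of \<open>r'\<close>, one factorial lower.\<close>
  have r_deriv: "(r has_real_derivative r' y) (at y)" for y
  proof -
    have "r = (\<lambda>z. d 0 z - (d 0 x + (\<Sum>k\<le>m. d (Suc k) x / fact (Suc k) * (z - x) ^ Suc k))
        - c / fact (Suc (Suc m)) * (z - x) ^ Suc (Suc m))"
      unfolding r_def by (simp add: sum.atMost_Suc_shift del: sum.atMost_Suc fact_Suc power_Suc)
    moreover have "((\<lambda>z. d 0 z - (d 0 x + (\<Sum>k\<le>m. d (Suc k) x / fact (Suc k) * (z - x) ^ Suc k))
        - c / fact (Suc (Suc m)) * (z - x) ^ Suc (Suc m)) has_real_derivative r' y) (at y)"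
    proof -
      have 1: "((\<lambda>z. e / fact (Suc k) * (z - x) ^ Suc k) has_real_derivative
          e / fact k * (y - x) ^ k) (at y)" for e k
        by (rule derivative_eq_intros refl)+ (simp add: field_simps del: of_nat_Suc)
      have "((\<lambda>z. \<Sum>k\<le>m. d (Suc k) x / fact (Suc k) * (z - x) ^ Suc k) has_real_derivative
          (\<Sum>k\<le>m. d (Suc k) x / fact k * (y - x) ^ k)) (at y)"
        by (intro DERIV_sum 1)
      then show ?thesis
        unfolding r'_def
        using DERIV_diff[OF DERIV_diff[OF Suc.prems(1)[of 0 y] DERIV_add[OF DERIV_const[of "d 0 x"]]] 1[of c "Suc m"]]
        by simp
    qed
    ultimately show ?thesis by simp
  qed
  have "r x = 0"
    unfolding r_def by (simp add: sum.atMost_Suc_shift del: sum.atMost_Suc)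
  \<comment> \<open>On the ball of radius \<open>\<bar>z - x\<bar>\<close> the derivative is at most
    \<open>C * \<bar>z - x\<bar> ^ m\<close>; the mean value inequality contributes the missing
    factor.\<close>
  have "norm (r z - r x) \<le> (C * \<bar>z - x\<bar> ^ m) * norm (z - x)"
  proof (rule field_differentiable_bound[of "{y. \<bar>y - x\<bar> \<le> \<bar>z - x\<bar>}" r r'])
    have "{y. \<bar>y - x\<bar> \<le> \<bar>z - x\<bar>} = cball x \<bar>z - x\<bar>"
      by (auto simp: dist_real_def)
    then show "convex {y. \<bar>y - x\<bar> \<le> \<bar>z - x\<bar>}" by simp
    show "norm (r' y) \<le> C * \<bar>z - x\<bar> ^ m" if "y \<in> {y. \<bar>y - x\<bar> \<le> \<bar>z - x\<bar>}" for y
    proof -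
      have "\<bar>r' y\<bar> \<le> C * \<bar>y - x\<bar> ^ m"
        using that Suc.prems by (intro r'_bound) simp
      also have "\<dots> \<le> C * \<bar>z - x\<bar> ^ m"
        using that Suc.prems by (intro mult_left_mono power_mono) auto
      finally show ?thesis by simp
    qed
  qed (use r_deriv in \<open>auto intro: DERIV_subset\<close>)
  then show ?case
    using \<open>r x = 0\<close> unfolding r_def by (simp add: ac_simps)
qed

text \<open>By Fubini, some \<open>s\<close> within \<open>1 / 2\<close> of \<open>x\<close> has \<open>t \<mapsto> f (s + t) - f s\<close> square integrable on \<open>[-1, 1]\<close>
  with a bound independent of \<open>x\<close>; the slope is \<open>c = f s\<close>.\<close>

lemma L2_shift_bound_imp_linear_oscillation:
  fixes g f :: "real \<Rightarrow> real"
  assumes deriv: "\<And>x. (g has_real_derivative f x) (at x)"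
    and shift: "\<And>t. integrable lborel (\<lambda>x. (f (x + t) - f x)\<^sup>2)"
      "\<And>t. sqrt (LINT x|lborel. (f (x + t) - f x)\<^sup>2) \<le> L"
  obtains C where "C \<ge> 0" "\<And>x. \<exists>c. \<forall>z. \<bar>z - x\<bar> \<le> 1 / 2 \<longrightarrow> \<bar>g z - g x - c * (z - x)\<bar> \<le> C"
proof -
  have g_cont: "continuous_on UNIV g"
    using deriv by (intro DERIV_continuous_on) (auto intro: DERIV_subset)
  \<comment> \<open>As a mere derivative \<open>f\<close> may be discontinuous; it is measurable as
    a pointwise limit of continuous difference quotients.\<close>
  have f_meas[measurable]: "f \<in> borel_measurable borel"
  proof (rule borel_measurable_LIMSEQ_real[of borel "\<lambda>n x. (g (x + 1 / real (Suc n)) - g x) / (1 / real (Suc n))"])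
    fix x
    have "((\<lambda>h. (g (x + h) - g x) / h) \<longlongrightarrow> f x) (at 0)"
      using deriv[of x] by (simp add: DERIV_def)
    moreover have "filterlim (\<lambda>n. 1 / real (Suc n)) (at 0) sequentially"
      unfolding filterlim_at using LIMSEQ_Suc[OF lim_1_over_n] by (auto simp: field_simps)
    ultimately show "(\<lambda>n. (g (x + 1 / real (Suc n)) - g x) / (1 / real (Suc n))) \<longlonglongrightarrow> f x"
      by (rule filterlim_compose)
  next
    show "(\<lambda>x. (g (x + 1 / real (Suc n)) - g x) / (1 / real (Suc n))) \<in> borel_measurable borel" for n
      by (intro borel_measurable_continuous_onI continuous_intros continuous_on_compose2[OF g_cont]) auto
  qed
  have shift_nn: "(\<integral>\<^sup>+s. ennreal ((f (s + t) - f s)\<^sup>2) \<partial>lborel) \<le> ennreal (L\<^sup>2)" for t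
  proof -
    have "(LINT x|lborel. (f (x + t) - f x)\<^sup>2) \<le> L\<^sup>2"
      using shift(2)[of t] by (metis real_sqrt_le_iff real_sqrt_ge_0_iff sqrt_le_D order.trans integral_nonneg_AE zero_le_power2 AE_I2)
    then show ?thesis
      by (subst nn_integral_eq_integral[OF shift(1)]) (auto intro: ennreal_leI)
  qed
  \<comment> \<open>The interval \<open>?J\<close> has length 2 and \<open>?I\<close> has length 1,
    so averaging over \<open>s\<close> in \<open>?I\<close> gives at most
    \<open>2 * L\<^sup>2\<close>; the added 1 produces the strict contradiction.\<close>
  define B where "B = 2 * L\<^sup>2 + 1"
  have B_pos: "B > 0" unfolding B_def by (simp add: add_nonneg_pos)
  have "\<exists>c. \<forall>z. \<bar>z - x\<bar> \<le> 1 / 2 \<longrightarrow> \<bar>g z - g x - c * (z - x)\<bar> \<le> 1 + B" for x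
  proof -
    let ?I = "{x - 1 / 2..x + 1 / 2}" and ?J = "{- 1..1::real}"
    have "\<exists>s\<in>?I. (\<integral>\<^sup>+t. ennreal ((f (s + t) - f s)\<^sup>2) * indicator ?J t \<partial>lborel) < ennreal B"
    proof (rule ccontr)
      assume "\<not> ?thesis"
      then have "(\<integral>\<^sup>+s. ennreal B * indicator ?I s \<partial>lborel) \<le>
          (\<integral>\<^sup>+s. (\<integral>\<^sup>+t. ennreal ((f (s + t) - f s)\<^sup>2) * indicator ?J t \<partial>lborel) \<partial>lborel)"
        by (intro nn_integral_mono) (auto split: split_indicator simp: not_less)
      also have "\<dots> = (\<integral>\<^sup>+t. (\<integral>\<^sup>+s. ennreal ((f (s + t) - f s)\<^sup>2) * indicator ?J t \<partial>lborel) \<partial>lborel)"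
        by (rule lborel_pair.Fubini') measurable
      also have "\<dots> \<le> (\<integral>\<^sup>+t. ennreal (L\<^sup>2) * indicator ?J t \<partial>lborel)"
      proof (intro nn_integral_mono)
        fix t
        show "(\<integral>\<^sup>+s. ennreal ((f (s + t) - f s)\<^sup>2) * indicator ?J t \<partial>lborel) \<le> ennreal (L\<^sup>2) * indicator ?J t"
          using shift_nn[of t] by (subst nn_integral_multc) (auto intro: mult_right_mono)
      qed
      also have "\<dots> = ennreal (2 * L\<^sup>2)"
        by (simp add: nn_integral_cmult ennreal_mult'' mult.commute)
      also have "(\<integral>\<^sup>+s. ennreal B * indicator ?I s \<partial>lborel) = ennreal B"
        by (simp add: nn_integral_cmult)
      finally show False
        unfolding B_def by (simp add: ennreal_le_iff)
    qed
    then obtain s where s: "s \<in> ?I"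
      and le: "(\<integral>\<^sup>+t. ennreal ((f (s + t) - f s)\<^sup>2) * indicator ?J t \<partial>lborel) < ennreal B" by auto
    define c where "c = f s"
    \<comment> \<open>Since \<open>s\<close> itself lies in \<open>?I\<close>, every
      \<open>y\<close> in \<open>?I\<close> has the form \<open>s + t\<close> with \<open>t\<close>
      in \<open>?J\<close>.\<close>
    have "(\<integral>\<^sup>+y. ennreal ((f y - c)\<^sup>2) * indicator ?I y \<partial>lborel) =
        (\<integral>\<^sup>+t. ennreal ((f (s + t) - c)\<^sup>2) * indicator ?I (s + t) \<partial>lborel)"
      using nn_integral_real_affine[of "\<lambda>y. ennreal ((f y - c)\<^sup>2) * indicator ?I y" 1 s] by simp
    also have "\<dots> \<le> (\<integral>\<^sup>+t. ennreal ((f (s + t) - f s)\<^sup>2) * indicator ?J t \<partial>lborel)"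
      unfolding c_def using s by (intro nn_integral_mono) (auto split: split_indicator)
    finally have L2: "(\<integral>\<^sup>+y. ennreal ((f y - c)\<^sup>2 * indicator ?I y) \<partial>lborel) < ennreal B"
      using le by (simp add: ennreal_mult' ennreal_indicator)
    have sq_int: "integrable lborel (\<lambda>y. (f y - c)\<^sup>2 * indicator ?I y)"
      using L2 by (intro integrableI_nonneg) (auto intro: order.strict_trans)
    have sq_le: "(LINT y|lborel. (f y - c)\<^sup>2 * indicator ?I y) \<le> B"
      using L2 B_pos by (subst (asm) nn_integral_eq_integral[OF sq_int]) (auto simp: ennreal_less_iff)
    have dom_int: "integrable lborel (\<lambda>y. indicator ?I y + (f y - c)\<^sup>2 * indicator ?I y :: real)"
      using sq_int by (intro Bochner_Integration.integrable_add) auto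
    have dom_le: "(LINT y|lborel. indicator ?I y + (f y - c)\<^sup>2 * indicator ?I y) \<le> 1 + B"
      using sq_le sq_int by (subst Bochner_Integration.integral_add) auto
    \<comment> \<open>Without continuity of \<open>f\<close>, the fundamental theorem is available
      only for the gauge integral. Absolute integrability on the segment identifies that integral
      with the Lebesgue integral.\<close>
    have seg: "\<bar>(g q - c * q) - (g p - c * p)\<bar> \<le> 1 + B" if "p \<le> q" "{p..q} \<subseteq> ?I" for p q
    proof -
      have *: "((\<lambda>y. f y - c) has_integral (g q - c * q) - (g p - c * p)) {p..q}"
      proof (rule fundamental_theorem_of_calculus[OF that(1)])
        fix y
        have "((\<lambda>y. g y - c * y) has_real_derivative f y - c) (at y)"
          by (rule derivative_eq_intros deriv refl)+ simp
        then show "((\<lambda>y. g y - c * y) has_vector_derivative f y - c) (at y within {p..q})"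
          by (simp add: has_real_derivative_iff_has_vector_derivative has_vector_derivative_at_within)
      qed
      \<comment> \<open>The inequality \<open>\<bar>y\<bar> \<le> 1 + y\<^sup>2\<close> takes the
        place of Cauchy-Schwarz and accounts for the bound \<open>1 + B\<close>.\<close>
      have ptw: "norm (indicator {p..q} y *\<^sub>R (f y - c)) \<le> indicator ?I y + (f y - c)\<^sup>2 * indicator ?I y" for y
      proof -
        have "\<bar>f y - c\<bar> \<le> 1 + (f y - c)\<^sup>2"
          using sum_squares_bound[of "\<bar>f y - c\<bar>" 1] by (simp, smt (verit, best))
        then show ?thesis using that(2) by (auto split: split_indicator)
      qed
      have int: "set_integrable lborel {p..q} (\<lambda>y. f y - c)"
        unfolding set_integrable_def
        by (rule Bochner_Integration.integrable_bound[OF dom_int]) (use ptw in \<open>auto intro: order.trans[OF _ abs_ge_self]\<close>)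
      have eq: "(g q - c * q) - (g p - c * p) = (LINT y:{p..q}|lborel. f y - c)"
        using set_borel_integral_eq_integral(2)[OF int] integral_unique[OF *] by (simp only:)
      have "norm (LINT y:{p..q}|lborel. f y - c) \<le> (LINT y|lborel. indicator ?I y + (f y - c)\<^sup>2 * indicator ?I y)"
        unfolding set_lebesgue_integral_def
        by (rule Bochner_Integration.integral_norm_bound_integral[OF int[unfolded set_integrable_def] dom_int ptw])
      from order.trans[OF this dom_le] show ?thesis unfolding eq real_norm_def .
    qed
    show ?thesis
    proof (intro exI[of _ c] allI impI)
      fix z assume z: "\<bar>z - x\<bar> \<le> 1 / 2"
      show "\<bar>g z - g x - c * (z - x)\<bar> \<le> 1 + B"
      proof (cases "x \<le> z")
        case True
        then show ?thesis using seg[of x z] z by (auto simp: algebra_simps)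
      next
        case False
        then show ?thesis using seg[of z x] z by (auto simp: algebra_simps abs_minus_commute)
      qed
    qed
  qed
  then show ?thesis using that[of "1 + B"] B_pos by auto
qed

section \<open>Stationary strongly mixing sequences\<close>

lemma space_generated_algebra [simp]: "space (generated_algebra M Y I) = space M"
  unfolding generated_algebra_def by (simp add: space_measure_of_conv)

lemma measurable_generated_algebra:
  assumes "i \<in> I"
  shows "Y i \<in> borel_measurable (generated_algebra M Y I)"
proof (rule measurableI)
  fix B :: "real set" assume "B \<in> sets borel"
  moreover have "(\<Union>i\<in>I. {Y i -` B \<inter> space M | B. B \<in> sets borel}) \<subseteq> Pow (space M)" by auto
  ultimately show "Y i -` B \<inter> space (generated_algebra M Y I) \<in> sets (generated_algebra M Y I)"
    using assms unfolding generated_algebra_def by (auto intro!: sigma_sets.Basic)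
qed simp

lemma sets_generated_algebra_subset:
  assumes "\<And>i. i \<in> I \<Longrightarrow> Y i \<in> borel_measurable N" "space N = space M"
  shows "sets (generated_algebra M Y I) \<subseteq> sets N"
proof -
  have sub: "(\<Union>i\<in>I. {Y i -` B \<inter> space M | B. B \<in> sets borel}) \<subseteq> Pow (space M)" by auto
  have "(\<Union>i\<in>I. {Y i -` B \<inter> space M | B. B \<in> sets borel}) \<subseteq> sets N"
  proof safe
    fix i B assume "i \<in> I" "B \<in> sets (borel :: real measure)"
    then show "Y i -` B \<inter> space M \<in> sets N"
      using measurable_sets[OF assms(1)[of i], of B] assms(2) by simp
  qed
  from sets.sigma_sets_subset[OF this] show ?thesis
    unfolding generated_algebra_def sets_measure_of[OF sub] assms(2) .
qed

lemma sets_generated_algebra_mono: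
  "I \<subseteq> J \<Longrightarrow> sets (generated_algebra M Y I) \<subseteq> sets (generated_algebra M Y J)"
  by (rule sets_generated_algebra_subset) (auto intro: measurable_generated_algebra)

lemma subalgebra_generated_algebra:
  assumes "\<And>i. i \<in> I \<Longrightarrow> Y i \<in> borel_measurable M"
  shows "subalgebra M (generated_algebra M Y I)"
  unfolding subalgebra_def using sets_generated_algebra_subset[OF assms refl] by simp

lemma Cesaro_mean_tendsto:
  fixes x :: "nat \<Rightarrow> real"
  assumes "x \<longlonglongrightarrow> l"
  shows "(\<lambda>n. (\<Sum>i<n. x i) / real n) \<longlonglongrightarrow> l"
proof (rule LIMSEQ_I)
  fix \<epsilon> :: real assume \<epsilon>: "\<epsilon> > 0"
  obtain N where N: "\<And>i. i \<ge> N \<Longrightarrow> \<bar>x i - l\<bar> < \<epsilon> / 2"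
    using LIMSEQ_D[OF assms, of "\<epsilon> / 2"] \<epsilon> by auto
  define S where "S = (\<Sum>i<N. \<bar>x i - l\<bar>)"
  show "\<exists>n0. \<forall>n\<ge>n0. norm ((\<Sum>i<n. x i) / real n - l) < \<epsilon>"
  proof (intro exI allI impI)
    fix n assume n: "n \<ge> nat \<lceil>2 * S / \<epsilon>\<rceil> + N + 1"
    have "2 * S / \<epsilon> < real n" using n by linarith
    then have S: "S < real n * \<epsilon> / 2" using \<epsilon> by (simp add: field_simps)
    have "(\<Sum>i<n. x i) / real n - l = (\<Sum>i<n. x i - l) / real n"
      using n by (simp add: sum_subtractf field_simps)
    moreover have "\<bar>\<Sum>i<n. x i - l\<bar> \<le> S + real n * (\<epsilon> / 2)"
    proof -
      have "\<bar>\<Sum>i<n. x i - l\<bar> \<le> (\<Sum>i<n. \<bar>x i - l\<bar>)" by (rule sum_abs)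
      also have split: "{..<n} = {..<N} \<union> {N..<n}" using n by auto
      also have "(\<Sum>i\<in>{..<N} \<union> {N..<n}. \<bar>x i - l\<bar>) = S + (\<Sum>i\<in>{N..<n}. \<bar>x i - l\<bar>)"
        unfolding S_def by (intro sum.union_disjoint) auto
      also have "(\<Sum>i\<in>{N..<n}. \<bar>x i - l\<bar>) \<le> (\<Sum>i\<in>{N..<n}. \<epsilon> / 2)"
        using N by (intro sum_mono) (auto intro: less_imp_le)
      also have "\<dots> \<le> real n * (\<epsilon> / 2)" using \<epsilon> by (simp add: mult_right_mono)
      finally show ?thesis by (simp only: split)
    qed
    ultimately show "norm ((\<Sum>i<n. x i) / real n - l) < \<epsilon>"
      using S n \<epsilon> by (simp add: field_simps)
  qed
qed

text \<open>The covariance is \<open>E[f k]\<close> for the conditional expectation \<open>k\<close> of \<open>g - E g\<close> given \<open>F\<close>, and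
  this is extremal when \<open>f\<close> is the indicator of \<open>k > 0\<close> or of \<open>k < 0\<close>.\<close>

lemma (in prob_space) covariance_bound_of_events:
  assumes F: "subalgebra M F" and f: "f \<in> borel_measurable F" "\<And>\<omega>. \<omega> \<in> space M \<Longrightarrow> 0 \<le> f \<omega> \<and> f \<omega> \<le> 1"
    and g: "integrable M g"
    and events: "\<And>A. A \<in> sets F \<Longrightarrow> \<bar>expectation (\<lambda>\<omega>. indicator A \<omega> * g \<omega>) - prob A * expectation g\<bar> \<le> c"
  shows "\<bar>expectation (\<lambda>\<omega>. f \<omega> * g \<omega>) - expectation f * expectation g\<bar> \<le> c"
proof -
  interpret finite_measure_subalgebra M F by unfold_locales (rule F)
  have f_M[measurable]: "f \<in> borel_measurable M" using measurable_from_subalg[OF F f(1)] .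
  define g0 where "g0 = (\<lambda>\<omega>. g \<omega> - expectation g)"
  define k where "k = real_cond_exp M F g0"
  have g0: "integrable M g0" unfolding g0_def using g by simp
  have k: "integrable M k" "k \<in> borel_measurable F" unfolding k_def using g0 by auto
  have int: "integrable M (\<lambda>\<omega>. u \<omega> * g0 \<omega>)" "integrable M (\<lambda>\<omega>. u \<omega> * k \<omega>)"
      "expectation (\<lambda>\<omega>. u \<omega> * g0 \<omega>) = expectation (\<lambda>\<omega>. u \<omega> * k \<omega>)"
    if u: "u \<in> borel_measurable F" "\<And>\<omega>. \<omega> \<in> space M \<Longrightarrow> 0 \<le> u \<omega> \<and> u \<omega> \<le> 1" for u
  proof -
    have uM: "u \<in> borel_measurable M" using measurable_from_subalg[OF F u(1)] .
    have "integrable M (\<lambda>\<omega>. u \<omega> * y \<omega>)" if "integrable M y" for y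
      by (rule Bochner_Integration.integrable_bound[OF that])
        (use uM that u(2) in \<open>auto simp: abs_mult intro!: mult_left_le_one_le\<close>)
    then show "integrable M (\<lambda>\<omega>. u \<omega> * g0 \<omega>)" "integrable M (\<lambda>\<omega>. u \<omega> * k \<omega>)" using g0 k by auto
    then show "expectation (\<lambda>\<omega>. u \<omega> * g0 \<omega>) = expectation (\<lambda>\<omega>. u \<omega> * k \<omega>)"
      unfolding k_def using real_cond_exp_intg(2)[of u g0] u(1) g0 by simp
  qed
  have ind: "(indicator A :: _ \<Rightarrow> real) \<in> borel_measurable F" if "A \<in> sets F" for A
    using that by simp
  have ev: "\<bar>expectation (\<lambda>\<omega>. indicator A \<omega> * k \<omega>)\<bar> \<le> c" if A: "A \<in> sets F" for A
  proof -
    have AM: "A \<in> sets M" using A F by (auto simp: subalgebra_def)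
    have "expectation (\<lambda>\<omega>. indicator A \<omega> * k \<omega>) = expectation (\<lambda>\<omega>. indicator A \<omega> * g0 \<omega>)"
      by (rule int(3)[symmetric, OF ind[OF A]]) (auto split: split_indicator)
    also have "\<dots> = expectation (\<lambda>\<omega>. indicator A \<omega> * g \<omega> - indicator A \<omega> * expectation g)"
      unfolding g0_def by (simp add: algebra_simps)
    also have "\<dots> = expectation (\<lambda>\<omega>. indicator A \<omega> * g \<omega>) - prob A * expectation g"
    proof -
      have "integrable M (indicator A :: _ \<Rightarrow> real)"
        by (rule integrable_const_bound[of _ 1]) (use AM in auto)
      then show ?thesis
        using AM g integrable_mult_indicator[OF AM g] by (subst Bochner_Integration.integral_diff) auto
    qed
    finally show ?thesis using events[OF A] by simp
  qed
  have sets: "{\<omega>\<in>space M. 0 < k \<omega>} \<in> sets F" "{\<omega>\<in>space M. k \<omega> < 0} \<in> sets F"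
  proof -
    have "space F = space M" using F by (simp add: subalgebra_def)
    then show "{\<omega>\<in>space M. 0 < k \<omega>} \<in> sets F" "{\<omega>\<in>space M. k \<omega> < 0} \<in> sets F"
      using measurable_sets[OF k(2), of "{0<..}"] measurable_sets[OF k(2), of "{..<0}"]
      by (auto simp: vimage_def Int_def conj_commute)
  qed
  let ?P = "{\<omega>\<in>space M. 0 < k \<omega>}" and ?N = "{\<omega>\<in>space M. k \<omega> < 0}"
  have "expectation (\<lambda>\<omega>. f \<omega> * k \<omega>) \<le> expectation (\<lambda>\<omega>. indicator ?P \<omega> * k \<omega>)"
  proof (intro integral_mono)
    show "integrable M (\<lambda>\<omega>. f \<omega> * k \<omega>)" using int(2)[OF f] .
    show "integrable M (\<lambda>\<omega>. indicator ?P \<omega> * k \<omega>)"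
      by (rule int(2)[OF ind[OF sets(1)]]) (auto split: split_indicator)
    fix \<omega> assume "\<omega> \<in> space M"
    then show "f \<omega> * k \<omega> \<le> indicator ?P \<omega> * k \<omega>"
      using f(2)[of \<omega>] by (auto split: split_indicator simp: mult_nonneg_nonpos)
  qed
  moreover have "expectation (\<lambda>\<omega>. indicator ?N \<omega> * k \<omega>) \<le> expectation (\<lambda>\<omega>. f \<omega> * k \<omega>)"
  proof (intro integral_mono)
    show "integrable M (\<lambda>\<omega>. f \<omega> * k \<omega>)" using int(2)[OF f] .
    show "integrable M (\<lambda>\<omega>. indicator ?N \<omega> * k \<omega>)"
      by (rule int(2)[OF ind[OF sets(2)]]) (auto split: split_indicator)
    fix \<omega> assume "\<omega> \<in> space M"
    then show "indicator ?N \<omega> * k \<omega> \<le> f \<omega> * k \<omega>"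
      using f(2)[of \<omega>] mult_right_mono_neg[of "f \<omega>" 1 "k \<omega>"] by (auto split: split_indicator)
  qed
  moreover have "expectation (\<lambda>\<omega>. f \<omega> * k \<omega>) = expectation (\<lambda>\<omega>. f \<omega> * g \<omega>) - expectation f * expectation g"
  proof -
    have fi: "integrable M f"
      by (rule integrable_const_bound[of _ 1]) (use f(2) in auto)
    have fg: "integrable M (\<lambda>\<omega>. f \<omega> * g \<omega>)"
      by (rule Bochner_Integration.integrable_bound[OF g])
        (use g f(2) in \<open>auto simp: abs_mult intro!: mult_left_le_one_le\<close>)
    have "expectation (\<lambda>\<omega>. f \<omega> * k \<omega>) = expectation (\<lambda>\<omega>. f \<omega> * g0 \<omega>)"
      by (rule int(3)[OF f, symmetric])
    also have "\<dots> = expectation (\<lambda>\<omega>. f \<omega> * g \<omega> - f \<omega> * expectation g)"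
      unfolding g0_def by (simp add: algebra_simps)
    finally show ?thesis using fi fg by simp
  qed
  ultimately show ?thesis using ev[OF sets(1)] ev[OF sets(2)] by linarith
qed

text \<open>Stationarity is recorded for initial segments under integer shifts, as an identity of
  laws on a product space: this moves the expectation of any function of finitely many consecutive
  observations.\<close>

locale stationary_mixing = prob_space M for M :: "'a measure" +
  fixes Z :: "nat \<Rightarrow> 'a \<Rightarrow> real"
  assumes Z_measurable [measurable]: "\<And>j. Z j \<in> borel_measurable M"
    and stationary: "\<And>p m. distr M (PiM {..<p} (\<lambda>_. borel)) (\<lambda>\<omega>. \<lambda>j\<in>{..<p}. Z (j + m) \<omega>) =
        distr M (PiM {..<p} (\<lambda>_. borel)) (\<lambda>\<omega>. \<lambda>j\<in>{..<p}. Z j \<omega>)"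
    and summable_alpha: "summable (alpha_coeff M Z)"
begin

abbreviation past :: "nat \<Rightarrow> 'a measure" where "past m \<equiv> generated_algebra M Z {..m}"
abbreviation future :: "nat \<Rightarrow> 'a measure" where "future m \<equiv> generated_algebra M Z {m..}"

section \<open>Covariance inequalities from the mixing coefficients\<close>

lemma subalgebra_gen: "subalgebra M (generated_algebra M Z I)"
  by (rule subalgebra_generated_algebra) simp

lemma event_covariance_le_1: "\<bar>prob (A \<inter> B) - prob A * prob B\<bar> \<le> 1"
proof -
  have "0 \<le> prob A * prob B" "prob A * prob B \<le> 1" by (auto intro: mult_le_one)
  then show ?thesis using measure_nonneg[of M "A \<inter> B"] prob_le_1[of "A \<inter> B"] by linarith
qed

text \<open>A supremum of reals dominates its members only over a set that is bounded above. The
  bound 1 for covariances of events provides this for both nested suprema.\<close>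

lemma event_covariance_le_alpha:
  assumes "A \<in> sets (past m)" "B \<in> sets (future (m + k))"
  shows "\<bar>prob (A \<inter> B) - prob A * prob B\<bar> \<le> alpha_coeff M Z k"
proof -
  let ?f = "\<lambda>(A, B). \<bar>prob (A \<inter> B) - prob A * prob B\<bar>"
  let ?S = "\<lambda>m. sets (past m) \<times> sets (future (m + k))"
  have ne: "?S m \<noteq> {}" for m by (auto intro: sets.top)
  have bdd: "bdd_above (?f ` ?S m)" for m
    by (rule bdd_aboveI[of _ 1]) (auto simp: event_covariance_le_1)
  have le1: "(SUP x\<in>?S m. ?f x) \<le> 1" for m
    by (rule cSUP_least[OF ne]) (auto simp: event_covariance_le_1)
  have "?f (A, B) \<le> (SUP x\<in>?S m. ?f x)"
    using assms by (intro cSUP_upper[OF _ bdd]) auto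
  also have "\<dots> \<le> (SUP m. SUP x\<in>?S m. ?f x)"
    by (rule cSUP_upper) (auto intro!: bdd_aboveI[of _ 1] le1)
  finally show ?thesis unfolding alpha_coeff_def by simp
qed

lemma alpha_nonneg: "0 \<le> alpha_coeff M Z k"
  using event_covariance_le_alpha[of "{}" 0 "{}" k] by simp

text \<open>A wider gap shrinks the \<open>future\<close> sigma-algebra, and with it the set over
  which the supremum runs.\<close>

lemma alpha_antimono:
  assumes "k \<le> l"
  shows "alpha_coeff M Z l \<le> alpha_coeff M Z k"
proof -
  let ?f = "\<lambda>(A, B). \<bar>prob (A \<inter> B) - prob A * prob B\<bar>"
  have "(SUP x\<in>sets (past m) \<times> sets (future (m + l)). ?f x) \<le> alpha_coeff M Z k" for m
  proof (rule cSUP_least)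
    show "sets (past m) \<times> sets (future (m + l)) \<noteq> {}" by (auto intro: sets.top)
    fix x assume "x \<in> sets (past m) \<times> sets (future (m + l))"
    then show "?f x \<le> alpha_coeff M Z k"
      using event_covariance_le_alpha[of "fst x" m "snd x" k]
        sets_generated_algebra_mono[of "{m + l..}" "{m + k..}" M Z] assms
      by (auto simp: case_prod_beta)
  qed
  then show ?thesis unfolding alpha_coeff_def[of M Z l] by (rule cSUP_least[OF UNIV_not_empty])
qed

text \<open>The passage from functions to events is made twice, first for \<open>f\<close> and then
  for \<open>g\<close> against a fixed event. Extremal functions with values in the unit interval
  are indicators, so no constant is lost.\<close>

lemma covariance_unit_bound:
  assumes f: "f \<in> borel_measurable (past m)" "\<And>\<omega>. \<omega> \<in> space M \<Longrightarrow> 0 \<le> f \<omega> \<and> f \<omega> \<le> 1"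
    and g: "g \<in> borel_measurable (future (m + k))" "\<And>\<omega>. \<omega> \<in> space M \<Longrightarrow> 0 \<le> g \<omega> \<and> g \<omega> \<le> 1"
  shows "\<bar>expectation (\<lambda>\<omega>. f \<omega> * g \<omega>) - expectation f * expectation g\<bar> \<le> alpha_coeff M Z k"
proof (rule covariance_bound_of_events[OF subalgebra_gen f])
  have gM[measurable]: "g \<in> borel_measurable M" using measurable_from_subalg[OF subalgebra_gen g(1)] .
  show "integrable M g"
    by (rule integrable_const_bound[of _ 1]) (use g(2) in auto)
  fix A assume A: "A \<in> sets (past m)"
  then have AM[measurable]: "A \<in> sets M" using subalgebra_gen[of "{..m}"] by (auto simp: subalgebra_def)
  have "\<bar>expectation (\<lambda>\<omega>. g \<omega> * indicator A \<omega>) - expectation g * expectation (indicator A)\<bar>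
      \<le> alpha_coeff M Z k"
  proof (rule covariance_bound_of_events[OF subalgebra_gen g])
    fix B assume B: "B \<in> sets (future (m + k))"
    then have BM[measurable]: "B \<in> sets M" using subalgebra_gen[of "{m + k..}"] by (auto simp: subalgebra_def)
    have "(\<lambda>\<omega>. indicator B \<omega> * indicator A \<omega>) = (indicator (A \<inter> B) :: _ \<Rightarrow> real)"
      by (auto split: split_indicator)
    then show "\<bar>expectation (\<lambda>\<omega>. indicator B \<omega> * indicator A \<omega>) - prob B * expectation (indicator A)\<bar>
        \<le> alpha_coeff M Z k"
      using event_covariance_le_alpha[OF A B] by (simp add: mult.commute)
  next
    show "integrable M (indicator A :: _ \<Rightarrow> real)"
      by (rule integrable_const_bound[of _ 1]) auto
  qed
  then show "\<bar>expectation (\<lambda>\<omega>. indicator A \<omega> * g \<omega>) - prob A * expectation g\<bar> \<le> alpha_coeff M Z k"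
    by (simp add: mult.commute)
qed

text \<open>Affine maps carry \<open>f\<close> and \<open>g\<close> into the unit interval. They
  divide the covariance by \<open>(2 * B) * (2 * D)\<close>, which is the origin of the factor
  4.\<close>

lemma covariance_bound:
  assumes f: "f \<in> borel_measurable (past m)" "\<And>\<omega>. \<omega> \<in> space M \<Longrightarrow> \<bar>f \<omega>\<bar> \<le> B"
    and g: "g \<in> borel_measurable (future (m + k))" "\<And>\<omega>. \<omega> \<in> space M \<Longrightarrow> \<bar>g \<omega>\<bar> \<le> D"
    and BD: "B > 0" "D > 0"
  shows "\<bar>expectation (\<lambda>\<omega>. f \<omega> * g \<omega>) - expectation f * expectation g\<bar> \<le> 4 * B * D * alpha_coeff M Z k"
proof -
  have fM[measurable]: "f \<in> borel_measurable M" using measurable_from_subalg[OF subalgebra_gen f(1)] .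
  have gM[measurable]: "g \<in> borel_measurable M" using measurable_from_subalg[OF subalgebra_gen g(1)] .
  have fi: "integrable M f" by (rule integrable_const_bound[of _ B]) (use f(2) in auto)
  have gi: "integrable M g" by (rule integrable_const_bound[of _ D]) (use g(2) in auto)
  have fgi: "integrable M (\<lambda>\<omega>. f \<omega> * g \<omega>)"
    by (rule integrable_const_bound[of _ "B * D"]) (use f(2) g(2) BD in \<open>auto simp: abs_mult intro!: mult_mono\<close>)
  define u v where "u = (\<lambda>\<omega>. (f \<omega> + B) / (2 * B))" and "v = (\<lambda>\<omega>. (g \<omega> + D) / (2 * D))"
  have "\<bar>expectation (\<lambda>\<omega>. u \<omega> * v \<omega>) - expectation u * expectation v\<bar> \<le> alpha_coeff M Z k"
  proof (rule covariance_unit_bound)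
    show "u \<in> borel_measurable (past m)" "v \<in> borel_measurable (future (m + k))"
      unfolding u_def v_def using f(1) g(1) by measurable
    show "0 \<le> u \<omega> \<and> u \<omega> \<le> 1" if "\<omega> \<in> space M" for \<omega>
      using f(2)[OF that] BD unfolding u_def by (auto simp: field_simps)
    show "0 \<le> v \<omega> \<and> v \<omega> \<le> 1" if "\<omega> \<in> space M" for \<omega>
      using g(2)[OF that] BD unfolding v_def by (auto simp: field_simps)
  qed
  moreover have "expectation (\<lambda>\<omega>. u \<omega> * v \<omega>) - expectation u * expectation v =
      (expectation (\<lambda>\<omega>. f \<omega> * g \<omega>) - expectation f * expectation g) / (4 * B * D)"
  proof -
    have "expectation u = (expectation f + B) / (2 * B)" "expectation v = (expectation g + D) / (2 * D)"
      unfolding u_def v_def using fi gi by (simp_all add: prob_space)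
    then have "expectation u * expectation v =
        (expectation f * expectation g + D * expectation f + B * expectation g + B * D) / (4 * B * D)"
      by (simp only: times_divide_times_eq) (simp add: algebra_simps)
    moreover have "(\<lambda>\<omega>. u \<omega> * v \<omega>) = (\<lambda>\<omega>. (f \<omega> * g \<omega> + D * f \<omega> + B * g \<omega> + B * D) / (4 * B * D))"
      unfolding u_def v_def by (rule ext) (simp add: field_simps)
    then have "expectation (\<lambda>\<omega>. u \<omega> * v \<omega>) =
        (expectation (\<lambda>\<omega>. f \<omega> * g \<omega>) + D * expectation f + B * expectation g + B * D) / (4 * B * D)"
      using fi gi fgi by (simp add: prob_space)
    ultimately show ?thesis by (simp add: diff_divide_distrib[symmetric])
  qed
  ultimately show ?thesis using BD by (simp add: field_simps abs_mult)
qed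

text \<open>Real and imaginary part of the covariance combine two real covariances each, every one
  at most \<open>4 * alpha_coeff M Z k\<close>; the modulus is at most the sum of the two
  parts.\<close>

lemma cmod_covariance_bound:
  fixes f g :: "'a \<Rightarrow> complex"
  assumes f: "f \<in> borel_measurable (past m)" "\<And>\<omega>. \<omega> \<in> space M \<Longrightarrow> cmod (f \<omega>) \<le> 1"
    and g: "g \<in> borel_measurable (future (m + k))" "\<And>\<omega>. \<omega> \<in> space M \<Longrightarrow> cmod (g \<omega>) \<le> 1"
  shows "cmod (expectation (\<lambda>\<omega>. f \<omega> * g \<omega>) - expectation f * expectation g) \<le> 16 * alpha_coeff M Z k"
proof -
  have fM[measurable]: "f \<in> borel_measurable M" using measurable_from_subalg[OF subalgebra_gen f(1)] .
  have gM[measurable]: "g \<in> borel_measurable M" using measurable_from_subalg[OF subalgebra_gen g(1)] .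
  have fi: "integrable M f" by (rule integrable_const_bound[of _ 1]) (use f(2) in auto)
  have gi: "integrable M g" by (rule integrable_const_bound[of _ 1]) (use g(2) in auto)
  have fgi: "integrable M (\<lambda>\<omega>. f \<omega> * g \<omega>)"
    by (rule integrable_const_bound[of _ 1]) (use f(2) g(2) in \<open>auto simp: norm_mult intro!: mult_le_one\<close>)
  define C where "C = (\<lambda>(u :: 'a \<Rightarrow> real) v. expectation (\<lambda>\<omega>. u \<omega> * v \<omega>) - expectation u * expectation v)"
  let ?fr = "\<lambda>\<omega>. Re (f \<omega>)" and ?fi = "\<lambda>\<omega>. Im (f \<omega>)" and ?gr = "\<lambda>\<omega>. Re (g \<omega>)" and ?gi = "\<lambda>\<omega>. Im (g \<omega>)"
  have bnd: "\<bar>C u v\<bar> \<le> 4 * alpha_coeff M Z k" if "u \<in> {?fr, ?fi}" "v \<in> {?gr, ?gi}" for u v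
  proof -
    have "\<bar>C u v\<bar> \<le> 4 * 1 * 1 * alpha_coeff M Z k"
      unfolding C_def
    proof (rule covariance_bound[where m = m])
      show "u \<in> borel_measurable (past m)" "v \<in> borel_measurable (future (m + k))"
        using that f(1) g(1) by auto
    qed (use that f(2) g(2) in \<open>auto intro: order.trans[OF abs_Re_le_cmod] order.trans[OF abs_Im_le_cmod]\<close>)
    then show ?thesis by simp
  qed
  have prod_int: "integrable M (\<lambda>\<omega>. u \<omega> * v \<omega>)" if "u \<in> {?fr, ?fi}" "v \<in> {?gr, ?gi}" for u v
  proof (rule integrable_const_bound[of _ 1])
    show "AE \<omega> in M. norm (u \<omega> * v \<omega>) \<le> 1"
      using that f(2) g(2) by (auto simp: abs_mult intro!: mult_le_one AE_I2
        intro: order.trans[OF abs_Re_le_cmod] order.trans[OF abs_Im_le_cmod])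
  qed (use that in auto)
  define E where "E = expectation (\<lambda>\<omega>. f \<omega> * g \<omega>) - expectation f * expectation g"
  have "Re E = C ?fr ?gr - C ?fi ?gi"
    unfolding E_def C_def using fi gi fgi prod_int
    by (simp add: integral_Re[symmetric] integral_Im[symmetric] del: integral_Re integral_Im)
  moreover have "Im E = C ?fr ?gi + C ?fi ?gr"
    unfolding E_def C_def using fi gi fgi prod_int
    by (simp add: integral_Re[symmetric] integral_Im[symmetric] del: integral_Re integral_Im)
  ultimately have "\<bar>Re E\<bar> \<le> 8 * alpha_coeff M Z k" "\<bar>Im E\<bar> \<le> 8 * alpha_coeff M Z k"
    using bnd[of ?fr ?gr] bnd[of ?fi ?gi] bnd[of ?fr ?gi] bnd[of ?fi ?gr] by (auto simp: abs_le_iff)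
  then show ?thesis using cmod_le[of E] unfolding E_def by linarith
qed

section \<open>Second moments of partial sums\<close>

lemma stationary_expectation:
  fixes G :: "(nat \<Rightarrow> real) \<Rightarrow> 'b::{banach, second_countable_topology}"
  assumes [measurable]: "G \<in> borel_measurable (PiM {..<p} (\<lambda>_. borel))"
  shows "expectation (\<lambda>\<omega>. G (\<lambda>j\<in>{..<p}. Z (j + m) \<omega>)) = expectation (\<lambda>\<omega>. G (\<lambda>j\<in>{..<p}. Z j \<omega>))"
proof -
  have "expectation (\<lambda>\<omega>. G (\<lambda>j\<in>{..<p}. Z (j + m) \<omega>)) =
      integral\<^sup>L (distr M (PiM {..<p} (\<lambda>_. borel)) (\<lambda>\<omega>. \<lambda>j\<in>{..<p}. Z (j + m) \<omega>)) G"
    by (subst integral_distr) auto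
  also have "\<dots> = expectation (\<lambda>\<omega>. G (\<lambda>j\<in>{..<p}. Z j \<omega>))"
    unfolding stationary by (subst integral_distr) auto
  finally show ?thesis .
qed

lemma stationary_mean:
  fixes f :: "real \<Rightarrow> real"
  assumes [measurable]: "f \<in> borel_measurable borel"
  shows "expectation (\<lambda>\<omega>. f (Z j \<omega>)) = expectation (\<lambda>\<omega>. f (Z 0 \<omega>))"
  using stationary_expectation[of "\<lambda>y. f (y 0)" 1 j] by simp

lemma stationary_pair:
  fixes f :: "real \<Rightarrow> real"
  assumes [measurable]: "f \<in> borel_measurable borel"
  shows "expectation (\<lambda>\<omega>. f (Z j \<omega>) * f (Z (j + d) \<omega>)) = expectation (\<lambda>\<omega>. f (Z 0 \<omega>) * f (Z d \<omega>))"
  using stationary_expectation[of "\<lambda>y. f (y 0) * f (y d)" "Suc d" j] by (simp add: add.commute)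

text \<open>Each lag occurs at most twice, once on either side of \<open>i\<close>.\<close>

lemma sum_alpha_distance_le:
  assumes "finite J"
  shows "(\<Sum>j\<in>J. alpha_coeff M Z (if i \<le> j then j - i else i - j)) \<le> 2 * suminf (alpha_coeff M Z)"
proof -
  have *: "(\<Sum>j\<in>I. alpha_coeff M Z (r j)) \<le> suminf (alpha_coeff M Z)" if "finite I" "inj_on r I" for I and r :: "nat \<Rightarrow> nat"
  proof -
    have "(\<Sum>j\<in>I. alpha_coeff M Z (r j)) = (\<Sum>k\<in>r ` I. alpha_coeff M Z k)"
      using that by (simp add: sum.reindex)
    also have "\<dots> \<le> suminf (alpha_coeff M Z)"
      using that by (intro sum_le_suminf summable_alpha) (auto intro: alpha_nonneg)
    finally show ?thesis .
  qed
  have "(\<Sum>j\<in>J. alpha_coeff M Z (if i \<le> j then j - i else i - j)) =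
      (\<Sum>j\<in>{j\<in>J. i \<le> j}. alpha_coeff M Z (j - i)) + (\<Sum>j\<in>{j\<in>J. \<not> i \<le> j}. alpha_coeff M Z (i - j))"
    using assms by (subst sum.Int_Diff[of J _ "{j. i \<le> j}"]) (auto intro!: arg_cong2[of _ _ _ _ "(+)"] sum.cong)
  also have "\<dots> \<le> suminf (alpha_coeff M Z) + suminf (alpha_coeff M Z)"
    using assms by (intro add_mono *) (auto simp: inj_on_def)
  finally show ?thesis by simp
qed

text \<open>The factor 8 is the 4 of the covariance inequality times the 2 for indices on either
  side.\<close>

definition mixing_const :: real where "mixing_const = 8 * suminf (alpha_coeff M Z)"

lemma mixing_const_nonneg: "mixing_const \<ge> 0"
  unfolding mixing_const_def using suminf_nonneg[OF summable_alpha alpha_nonneg] by simp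

lemma covariance_pair_bound:
  assumes f[measurable]: "f \<in> borel_measurable borel" and B: "\<And>x. \<bar>f x\<bar> \<le> B" "B > 0"
    and mean: "expectation (\<lambda>\<omega>. f (Z 0 \<omega>)) = 0"
  shows "\<bar>expectation (\<lambda>\<omega>. f (Z j \<omega>) * f (Z (j + k) \<omega>))\<bar> \<le> 4 * B\<^sup>2 * alpha_coeff M Z k"
proof -
  have "\<bar>expectation (\<lambda>\<omega>. f (Z j \<omega>) * f (Z (j + k) \<omega>)) -
      expectation (\<lambda>\<omega>. f (Z j \<omega>)) * expectation (\<lambda>\<omega>. f (Z (j + k) \<omega>))\<bar> \<le> 4 * B * B * alpha_coeff M Z k"
    using B by (intro covariance_bound[where m = j])
      (auto intro!: measurable_compose[OF measurable_generated_algebra])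
  then show ?thesis using stationary_mean[OF f] mean by (simp add: power2_eq_square mult.assoc)
qed

lemma second_moment_sum_bound:
  assumes f[measurable]: "f \<in> borel_measurable borel" and B: "\<And>x. \<bar>f x\<bar> \<le> B" "B > 0"
    and mean: "expectation (\<lambda>\<omega>. f (Z 0 \<omega>)) = 0" and J: "finite J"
  shows "expectation (\<lambda>\<omega>. (\<Sum>j\<in>J. f (Z j \<omega>))\<^sup>2) \<le> mixing_const * B\<^sup>2 * card J"
proof -
  have int: "integrable M (\<lambda>\<omega>. f (Z i \<omega>) * f (Z j \<omega>))" for i j
    by (rule integrable_const_bound[of _ "B * B"]) (use B in \<open>auto simp: abs_mult intro!: mult_mono\<close>)
  have "expectation (\<lambda>\<omega>. (\<Sum>j\<in>J. f (Z j \<omega>))\<^sup>2) = (\<Sum>i\<in>J. \<Sum>j\<in>J. expectation (\<lambda>\<omega>. f (Z i \<omega>) * f (Z j \<omega>)))"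
    using int by (simp add: power2_eq_square sum_product)
  also have "\<dots> \<le> (\<Sum>i\<in>J. \<Sum>j\<in>J. 4 * B\<^sup>2 * alpha_coeff M Z (if i \<le> j then j - i else i - j))"
  proof (intro sum_mono)
    fix i j
    show "expectation (\<lambda>\<omega>. f (Z i \<omega>) * f (Z j \<omega>)) \<le>
        4 * B\<^sup>2 * alpha_coeff M Z (if i \<le> j then j - i else i - j)"
      using covariance_pair_bound[OF f B mean, of i "j - i"] covariance_pair_bound[OF f B mean, of j "i - j"]
      by (auto simp: mult.commute)
  qed
  also have "\<dots> = 4 * B\<^sup>2 * (\<Sum>i\<in>J. \<Sum>j\<in>J. alpha_coeff M Z (if i \<le> j then j - i else i - j))"
    by (simp only: sum_distrib_left)
  also have "\<dots> \<le> 4 * B\<^sup>2 * (\<Sum>i\<in>J. 2 * suminf (alpha_coeff M Z))"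
    by (intro mult_left_mono sum_mono sum_alpha_distance_le[OF J]) auto
  finally show ?thesis unfolding mixing_const_def by (simp add: ac_simps)
qed

text \<open>The second moment of the sum of \<open>p\<close> terms has the increments
  \<open>v p\<close>, each a partial sum of the covariance series. They converge to the long-run
  variance, hence so do their Cesaro means.\<close>

lemma second_moment_average_limit:
  assumes f[measurable]: "f \<in> borel_measurable borel" and B: "\<And>x. \<bar>f x\<bar> \<le> B" "B > 0"
    and mean: "expectation (\<lambda>\<omega>. f (Z 0 \<omega>)) = 0"
  shows "(\<lambda>p. expectation (\<lambda>\<omega>. (\<Sum>j<p. f (Z j \<omega>))\<^sup>2) / real p) \<longlonglongrightarrow>
    expectation (\<lambda>\<omega>. (f (Z 0 \<omega>))\<^sup>2) + 2 * (\<Sum>j. expectation (\<lambda>\<omega>. f (Z 0 \<omega>) * f (Z (Suc j) \<omega>)))"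
proof -
  define c where "c = (\<lambda>d. expectation (\<lambda>\<omega>. f (Z 0 \<omega>) * f (Z d \<omega>)))"
  have int: "integrable M (\<lambda>\<omega>. f (Z i \<omega>) * f (Z j \<omega>))" for i j
    by (rule integrable_const_bound[of _ "B * B"]) (use B in \<open>auto simp: abs_mult intro!: mult_mono\<close>)
  have sums_int: "integrable M (\<lambda>\<omega>. (\<Sum>j<p. f (Z j \<omega>))\<^sup>2)" for p
    using int by (simp add: power2_eq_square sum_product)
  define v where "v = (\<lambda>p. c 0 + 2 * (\<Sum>d<p. c (Suc d)))"
  have eq: "expectation (\<lambda>\<omega>. (\<Sum>j<p. f (Z j \<omega>))\<^sup>2) = (\<Sum>i<p. v i)" for p
  proof (induction p)
    case (Suc p)
    have "expectation (\<lambda>\<omega>. (\<Sum>j<Suc p. f (Z j \<omega>))\<^sup>2) =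
        expectation (\<lambda>\<omega>. (\<Sum>j<p. f (Z j \<omega>))\<^sup>2 + (f (Z p \<omega>) * f (Z p \<omega>) + 2 * (\<Sum>j<p. f (Z j \<omega>) * f (Z p \<omega>))))"
      by (rule arg_cong[where f = expectation])
        (simp add: fun_eq_iff power2_eq_square algebra_simps sum_distrib_left sum_distrib_right)
    also have "\<dots> = (\<Sum>i<p. v i) + (expectation (\<lambda>\<omega>. f (Z p \<omega>) * f (Z p \<omega>)) +
        2 * (\<Sum>j<p. expectation (\<lambda>\<omega>. f (Z j \<omega>) * f (Z p \<omega>))))"
      using int sums_int by (simp add: Suc)
    also have "expectation (\<lambda>\<omega>. f (Z p \<omega>) * f (Z p \<omega>)) = c 0"
      using stationary_pair[OF f, of p 0] unfolding c_def by simp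
    also have "(\<Sum>j<p. expectation (\<lambda>\<omega>. f (Z j \<omega>) * f (Z p \<omega>))) = (\<Sum>j<p. c (Suc (p - Suc j)))"
    proof (intro sum.cong refl)
      fix j assume "j \<in> {..<p}"
      then show "expectation (\<lambda>\<omega>. f (Z j \<omega>) * f (Z p \<omega>)) = c (Suc (p - Suc j))"
        using stationary_pair[OF f, of j "p - j"] unfolding c_def by (simp add: Suc_diff_Suc)
    qed
    also have "\<dots> = (\<Sum>d<p. c (Suc d))" by (rule sum.nat_diff_reindex)
    finally show ?case by (simp add: v_def)
  qed simp
  have "summable (\<lambda>d. c (Suc d))"
  proof (rule summable_comparison_test')
    show "summable (\<lambda>d. 4 * B\<^sup>2 * alpha_coeff M Z (Suc d))"
      using summable_alpha by (intro summable_mult) (simp add: summable_Suc_iff)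
    show "norm (c (Suc d)) \<le> 4 * B\<^sup>2 * alpha_coeff M Z (Suc d)" for d
      using covariance_pair_bound[OF f B mean, of 0 "Suc d"] unfolding c_def by simp
  qed
  then have "v \<longlonglongrightarrow> c 0 + 2 * (\<Sum>d. c (Suc d))"
    unfolding v_def by (intro tendsto_intros summable_LIMSEQ)
  from Cesaro_mean_tendsto[OF this] show ?thesis
    unfolding eq unfolding c_def by (simp add: power2_eq_square)
qed

end

text \<open>The two-stage limit of the proof: a tuning parameter \<open>L\<close> is fixed while
  \<open>n\<close> grows, and is sent to infinity afterwards. In the central limit theorem it is the
  ratio of block to gap length, later the radius of a neighbourhood of the true parameter.\<close>

lemma tendsto_zero_of_double_limit:
  fixes a :: "nat \<Rightarrow> real"
  assumes nonneg: "\<And>n. 0 \<le> a n"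
    and le: "\<And>L. eventually (\<lambda>n. a n \<le> D L n) sequentially"
    and lim: "\<And>L. D L \<longlonglongrightarrow> d L" "d \<longlonglongrightarrow> 0"
  shows "a \<longlonglongrightarrow> 0"
proof (rule LIMSEQ_I)
  fix \<epsilon> :: real assume \<epsilon>: "\<epsilon> > 0"
  obtain L where "d L < \<epsilon>"
    using order_tendstoD(2)[OF lim(2) \<epsilon>] by (auto simp: eventually_sequentially)
  from order_tendstoD(2)[OF lim(1) this] le[of L]
  have "eventually (\<lambda>n. norm (a n - 0) < \<epsilon>) sequentially"
    by eventually_elim (use nonneg in \<open>auto intro: order.strict_trans1\<close>)
  then show "\<exists>n0. \<forall>n\<ge>n0. norm (a n - 0) < \<epsilon>" by (simp add: eventually_sequentially)
qed

lemma abs_exp_minus_linear_le: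
  fixes y :: real
  assumes "0 \<le> y"
  shows "\<bar>1 - y - exp (- y)\<bar> \<le> y\<^sup>2"
proof -
  \<comment> \<open>After multiplication by \<open>exp y\<close>, the upper bound for
    \<open>exp (- y)\<close> follows from the quadratic Taylor minorant of \<open>exp\<close> and
    this polynomial inequality.\<close>
  have "1 \<le> (1 - y + y\<^sup>2) * (1 + y + y\<^sup>2 / 2)"
  proof -
    have "(1 - y + y\<^sup>2) * (1 + y + y\<^sup>2 / 2) = 1 + y\<^sup>2 / 2 + y ^ 3 / 2 + y ^ 4 / 2"
      by (simp add: field_simps power2_eq_square power3_eq_cube power4_eq_xxxx)
    then show ?thesis using assms by simp
  qed
  also have "\<dots> \<le> (1 - y + y\<^sup>2) * exp y"
  proof (intro mult_left_mono exp_lower_Taylor_quadratic assms)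
    have "0 \<le> (y - 1 / 2)\<^sup>2 + 3 / 4" by simp
    also have "\<dots> = 1 - y + y\<^sup>2" by (simp add: power2_eq_square field_simps)
    finally show "0 \<le> 1 - y + y\<^sup>2" .
  qed
  finally have "exp (- y) \<le> 1 - y + y\<^sup>2"
    by (simp add: exp_minus field_simps)
  moreover have "1 - y \<le> exp (- y)" using exp_ge_add_one_self[of "- y"] by simp
  ultimately show ?thesis by auto
qed

lemma cmod_iexp_diff_le: "cmod (iexp x - iexp y) \<le> \<bar>x - y\<bar>"
proof -
  have "iexp x - iexp y = iexp y * (iexp (x - y) - 1)"
    by (simp add: right_diff_distrib exp_add[symmetric] algebra_simps)
  then have "cmod (iexp x - iexp y) = cmod (iexp (x - y) - 1)"
    by (simp add: norm_mult)
  also have "\<dots> \<le> \<bar>x - y\<bar>"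
    using iexp_approx1[of "x - y" 0] by simp
  finally show ?thesis .
qed

lemma (in prob_space) integrable_square_of_bounded:
  fixes Y :: "'a \<Rightarrow> real"
  assumes [measurable]: "Y \<in> borel_measurable M" and D: "\<And>\<omega>. \<omega> \<in> space M \<Longrightarrow> \<bar>Y \<omega>\<bar> \<le> D"
  shows "integrable M (\<lambda>\<omega>. (Y \<omega>)\<^sup>2)"
proof (rule integrable_const_bound[of _ "D\<^sup>2"])
  show "AE \<omega> in M. norm ((Y \<omega>)\<^sup>2) \<le> D\<^sup>2"
  proof (rule AE_I2)
    fix \<omega> assume "\<omega> \<in> space M"
    from power_mono[OF D[OF this] abs_ge_zero, of 2] show "norm ((Y \<omega>)\<^sup>2) \<le> D\<^sup>2" by simp
  qed
qed measurable

section \<open>Bernstein blocks and the central limit theorem\<close>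

context stationary_mixing
begin

text \<open>A classical fact on decreasing summable sequences: about \<open>q / 2\<close> terms with
  index from \<open>q div 2\<close> to \<open>q\<close> are at least the \<open>q\<close>-th, so
  that \<open>q\<close> times this term is at most twice a Cauchy difference of partial
  sums.\<close>

lemma alpha_little_o_inverse: "(\<lambda>q. real q * alpha_coeff M Z q) \<longlonglongrightarrow> 0"
proof -
  define S where "S = (\<lambda>n. \<Sum>k<n. alpha_coeff M Z k)"
  have S: "S \<longlonglongrightarrow> suminf (alpha_coeff M Z)"
    unfolding S_def by (rule summable_LIMSEQ[OF summable_alpha])
  have div2: "filterlim (\<lambda>q::nat. q div 2) sequentially sequentially"
    unfolding filterlim_at_top
  proof
    fix N :: nat
    show "eventually (\<lambda>q. N \<le> q div 2) sequentially"
      using eventually_ge_at_top[of "2 * N"] by eventually_elim simp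
  qed
  have "(\<lambda>q. 2 * (S q - S (q div 2))) \<longlonglongrightarrow> 2 * (suminf (alpha_coeff M Z) - suminf (alpha_coeff M Z))"
    by (intro tendsto_intros S filterlim_compose[OF S div2])
  then have lim: "(\<lambda>q. 2 * (S q - S (q div 2))) \<longlonglongrightarrow> 0" by simp
  show ?thesis
  proof (rule tendsto_sandwich[OF _ _ tendsto_const lim])
    show "eventually (\<lambda>q. real q * alpha_coeff M Z q \<le> 2 * (S q - S (q div 2))) sequentially"
    proof (rule always_eventually, rule allI)
      fix q
      have "real q * alpha_coeff M Z q \<le> 2 * (real (q - q div 2) * alpha_coeff M Z q)"
      proof -
        have "q \<le> 2 * (q - q div 2)" by presburger
        then have "real q \<le> 2 * real (q - q div 2)" by linarith
        from mult_right_mono[OF this alpha_nonneg] show ?thesis by (simp only: mult.assoc)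
      qed
      also have "real (q - q div 2) * alpha_coeff M Z q = (\<Sum>k\<in>{q div 2..<q}. alpha_coeff M Z q)" by simp
      also have "\<dots> \<le> (\<Sum>k\<in>{q div 2..<q}. alpha_coeff M Z k)"
        by (intro sum_mono alpha_antimono) simp
      also have "\<dots> = S q - S (q div 2)"
        unfolding S_def using sum_diff[of "{..<q}" "{..<q div 2}" "alpha_coeff M Z"]
        by (simp add: lessThan_minus_lessThan)
      finally show "real q * alpha_coeff M Z q \<le> 2 * (S q - S (q div 2))" by simp
    qed
  qed (simp add: alpha_nonneg)
qed

text \<open>The blocks are split off one at a time from the right. Each step costs one covariance
  across a gap of length \<open>q\<close>; errors do not amplify, as all characteristic functions
  have modulus at most 1, and stationarity makes all factors equal.\<close>

lemma char_block_product:
  fixes f :: "real \<Rightarrow> real" and s :: real and p q :: nat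
  assumes [measurable]: "f \<in> borel_measurable borel"
  defines "U \<equiv> \<lambda>r \<omega>. \<Sum>j<p. f (Z (r * (p + q) + j) \<omega>)"
  shows "cmod (expectation (\<lambda>\<omega>. iexp (s * (\<Sum>r<k. U r \<omega>))) - expectation (\<lambda>\<omega>. iexp (s * U 0 \<omega>)) ^ k)
    \<le> real k * (16 * alpha_coeff M Z q)"
proof (induction k)
  case 0
  then show ?case by (simp add: prob_space)
next
  case (Suc k)
  let ?P = "\<lambda>k \<omega>. iexp (s * (\<Sum>r<k. U r \<omega>))" and ?e = "expectation (\<lambda>\<omega>. iexp (s * U 0 \<omega>))"
  have [measurable]: "U r \<in> borel_measurable M" for r unfolding U_def by measurable
  have char_le: "cmod (expectation (\<lambda>\<omega>. iexp (Y \<omega>))) \<le> 1"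
    if [measurable]: "Y \<in> borel_measurable M" for Y
  proof -
    have "cmod (expectation (\<lambda>\<omega>. iexp (Y \<omega>))) \<le> expectation (\<lambda>\<omega>. cmod (iexp (Y \<omega>)))"
      by (rule integral_norm_bound)
    then show ?thesis by (simp add: prob_space)
  qed
  have U_stat: "expectation (\<lambda>\<omega>. iexp (s * U k \<omega>)) = ?e"
    using stationary_expectation[of "\<lambda>y. iexp (s * (\<Sum>j<p. f (y j)))" p "k * (p + q)"]
    unfolding U_def by (simp add: add.commute)
  have prod: "?P (Suc k) = (\<lambda>\<omega>. ?P k \<omega> * iexp (s * U k \<omega>))"
    by (simp add: fun_eq_iff ring_distribs exp_add[symmetric])
  have step: "cmod (expectation (?P (Suc k)) - expectation (?P k) * ?e) \<le> 16 * alpha_coeff M Z q"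
  \<comment> \<open>Block 0 has no predecessor, and for it the truncated subtraction in
    \<open>m\<close> below would be wrong.\<close>
  proof (cases k)
    case 0
    then show ?thesis using alpha_nonneg[of q] by (simp add: prob_space)
  next
    case (Suc k')
    \<comment> \<open>\<open>m\<close> is the position right after block \<open>k - 1\<close>:
      earlier blocks end before it, and block \<open>k\<close> starts exactly \<open>q\<close>
      later.\<close>
    define m where "m = k * (p + q) - q"
    have m: "m + q = k * (p + q)" unfolding m_def Suc by simp
    have "cmod (expectation (?P (Suc k)) - expectation (?P k) * expectation (\<lambda>\<omega>. iexp (s * U k \<omega>)))
        \<le> 16 * alpha_coeff M Z q"
      unfolding prod
    proof (rule cmod_covariance_bound[where m = m])
      have ix: "r * (p + q) + j \<in> {..m}" if "r < k" "j < p" for r j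
      proof -
        have "Suc r * (p + q) \<le> k * (p + q)" using that by (intro mult_le_mono1) simp
        then have "r * (p + q) + (p + q) \<le> m + q" unfolding m by simp
        then show ?thesis using that(2) by simp
      qed
      have [measurable]: "(\<lambda>\<omega>. \<Sum>r<k. U r \<omega>) \<in> borel_measurable (past m)"
        unfolding U_def
        by (intro borel_measurable_sum measurable_compose[OF measurable_generated_algebra[OF ix] assms(1)]) auto
      have [measurable]: "U k \<in> borel_measurable (future (m + q))"
        unfolding U_def m
        by (intro borel_measurable_sum measurable_compose[OF measurable_generated_algebra assms(1)]) auto
      show "?P k \<in> borel_measurable (past m)" "(\<lambda>\<omega>. iexp (s * U k \<omega>)) \<in> borel_measurable (future (m + q))"
        by measurable
    qed auto
    then show ?thesis unfolding U_stat .
  qed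
  have triangle: "cmod (x - e ^ Suc k) \<le> cmod (x - y * e) + cmod (y - e ^ k) * cmod e" for x y e :: complex
  proof -
    have eq: "x - e ^ Suc k = (x - y * e) + (y - e ^ k) * e" by (simp add: algebra_simps)
    show ?thesis
      using norm_triangle_ineq[of "x - y * e" "(y - e ^ k) * e"] unfolding eq norm_mult .
  qed
  have "cmod (expectation (?P (Suc k)) - ?e ^ Suc k) \<le>
      cmod (expectation (?P (Suc k)) - expectation (?P k) * ?e) + cmod (expectation (?P k) - ?e ^ k) * cmod ?e"
    by (rule triangle)
  moreover have "cmod (expectation (?P k) - ?e ^ k) * cmod ?e \<le> (real k * (16 * alpha_coeff M Z q)) * 1"
    by (rule mult_mono[OF Suc.IH char_le]) (auto simp: alpha_nonneg)
  ultimately have "cmod (expectation (?P (Suc k)) - ?e ^ Suc k) \<le>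
      16 * alpha_coeff M Z q + (real k * (16 * alpha_coeff M Z q)) * 1"
    using step by linarith
  also have "\<dots> = real (Suc k) * (16 * alpha_coeff M Z q)" by (simp add: algebra_simps)
  finally show ?case .
qed

text \<open>One factor of the cubic Taylor remainder is traded for the bound \<open>D\<close>, so
  that the error is again a multiple of the second moment.\<close>

lemma char_second_order:
  fixes U :: "'a \<Rightarrow> real"
  assumes [measurable]: "U \<in> borel_measurable M" and D: "\<And>\<omega>. \<omega> \<in> space M \<Longrightarrow> \<bar>U \<omega>\<bar> \<le> D"
    and mean: "expectation U = 0"
  shows "cmod (expectation (\<lambda>\<omega>. iexp (s * U \<omega>)) - complex_of_real (1 - s\<^sup>2 * expectation (\<lambda>\<omega>. (U \<omega>)\<^sup>2) / 2))
    \<le> \<bar>s\<bar> ^ 3 * D * expectation (\<lambda>\<omega>. (U \<omega>)\<^sup>2) / 6"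
proof -
  have U: "integrable M U"
    by (rule integrable_const_bound[of _ D]) (use D in auto)
  have U2: "integrable M (\<lambda>\<omega>. (U \<omega>)\<^sup>2)"
    by (rule integrable_square_of_bounded[OF assms(1) D])
  define T where "T = (\<lambda>\<omega>. \<i> * complex_of_real (s * U \<omega>) + complex_of_real (1 - s\<^sup>2 * (U \<omega>)\<^sup>2 / 2))"
  have T1: "complex_integrable M (\<lambda>\<omega>. complex_of_real (s * U \<omega>))"
    and T2: "complex_integrable M (\<lambda>\<omega>. complex_of_real (1 - s\<^sup>2 * (U \<omega>)\<^sup>2 / 2))"
    using U U2 by (intro integrable_of_real; simp)+
  then have Tint: "integrable M T" unfolding T_def by simp
  have Eint: "integrable M (\<lambda>\<omega>. iexp (s * U \<omega>))"
    by (rule integrable_const_bound[of _ 1]) auto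
  have TE: "expectation T = complex_of_real (1 - s\<^sup>2 * expectation (\<lambda>\<omega>. (U \<omega>)\<^sup>2) / 2)"
  proof -
    have "expectation T = \<i> * complex_of_real (expectation (\<lambda>\<omega>. s * U \<omega>)) +
        complex_of_real (expectation (\<lambda>\<omega>. 1 - s\<^sup>2 * (U \<omega>)\<^sup>2 / 2))"
      unfolding T_def using T1 T2
      by (subst Bochner_Integration.integral_add) (simp_all only: integral_mult_right_zero integral_complex_of_real integrable_mult_right)
    then show ?thesis using U U2 mean by (simp add: prob_space)
  qed
  have "cmod (expectation (\<lambda>\<omega>. iexp (s * U \<omega>)) - expectation T) = cmod (expectation (\<lambda>\<omega>. iexp (s * U \<omega>) - T \<omega>))"
    using Eint Tint by simp
  also have "\<dots> \<le> expectation (\<lambda>\<omega>. cmod (iexp (s * U \<omega>) - T \<omega>))"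
    by (rule integral_norm_bound)
  also have "\<dots> \<le> expectation (\<lambda>\<omega>. \<bar>s\<bar> ^ 3 * D * (U \<omega>)\<^sup>2 / 6)"
  proof (rule integral_mono)
    fix \<omega> assume \<omega>: "\<omega> \<in> space M"
    have "cmod (iexp (s * U \<omega>) - T \<omega>) \<le> \<bar>s * U \<omega>\<bar> ^ 3 / 6"
      using iexp_approx1[of "s * U \<omega>" 2]
      by (simp add: T_def numeral_eq_Suc power_mult_distrib algebra_simps)
    also have "\<dots> = \<bar>s\<bar> ^ 3 * (\<bar>U \<omega>\<bar> * (U \<omega>)\<^sup>2) / 6"
    proof -
      have "\<bar>U \<omega>\<bar> ^ 3 = \<bar>U \<omega>\<bar> * \<bar>U \<omega>\<bar>\<^sup>2" by (simp only: power3_eq_cube power2_eq_square mult.assoc)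
      then show ?thesis by (simp add: abs_mult power_mult_distrib)
    qed
    also have "\<dots> \<le> \<bar>s\<bar> ^ 3 * (D * (U \<omega>)\<^sup>2) / 6"
      using D[OF \<omega>] by (intro divide_right_mono mult_left_mono mult_right_mono) auto
    finally show "cmod (iexp (s * U \<omega>) - T \<omega>) \<le> \<bar>s\<bar> ^ 3 * D * (U \<omega>)\<^sup>2 / 6" by (simp add: mult.assoc)
  qed (use Eint Tint U2 in auto)
  finally show ?thesis unfolding TE by simp
qed

text \<open>Bernstein blocks: \<open>k\<close> blocks of length \<open>p\<close> separated by gaps of length \<open>q\<close>.\<close>

lemma char_sum_block_bound:
  fixes f :: "real \<Rightarrow> real" and t :: real and p q k N :: nat
  assumes f[measurable]: "f \<in> borel_measurable borel" and B: "\<And>x. \<bar>f x\<bar> \<le> B" "B > 0"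
    and mean: "expectation (\<lambda>\<omega>. f (Z 0 \<omega>)) = 0"
  defines "A \<equiv> expectation (\<lambda>\<omega>. (\<Sum>j<p. f (Z j \<omega>))\<^sup>2)"
    and "C \<equiv> mixing_const * B\<^sup>2"
  assumes N: "N > 0" "k * (p + q) \<le> N" and small: "t\<^sup>2 * A / (2 * real N) \<le> 2"
  shows "cmod (expectation (\<lambda>\<omega>. iexp (t * ((\<Sum>j<N. f (Z j \<omega>)) / sqrt (real N)))) -
      complex_of_real (exp (- (real k * (t\<^sup>2 * A / (2 * real N))))))
    \<le> \<bar>t\<bar> * sqrt (C * (1 - real k * real p / real N)) + real k * (16 * alpha_coeff M Z q)
      + real k * (\<bar>t\<bar> ^ 3 * B * C * (real p)\<^sup>2 / (6 * (real N * sqrt (real N))) + (t\<^sup>2 * C * real p / (2 * real N))\<^sup>2)"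
proof -
  define s where "s = t / sqrt (real N)"
  define U where "U = (\<lambda>r \<omega>. \<Sum>j<p. f (Z (r * (p + q) + j) \<omega>))"
  define J where "J = (\<Union>r\<in>{..<k}. (\<lambda>j. r * (p + q) + j) ` {..<p})"
  have [measurable]: "U r \<in> borel_measurable M" for r unfolding U_def by measurable
  have C0: "C \<ge> 0" unfolding C_def using mixing_const_nonneg by simp
  have s2: "s\<^sup>2 = t\<^sup>2 / real N" and s3: "\<bar>s\<bar> ^ 3 = \<bar>t\<bar> ^ 3 / (real N * sqrt (real N))"
    unfolding s_def by (simp_all add: power_divide power3_eq_cube)
  have A0: "0 \<le> A" unfolding A_def by simp
  have A_le: "A \<le> C * real p"
    using second_moment_sum_bound[OF f B mean, of "{..<p}"] unfolding A_def C_def by simp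
  have U0: "U 0 = (\<lambda>\<omega>. \<Sum>j<p. f (Z j \<omega>))" unfolding U_def by simp
  have ff: "integrable M (\<lambda>\<omega>. f (Z j \<omega>))" for j
    by (rule integrable_const_bound[of _ B]) (use B in auto)
  have U_mean: "expectation (U 0) = 0"
    unfolding U0 using ff stationary_mean[OF f] mean by simp
  have U_bound: "\<bar>U 0 \<omega>\<bar> \<le> real p * B" for \<omega>
    unfolding U0 using sum_norm_bound[of "{..<p}" "\<lambda>j. f (Z j \<omega>)" B] B by simp
  let ?S = "\<lambda>\<omega>. \<Sum>j<N. f (Z j \<omega>)" and ?e = "expectation (\<lambda>\<omega>. iexp (s * U 0 \<omega>))"
  define y where "y = t\<^sup>2 * A / (2 * real N)"
  have y: "0 \<le> y" "y \<le> 2" "y \<le> t\<^sup>2 * C * real p / (2 * real N)"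
    using small A0 A_le N unfolding y_def by (auto simp: divide_right_mono mult_left_mono mult.assoc)

  \<comment> \<open>Division by \<open>p + q\<close> recovers the block number, hence the blocks are
    disjoint and \<open>J\<close> has \<open>k * p\<close> elements.\<close>
  have rect: "(r * (p + q) + j = r' * (p + q) + j') = (r = r' \<and> j = j')" if "j < p" "j' < p" for r r' j j'
  proof
    assume eq: "r * (p + q) + j = r' * (p + q) + j'"
    have "(r * (p + q) + j) div (p + q) = r" "(r' * (p + q) + j') div (p + q) = r'"
      using that by simp_all
    then show "r = r' \<and> j = j'" using eq by simp
  qed simp
  have finJ: "finite J" unfolding J_def by simp
  have J_sub: "J \<subseteq> {..<N}"
  proof
    fix i assume "i \<in> J"
    then obtain r j where rj: "r < k" "j < p" "i = r * (p + q) + j" unfolding J_def by auto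
    have "Suc r * (p + q) \<le> k * (p + q)" using rj by (intro mult_le_mono1) simp
    then have "r * (p + q) + (p + q) \<le> N" using N by simp
    then show "i \<in> {..<N}" using rj by simp
  qed
  have sum_J: "(\<Sum>j\<in>J. g j) = (\<Sum>r<k. \<Sum>j<p. g (r * (p + q) + j))" for g :: "nat \<Rightarrow> real"
    unfolding J_def
    by (subst sum.UNION_disjoint) (auto simp: rect intro!: sum.cong sum.reindex_cong[OF _ refl] inj_onI)
  have card_J: "real (card J) = real k * real p"
    using sum_J[of "\<lambda>_. 1"] by simp
  have rest: "?S \<omega> - (\<Sum>r<k. U r \<omega>) = (\<Sum>j\<in>{..<N} - J. f (Z j \<omega>))" for \<omega>
    unfolding U_def by (simp add: sum_diff[OF _ J_sub] sum_J)

  have S_meas[measurable]: "?S \<in> borel_measurable M" by measurable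
  have char_int: "complex_integrable M (\<lambda>\<omega>. iexp (Y \<omega>))" if [measurable]: "Y \<in> borel_measurable M" for Y
    by (rule integrable_const_bound[of _ 1]) auto
  \<comment> \<open>\<open>iexp\<close> is Lipschitz, and the first absolute moment of the sum over
    the \<open>N - k * p\<close> remaining indices is at most the root of its second moment.\<close>
  have small_blocks: "cmod (expectation (\<lambda>\<omega>. iexp (s * ?S \<omega>)) - expectation (\<lambda>\<omega>. iexp (s * (\<Sum>r<k. U r \<omega>))))
      \<le> \<bar>t\<bar> * sqrt (C * (1 - real k * real p / real N))"
  proof -
    let ?D = "\<lambda>\<omega>. \<Sum>j\<in>{..<N} - J. f (Z j \<omega>)"
    have D_bound: "\<bar>?D \<omega>\<bar> \<le> real (card ({..<N} - J)) * B" for \<omega>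
      using sum_norm_bound[of "{..<N} - J" "\<lambda>j. f (Z j \<omega>)" B] B by simp
    have D: "integrable M (\<lambda>\<omega>. \<bar>?D \<omega>\<bar>)"
      by (rule integrable_const_bound[of _ "real (card ({..<N} - J)) * B"]) (use D_bound in auto)
    have D2: "integrable M (\<lambda>\<omega>. \<bar>?D \<omega>\<bar>\<^sup>2)"
      unfolding power2_abs by (rule integrable_square_of_bounded[OF _ D_bound]) measurable
    have card_le: "card J \<le> N" using card_mono[OF _ J_sub] by simp
    have card: "real (card ({..<N} - J)) = real N - real k * real p"
      using card_Diff_subset[OF finJ J_sub] card_le card_J by (simp add: of_nat_diff)
    have "(expectation (\<lambda>\<omega>. \<bar>?D \<omega>\<bar>))\<^sup>2 \<le> expectation (\<lambda>\<omega>. \<bar>?D \<omega>\<bar>\<^sup>2)"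
    proof -
      have "0 \<le> variance (\<lambda>\<omega>. \<bar>?D \<omega>\<bar>)" by (rule variance_positive)
      then show ?thesis using variance_eq[OF D D2] by simp
    qed
    also have "\<dots> \<le> C * (real N - real k * real p)"
      using second_moment_sum_bound[OF f B mean, of "{..<N} - J"] unfolding C_def card by simp
    finally have ED: "expectation (\<lambda>\<omega>. \<bar>?D \<omega>\<bar>) \<le> sqrt (C * (real N - real k * real p))"
      by (rule real_le_rsqrt)
    have "cmod (expectation (\<lambda>\<omega>. iexp (s * ?S \<omega>)) - expectation (\<lambda>\<omega>. iexp (s * (\<Sum>r<k. U r \<omega>)))) =
        cmod (expectation (\<lambda>\<omega>. iexp (s * ?S \<omega>) - iexp (s * (\<Sum>r<k. U r \<omega>))))"
      by (rule arg_cong[where f = cmod], rule Bochner_Integration.integral_diff[symmetric]; rule char_int; measurable)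
    also have "\<dots> \<le> expectation (\<lambda>\<omega>. cmod (iexp (s * ?S \<omega>) - iexp (s * (\<Sum>r<k. U r \<omega>))))"
      by (rule integral_norm_bound)
    also have "\<dots> \<le> expectation (\<lambda>\<omega>. \<bar>s\<bar> * \<bar>?D \<omega>\<bar>)"
    proof (rule integral_mono)
      fix \<omega>
      show "cmod (iexp (s * ?S \<omega>) - iexp (s * (\<Sum>r<k. U r \<omega>))) \<le> \<bar>s\<bar> * \<bar>?D \<omega>\<bar>"
        using cmod_iexp_diff_le[of "s * ?S \<omega>" "s * (\<Sum>r<k. U r \<omega>)"]
        unfolding right_diff_distrib[symmetric] rest abs_mult .
    next
      show "integrable M (\<lambda>\<omega>. cmod (iexp (s * ?S \<omega>) - iexp (s * (\<Sum>r<k. U r \<omega>))))"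
        by (intro integrable_norm Bochner_Integration.integrable_diff char_int) measurable
    qed (use D in simp)
    also have "\<dots> \<le> \<bar>s\<bar> * sqrt (C * (real N - real k * real p))"
      using ED by (simp add: mult_left_mono)
    also have "\<dots> = \<bar>t\<bar> * sqrt (C * (real N - real k * real p) / real N)"
      unfolding s_def by (simp add: real_sqrt_divide abs_divide)
    also have "C * (real N - real k * real p) / real N = C * (1 - real k * real p / real N)"
      using N by (simp add: field_simps)
    finally show ?thesis .
  qed

  have blocks: "cmod (expectation (\<lambda>\<omega>. iexp (s * (\<Sum>r<k. U r \<omega>))) - ?e ^ k) \<le> real k * (16 * alpha_coeff M Z q)"
    unfolding U_def by (rule char_block_product[OF f])

  \<comment> \<open>Powers of numbers of modulus at most 1 differ by at most \<open>k\<close> times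
    the difference of the bases. For the base \<open>1 - y\<close> this needs
    \<open>y \<le> 2\<close>, the purpose of the hypothesis \<open>small\<close>.\<close>
  have one_block: "cmod (?e ^ k - complex_of_real (1 - y) ^ k) \<le>
      real k * (\<bar>t\<bar> ^ 3 * B * C * (real p)\<^sup>2 / (6 * (real N * sqrt (real N))))"
  proof -
    have "cmod ?e \<le> expectation (\<lambda>\<omega>. cmod (iexp (s * U 0 \<omega>)))" by (rule integral_norm_bound)
    then have e1: "cmod ?e \<le> 1" by (simp add: prob_space)
    have "cmod (?e - complex_of_real (1 - y)) \<le> \<bar>s\<bar> ^ 3 * (real p * B) * A / 6"
      using char_second_order[of "U 0" "real p * B" s] U_bound U_mean
      unfolding y_def A_def s2 U0 by (simp add: field_simps)
    also have "\<dots> \<le> \<bar>s\<bar> ^ 3 * (real p * B) * (C * real p) / 6"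
      using A_le B by (intro divide_right_mono mult_left_mono) auto
    also have "\<dots> = \<bar>t\<bar> ^ 3 * B * C * (real p)\<^sup>2 / (6 * (real N * sqrt (real N)))"
      unfolding s3 by (simp add: power2_eq_square ac_simps)
    finally have "real k * cmod (?e - complex_of_real (1 - y)) \<le>
        real k * (\<bar>t\<bar> ^ 3 * B * C * (real p)\<^sup>2 / (6 * (real N * sqrt (real N))))"
      by (rule mult_left_mono) simp
    moreover have "cmod (complex_of_real (1 - y)) \<le> 1" unfolding norm_of_real using y by simp
    ultimately show ?thesis using norm_power_diff[OF e1, of "complex_of_real (1 - y)" k] by linarith
  qed

  have exponential: "cmod (complex_of_real (1 - y) ^ k - complex_of_real (exp (- (real k * y)))) \<le>
      real k * (t\<^sup>2 * C * real p / (2 * real N))\<^sup>2"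
  proof -
    have "cmod (complex_of_real (1 - y) ^ k - complex_of_real (exp (- (real k * y)))) =
        norm ((1 - y) ^ k - exp (- y) ^ k)"
      by (simp only: exp_of_nat_mult[symmetric] of_real_power[symmetric] of_real_diff[symmetric] norm_of_real
          mult_minus_right real_norm_def)
    also have "\<dots> \<le> real k * norm ((1 - y) - exp (- y))"
      using y by (intro norm_power_diff) auto
    also have "\<dots> \<le> real k * y\<^sup>2"
      using abs_exp_minus_linear_le[OF y(1)] by (intro mult_left_mono) auto
    also have "\<dots> \<le> real k * (t\<^sup>2 * C * real p / (2 * real N))\<^sup>2"
      using y by (intro mult_left_mono power_mono) auto
    finally show ?thesis .
  qed

  have S_eq: "(\<lambda>\<omega>. iexp (t * (?S \<omega> / sqrt (real N)))) = (\<lambda>\<omega>. iexp (s * ?S \<omega>))"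
    unfolding s_def by simp
  \<comment> \<open>Four errors are added: discarding the gaps, decoupling the blocks, expanding one
    characteristic function to second order, and replacing \<open>(1 - y) ^ k\<close> by an
    exponential.\<close>
  have chain: "cmod (a - e) \<le> cmod (a - b) + cmod (b - c) + cmod (c - d) + cmod (d - e)" for a b c d e :: complex
    using dist_triangle[of a e b] dist_triangle[of b e c] dist_triangle[of c e d]
    unfolding dist_norm by linarith
  show ?thesis
    unfolding S_eq y_def[symmetric]
    using order.trans[OF chain add_mono[OF add_mono[OF add_mono[OF small_blocks blocks] one_block] exponential]]
    by (simp only: distrib_left add.assoc)
qed

text \<open>Characteristic functions are the form in which the sum is compared with the estimator
  later; in this form the degenerate value \<open>V = 0\<close> needs no separate treatment.\<close>

theorem central_limit_theorem:
  fixes f :: "real \<Rightarrow> real" and t :: real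
  assumes f[measurable]: "f \<in> borel_measurable borel" and B: "\<And>x. \<bar>f x\<bar> \<le> B" "B > 0"
    and mean: "expectation (\<lambda>\<omega>. f (Z 0 \<omega>)) = 0"
  defines "V \<equiv> expectation (\<lambda>\<omega>. (f (Z 0 \<omega>))\<^sup>2) + 2 * (\<Sum>j. expectation (\<lambda>\<omega>. f (Z 0 \<omega>) * f (Z (Suc j) \<omega>)))"
  shows "(\<lambda>N. expectation (\<lambda>\<omega>. iexp (t * ((\<Sum>j<N. f (Z j \<omega>)) / sqrt (real N)))))
    \<longlonglongrightarrow> complex_of_real (exp (- (t\<^sup>2 * V / 2)))"
proof -
  define A where "A = (\<lambda>p. expectation (\<lambda>\<omega>. (\<Sum>j<p. f (Z j \<omega>))\<^sup>2))"
  define C where "C = mixing_const * B\<^sup>2"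
  define \<phi> where "\<phi> = (\<lambda>N. expectation (\<lambda>\<omega>. iexp (t * ((\<Sum>j<N. f (Z j \<omega>)) / sqrt (real N)))))"
  have C0: "C \<ge> 0" unfolding C_def using mixing_const_nonneg by simp
  have A0: "0 \<le> A p" and A_le: "A p \<le> C * real p" for p
    using second_moment_sum_bound[OF f B mean, of "{..<p}"] unfolding A_def C_def by simp_all
  have A_lim: "(\<lambda>p. A p / real p) \<longlonglongrightarrow> V"
    unfolding A_def V_def by (rule second_moment_average_limit[OF f B mean])
  txt \<open>For a fixed ratio of \<open>p\<close> to \<open>q\<close> both are of order \<open>sqrt N\<close>: then \<open>k * alpha q\<close> vanishes
    because \<open>q * alpha q\<close> does, and the remaining errors vanish as \<open>L\<close> grows.\<close>
  define q where "q = (\<lambda>L N. nat \<lfloor>sqrt (real N) / (real (Suc L))\<^sup>2\<rfloor>)"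
  define p where "p = (\<lambda>L N. Suc L * q L N)"
  define k where "k = (\<lambda>L N. N div (p L N + q L N))"
  \<comment> \<open>These are the errors of \<open>char_sum_block_bound\<close> with
    \<open>k\<close> bounded by \<open>N / q\<close> in the second and by \<open>N / p\<close> in
    the third.\<close>
  define E where "E = (\<lambda>L N. \<bar>t\<bar> * sqrt (C * (1 - real (k L N) * real (p L N) / real N))
      + 16 * (real N / (real (q L N))\<^sup>2 * (real (q L N) * alpha_coeff M Z (q L N)))
      + (\<bar>t\<bar> ^ 3 * B * C / 6 * (real (p L N) / sqrt (real N)) + (t\<^sup>2 * C / 2)\<^sup>2 * (real (p L N) / real N)))"
  define x where "x = (\<lambda>L N. t\<^sup>2 / 2 * (real (k L N) * real (p L N) / real N * (A (p L N) / real (p L N))))"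
  define D where "D = (\<lambda>L N. E L N + \<bar>exp (- x L N) - exp (- (t\<^sup>2 * V / 2))\<bar>)"
  \<comment> \<open>\<open>\<rho> L\<close> is the limiting share of indices that belong to blocks,
    and \<open>d L\<close> the limit of \<open>D L N\<close> as \<open>N\<close> grows.\<close>
  define \<rho> where "\<rho> = (\<lambda>L. real (Suc L) / real (Suc (Suc L)))"
  define d where "d = (\<lambda>L. (\<bar>t\<bar> * sqrt (C * (1 - \<rho> L)) + 16 * (real (Suc L) ^ 4 * 0)
      + (\<bar>t\<bar> ^ 3 * B * C / 6 * (1 / real (Suc L)) + (t\<^sup>2 * C / 2)\<^sup>2 * 0))
      + \<bar>exp (- (t\<^sup>2 / 2 * (\<rho> L * V))) - exp (- (t\<^sup>2 * V / 2))\<bar>)"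
  have sqrt_top: "filterlim (\<lambda>N. sqrt (real N)) at_top sequentially"
    by (rule filterlim_compose[OF sqrt_at_top filterlim_real_sequentially])
  have inv_sqrt: "(\<lambda>N. 1 / sqrt (real N)) \<longlonglongrightarrow> 0"
    by (rule real_tendsto_divide_at_top[OF tendsto_const sqrt_top])
  have q_lim: "(\<lambda>N. real (q L N) / sqrt (real N)) \<longlonglongrightarrow> 1 / (real (Suc L))\<^sup>2" for L
  proof (rule tendsto_sandwich)
    show "eventually (\<lambda>N. 1 / (real (Suc L))\<^sup>2 - 1 / sqrt (real N) \<le> real (q L N) / sqrt (real N)) sequentially"
      using eventually_gt_at_top[of 0]
    proof eventually_elim
      case (elim N)
      have "sqrt (real N) / (real (Suc L))\<^sup>2 - 1 \<le> real (q L N)" unfolding q_def by linarith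
      from divide_right_mono[OF this, of "sqrt (real N)"] show ?case
        using elim by (simp add: diff_divide_distrib)
    qed
    show "eventually (\<lambda>N. real (q L N) / sqrt (real N) \<le> 1 / (real (Suc L))\<^sup>2) sequentially"
      using eventually_gt_at_top[of 0]
    proof eventually_elim
      case (elim N)
      have "real (q L N) \<le> sqrt (real N) / (real (Suc L))\<^sup>2" unfolding q_def by simp
      from divide_right_mono[OF this, of "sqrt (real N)"] show ?case
        using elim by simp
    qed
    have "(\<lambda>N. 1 / (real (Suc L))\<^sup>2 - 1 / sqrt (real N)) \<longlonglongrightarrow> 1 / (real (Suc L))\<^sup>2 - 0"
      by (intro tendsto_diff tendsto_const inv_sqrt)
    then show "(\<lambda>N. 1 / (real (Suc L))\<^sup>2 - 1 / sqrt (real N)) \<longlonglongrightarrow> 1 / (real (Suc L))\<^sup>2" by simp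
  qed simp
  have q_top: "filterlim (q L) at_top sequentially" for L
  proof -
    have "filterlim (\<lambda>N. sqrt (real N) * (real (q L N) / sqrt (real N))) at_top sequentially"
      by (rule filterlim_at_top_mult_tendsto_pos[OF q_lim _ sqrt_top]) simp
    moreover have "eventually (\<lambda>N. sqrt (real N) * (real (q L N) / sqrt (real N)) = real (q L N)) sequentially"
      using eventually_gt_at_top[of 0] by eventually_elim simp
    ultimately have "filterlim (\<lambda>N. real (q L N)) at_top sequentially"
      by (rule filterlim_cong[OF refl refl, THEN iffD1, rotated])
    then show ?thesis
      by (simp add: filterlim_sequentially_iff_filterlim_real)
  qed
  have p_lim: "(\<lambda>N. real (p L N) / sqrt (real N)) \<longlonglongrightarrow> 1 / real (Suc L)" for L
  proof -
    have "(\<lambda>N. real (Suc L) * (real (q L N) / sqrt (real N))) \<longlonglongrightarrow> real (Suc L) * (1 / (real (Suc L))\<^sup>2)"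
      by (intro tendsto_mult tendsto_const q_lim)
    moreover have "real (Suc L) * (1 / (real (Suc L))\<^sup>2) = 1 / real (Suc L)"
      by (simp add: power2_eq_square del: of_nat_Suc)
    ultimately show ?thesis unfolding p_def of_nat_mult times_divide_eq_right by (simp only:)
  qed
  have N_lim: "(\<lambda>N. real (r N) / real N) \<longlonglongrightarrow> 0" if "(\<lambda>N. real (r N) / sqrt (real N)) \<longlonglongrightarrow> c" for r :: "nat \<Rightarrow> nat" and c
  proof -
    have "(\<lambda>N. real (r N) / sqrt (real N) * (1 / sqrt (real N))) \<longlonglongrightarrow> c * 0"
      by (intro tendsto_mult that inv_sqrt)
    then show ?thesis by simp
  qed
  have kp_lim: "(\<lambda>N. real (k L N) * real (p L N) / real N) \<longlonglongrightarrow> \<rho> L" for L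
  proof -
    let ?l = "\<lambda>N. p L N + q L N"
    \<comment> \<open>Blocks together with their gaps leave out less than one full period of the
      \<open>N\<close> indices.\<close>
    have kl: "(\<lambda>N. real (k L N) * real (?l N) / real N) \<longlonglongrightarrow> 1"
    proof (rule tendsto_sandwich)
      have "(\<lambda>N. 1 - (real (p L N) / real N + real (q L N) / real N)) \<longlonglongrightarrow> 1 - (0 + 0)"
        by (intro tendsto_intros N_lim[OF p_lim] N_lim[OF q_lim])
      then show "(\<lambda>N. 1 - (real (p L N) / real N + real (q L N) / real N)) \<longlonglongrightarrow> 1" by simp
      show "eventually (\<lambda>N. 1 - (real (p L N) / real N + real (q L N) / real N) \<le> real (k L N) * real (?l N) / real N) sequentially"
        using eventually_gt_at_top[of 0] filterlim_at_top[THEN iffD1, OF q_top, rule_format, of 1 L]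
      proof eventually_elim
        case (elim N)
        have "N mod ?l N < ?l N" using elim by simp
        moreover have "N = k L N * ?l N + N mod ?l N"
          unfolding k_def by (rule div_mult_mod_eq[symmetric])
        ultimately have "N \<le> k L N * ?l N + ?l N" by linarith
        then have "real N \<le> real (k L N) * real (?l N) + (real (p L N) + real (q L N))"
          by (metis of_nat_add of_nat_le_iff of_nat_mult)
        then have "real N / real N \<le> (real (k L N) * real (?l N) + (real (p L N) + real (q L N))) / real N"
          by (rule divide_right_mono) simp
        then show ?case using elim by (simp add: add_divide_distrib)
      qed
      show "eventually (\<lambda>N. real (k L N) * real (?l N) / real N \<le> 1) sequentially"
        using eventually_gt_at_top[of 0]
      proof eventually_elim
        case (elim N)
        have "k L N * ?l N \<le> N" unfolding k_def by simp
        then have "real (k L N) * real (?l N) \<le> real N" by (metis of_nat_le_iff of_nat_mult)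
        then show ?case using elim by (simp add: divide_le_eq)
      qed
    qed simp
    have eq: "real (k L N) * real (p L N) / real N = \<rho> L * (real (k L N) * real (?l N) / real N)" for N
    proof -
      have "real (?l N) = real (Suc (Suc L)) * real (q L N)" "real (p L N) = real (Suc L) * real (q L N)"
        unfolding p_def by (simp_all add: algebra_simps)
      then show ?thesis unfolding \<rho>_def by (simp del: of_nat_Suc)
    qed
    show ?thesis
      using tendsto_mult[OF tendsto_const kl, of "\<rho> L"] unfolding eq mult_1_right .
  qed
  have p_top: "filterlim (p L) at_top sequentially" for L
    by (rule filterlim_at_top_mono[OF q_top[of L]]) (simp add: p_def)
  have gap_lim: "(\<lambda>N. real N / (real (q L N))\<^sup>2 * (real (q L N) * alpha_coeff M Z (q L N))) \<longlonglongrightarrow> real (Suc L) ^ 4 * 0" for L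
  proof (rule tendsto_mult)
    have "(\<lambda>N. inverse ((real (q L N) / sqrt (real N))\<^sup>2)) \<longlonglongrightarrow> inverse ((1 / (real (Suc L))\<^sup>2)\<^sup>2)"
      by (intro tendsto_intros q_lim) simp
    moreover have "inverse ((1 / S\<^sup>2)\<^sup>2) = S ^ 4" for S :: real
      by (simp add: power_one_over flip: power_mult)
    moreover have "inverse ((real (q L N) / sqrt (real N))\<^sup>2) = real N / (real (q L N))\<^sup>2" for N
      by (simp add: power_divide)
    ultimately show "(\<lambda>N. real N / (real (q L N))\<^sup>2) \<longlonglongrightarrow> real (Suc L) ^ 4"
      by (simp only:)
    show "(\<lambda>N. real (q L N) * alpha_coeff M Z (q L N)) \<longlonglongrightarrow> 0"
      by (rule filterlim_compose[OF alpha_little_o_inverse q_top])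
  qed
  have E_bound: "eventually (\<lambda>N. cmod (\<phi> N - complex_of_real (exp (- x L N))) \<le> E L N) sequentially" for L
  proof -
    \<comment> \<open>As \<open>p\<close> is of order sqrt N, \<open>p / N\<close> vanishes; this
      eventually gives the hypothesis \<open>small\<close> of the block bound.\<close>
    have "(\<lambda>N. t\<^sup>2 * C / 2 * (real (p L N) / real N)) \<longlonglongrightarrow> t\<^sup>2 * C / 2 * 0"
      by (intro tendsto_intros N_lim[OF p_lim])
    then have "eventually (\<lambda>N. t\<^sup>2 * C / 2 * (real (p L N) / real N) < 2) sequentially"
      by (rule order_tendstoD) simp
    moreover have "eventually (\<lambda>N. 1 \<le> q L N) sequentially"
      using q_top[of L] by (simp add: filterlim_at_top)
    ultimately show ?thesis
      using eventually_gt_at_top[of 0]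
    proof eventually_elim
      case (elim N)
      let ?p = "p L N" and ?q = "q L N" and ?k = "k L N"
      have p_pos: "0 < ?p" using elim unfolding p_def by simp
      have kl: "?k * (?p + ?q) \<le> N" unfolding k_def by simp
      then have "real ?k * (real ?p + real ?q) \<le> real N" by (metis of_nat_add of_nat_le_iff of_nat_mult)
      then have kp: "real ?k * real ?p \<le> real N" and kq: "real ?k * real ?q \<le> real N"
        by (simp_all add: distrib_left) (smt (verit) mult_nonneg_nonneg of_nat_0_le_iff)+
      have "t\<^sup>2 * A ?p / (2 * real N) \<le> t\<^sup>2 * (C * real ?p) / (2 * real N)"
        using A_le[of ?p] by (intro divide_right_mono mult_left_mono) auto
      also have "\<dots> \<le> 2" using elim by (simp add: field_simps)
      finally have small: "t\<^sup>2 * A ?p / (2 * real N) \<le> 2" .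
      have x_eq: "x L N = real ?k * (t\<^sup>2 * A ?p / (2 * real N))"
        unfolding x_def using p_pos by (simp add: field_simps)
      have b: "cmod (\<phi> N - complex_of_real (exp (- x L N))) \<le>
          \<bar>t\<bar> * sqrt (C * (1 - real ?k * real ?p / real N)) + real ?k * (16 * alpha_coeff M Z ?q)
          + real ?k * (\<bar>t\<bar> ^ 3 * B * C * (real ?p)\<^sup>2 / (6 * (real N * sqrt (real N))) + (t\<^sup>2 * C * real ?p / (2 * real N))\<^sup>2)"
        unfolding x_eq \<phi>_def A_def C_def
        by (rule char_sum_block_bound[OF f B mean elim(3) kl small[unfolded A_def]])
      have "real ?k \<le> real N / real ?q" using kq elim by (simp add: pos_le_divide_eq)
      then have "real ?k * (16 * alpha_coeff M Z ?q) \<le> real N / real ?q * (16 * alpha_coeff M Z ?q)"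
        by (rule mult_right_mono) (simp add: alpha_nonneg)
      also have "\<dots> = 16 * (real N / (real ?q)\<^sup>2 * (real ?q * alpha_coeff M Z ?q))"
        using elim by (simp add: power2_eq_square field_simps)
      finally have gap: "real ?k * (16 * alpha_coeff M Z ?q) \<le> 16 * (real N / (real ?q)\<^sup>2 * (real ?q * alpha_coeff M Z ?q))" .
      have "real ?k \<le> real N / real ?p" using kp p_pos by (simp add: pos_le_divide_eq)
      then have "real ?k * (\<bar>t\<bar> ^ 3 * B * C * (real ?p)\<^sup>2 / (6 * (real N * sqrt (real N))) + (t\<^sup>2 * C * real ?p / (2 * real N))\<^sup>2)
          \<le> real N / real ?p * (\<bar>t\<bar> ^ 3 * B * C * (real ?p)\<^sup>2 / (6 * (real N * sqrt (real N))) + (t\<^sup>2 * C * real ?p / (2 * real N))\<^sup>2)"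
        by (rule mult_right_mono) (use C0 B in auto)
      also have "\<dots> = \<bar>t\<bar> ^ 3 * B * C / 6 * (real ?p / sqrt (real N)) + (t\<^sup>2 * C / 2)\<^sup>2 * (real ?p / real N)"
        using elim p_pos by (simp add: distrib_left power2_eq_square field_simps)
      finally show ?case using b gap unfolding E_def by linarith
    qed
  qed
  have rho: "\<rho> \<longlonglongrightarrow> 1"
    unfolding \<rho>_def using LIMSEQ_n_over_Suc_n[THEN LIMSEQ_Suc] by simp
  have "(\<lambda>N. cmod (\<phi> N - complex_of_real (exp (- (t\<^sup>2 * V / 2))))) \<longlonglongrightarrow> 0"
  proof (rule tendsto_zero_of_double_limit[where D = D and d = d])
    show "eventually (\<lambda>N. cmod (\<phi> N - complex_of_real (exp (- (t\<^sup>2 * V / 2)))) \<le> D L N) sequentially" for L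
      using E_bound[of L]
    proof eventually_elim
      case (elim N)
      have "cmod (\<phi> N - complex_of_real (exp (- (t\<^sup>2 * V / 2)))) \<le> cmod (\<phi> N - complex_of_real (exp (- x L N))) +
          cmod (complex_of_real (exp (- x L N)) - complex_of_real (exp (- (t\<^sup>2 * V / 2))))"
        using norm_triangle_ineq[of "\<phi> N - complex_of_real (exp (- x L N))"
            "complex_of_real (exp (- x L N)) - complex_of_real (exp (- (t\<^sup>2 * V / 2)))"] by simp
      also have "cmod (complex_of_real (exp (- x L N)) - complex_of_real (exp (- (t\<^sup>2 * V / 2)))) =
          \<bar>exp (- x L N) - exp (- (t\<^sup>2 * V / 2))\<bar>"
        unfolding of_real_diff[symmetric] norm_of_real ..
      finally show ?case unfolding D_def using elim by linarith
    qed
    show "D L \<longlonglongrightarrow> d L" for L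
      unfolding D_def d_def E_def x_def
      by (intro tendsto_intros kp_lim p_lim gap_lim N_lim[OF p_lim] filterlim_compose[OF A_lim p_top])
    have "d = (\<lambda>L. \<bar>t\<bar> * sqrt (C * (1 - \<rho> L)) + \<bar>t\<bar> ^ 3 * B * C / 6 * (1 / real (Suc L)) +
        \<bar>exp (- (t\<^sup>2 / 2 * (\<rho> L * V))) - exp (- (t\<^sup>2 * V / 2))\<bar>)"
      unfolding d_def by simp
    moreover have "\<dots> \<longlonglongrightarrow> \<bar>t\<bar> * sqrt (C * (1 - 1)) + \<bar>t\<bar> ^ 3 * B * C / 6 * 0 +
        \<bar>exp (- (t\<^sup>2 / 2 * (1 * V))) - exp (- (t\<^sup>2 * V / 2))\<bar>"
      by (intro tendsto_intros rho LIMSEQ_Suc[OF lim_1_over_n])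
    ultimately have "d \<longlonglongrightarrow> \<bar>t\<bar> * sqrt (C * (1 - 1)) + \<bar>t\<bar> ^ 3 * B * C / 6 * 0 +
        \<bar>exp (- (t\<^sup>2 / 2 * (1 * V))) - exp (- (t\<^sup>2 * V / 2))\<bar>"
      by (simp only:)
    then show "d \<longlonglongrightarrow> 0" by simp
  qed simp
  then show ?thesis
    unfolding \<phi>_def[symmetric] by (simp add: tendsto_norm_zero_iff LIM_zero_iff)
qed

end

section \<open>Kernel smoothing\<close>

lemma has_real_derivative_iterated_deriv:
  assumes "times_differentiable n f" "k < n"
  shows "((deriv ^^ k) f has_real_derivative (deriv ^^ Suc k) f x) (at x)"
proof -
  have "(deriv ^^ k) f differentiable at x"
    using assms(1)[unfolded times_differentiable_def, rule_format, OF assms(2)] .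
  then have "((deriv ^^ k) f has_real_derivative deriv ((deriv ^^ k) f) x) (at x)"
    by (simp only: DERIV_deriv_iff_real_differentiable)
  then show ?thesis by simp
qed

lemma DERIV_imp_continuous_on_UNIV:
  fixes f f' :: "real \<Rightarrow> real"
  assumes "\<And>x. (f has_real_derivative f' x) (at x)"
  shows "continuous_on UNIV f"
  using DERIV_isCont[OF assms] by (simp add: continuous_on_eq_continuous_at)

lemma continuous_iterated_deriv:
  assumes "times_differentiable n f" "k < n"
  shows "continuous_on UNIV ((deriv ^^ k) f)"
  using has_real_derivative_iterated_deriv[OF assms] by (rule DERIV_imp_continuous_on_UNIV)

lemma integrable_compact_support:
  fixes f :: "real \<Rightarrow> real"
  assumes "continuous_on UNIV f" "\<And>u. \<bar>u\<bar> > 1 \<Longrightarrow> f u = 0"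
  shows "integrable lborel f"
proof -
  have "integrable lborel (\<lambda>x. indicator {-1..1} x *\<^sub>R f x)"
    by (rule borel_integrable_compact[OF compact_Icc continuous_on_subset[OF assms(1) subset_UNIV]])
  moreover have "(\<lambda>x. indicator {-1..1} x *\<^sub>R f x) = f"
  proof
    fix x
    show "indicator {-1..1} x *\<^sub>R f x = f x"
    proof (cases "\<bar>x\<bar> > 1")
      case False
      then have "x \<in> {-1..1}" by auto
      then show ?thesis by simp
    qed (simp add: assms(2))
  qed
  ultimately show ?thesis by (simp only:)
qed

lemma bounded_compact_support:
  fixes f :: "real \<Rightarrow> real"
  assumes "continuous_on UNIV f" "\<And>u. \<bar>u\<bar> > 1 \<Longrightarrow> f u = 0"
  obtains B where "\<And>u. \<bar>f u\<bar> \<le> B" "B > 0"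
proof -
  have "compact (f ` {-1..1})"
    by (intro compact_continuous_image continuous_on_subset[OF assms(1)]) auto
  then obtain B where B: "B > 0" "\<And>y. y \<in> f ` {-1..1} \<Longrightarrow> norm y \<le> B"
    using compact_imp_bounded bounded_pos by metis
  have "\<bar>f u\<bar> \<le> B" for u
  proof (cases "\<bar>u\<bar> \<le> 1")
    case True
    then have "u \<in> {-1..1}" by auto
    then show ?thesis using B(2)[of "f u"] by simp
  next
    case False
    then show ?thesis using assms(2)[of u] B(1) by simp
  qed
  then show ?thesis using that B(1) by blast
qed

lemma integral_affine_minus:
  fixes g :: "real \<Rightarrow> real"
  shows "h > 0 \<Longrightarrow> (LINT z|lborel. g z) = h * (LINT u|lborel. g (x - h * u))"
  using lborel_integral_real_affine[of "- h" g x] by simp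

locale smoothing_kernel =
  fixes \<alpha> :: nat and K :: "real \<Rightarrow> real"
  assumes kernel: "kernel_of_order \<alpha> K"
begin

lemmas kernel_unfolded = kernel[unfolded kernel_of_order_def continuously_differentiable_def, THEN conjunct2]
lemmas kernel_differentiable = kernel_unfolded[THEN conjunct1, THEN conjunct1, rule_format]
lemmas K'_cont = kernel_unfolded[THEN conjunct1, THEN conjunct2]
lemmas kernel_support = kernel_unfolded[THEN conjunct2, THEN conjunct1]
lemmas kernel_mass = kernel_unfolded[THEN conjunct2, THEN conjunct2, THEN conjunct1]
lemmas kernel_moments = kernel_unfolded[THEN conjunct2, THEN conjunct2, THEN conjunct2]

lemma K_deriv: "(K has_real_derivative deriv K u) (at u)"
  using kernel_differentiable by (simp only: DERIV_deriv_iff_real_differentiable)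

lemma K_cont: "continuous_on UNIV K"
  using K_deriv by (rule DERIV_imp_continuous_on_UNIV)

lemma K_zero: "\<bar>u\<bar> > 1 \<Longrightarrow> K u = 0"
proof (rule ccontr)
  assume "\<bar>u\<bar> > 1" "K u \<noteq> 0"
  then have "u \<in> closure {u. K u \<noteq> 0}" by (intro subsetD[OF closure_subset]) simp
  then have "u \<in> {-1..1}" unfolding kernel_support .
  then show False using \<open>\<bar>u\<bar> > 1\<close> by auto
qed

lemma K'_zero:
  assumes "\<bar>u\<bar> > 1"
  shows "deriv K u = 0"
proof -
  have "open {u::real. \<bar>u\<bar> > 1}"
    by (intro open_Collect_less continuous_intros)
  then have "(K has_real_derivative 0) (at u)"
    by (rule has_field_derivative_transform_within_open[OF DERIV_const[of 0]]) (use assms K_zero in auto)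
  then show ?thesis by (rule DERIV_imp_deriv)
qed

lemma K_meas [measurable]: "K \<in> borel_measurable borel"
  using K_cont by (rule borel_measurable_continuous_onI)

lemma K'_meas [measurable]: "deriv K \<in> borel_measurable borel"
  using K'_cont by (rule borel_measurable_continuous_onI)

lemma moment_integrable: "integrable lborel (\<lambda>u. u ^ l * K u)"
  by (rule integrable_compact_support) (auto intro!: continuous_intros K_cont simp: K_zero)

lemma K_integrable: "integrable lborel K"
  using moment_integrable[of 0] by simp

lemma moment: "(LINT u|lborel. u ^ l * K u) = (if l = 0 then 1 else 0)" if "l \<le> \<alpha>"
proof -
  have "(LINT u|lborel. u ^ l * K u) = (LINT u:{-1..1}|lborel. u ^ l * K u)"
    unfolding set_lebesgue_integral_def
  proof (rule Bochner_Integration.integral_cong[OF refl])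
    fix u :: real
    show "u ^ l * K u = indicator {-1..1} u *\<^sub>R (u ^ l * K u)"
    proof (cases "\<bar>u\<bar> > 1")
      case False
      then have "u \<in> {-1..1}" by auto
      then show ?thesis by simp
    qed (simp add: K_zero)
  qed
  then show ?thesis using that kernel_mass kernel_moments by (cases "l = 0") auto
qed

definition K_L1 :: real where "K_L1 = (LINT u|lborel. \<bar>K u\<bar>)"

lemma K_L1_nonneg: "K_L1 \<ge> 0" unfolding K_L1_def by simp

text \<open>The moment conditions annihilate every polynomial of degree at most \<open>\<alpha>\<close> except its constant term.\<close>

lemma smoothing_bias:
  fixes F :: "real \<Rightarrow> real"
  assumes F: "continuous_on UNIV F"
    and poly: "\<And>s. \<bar>s\<bar> \<le> \<bar>h\<bar> \<Longrightarrow> \<bar>F (x + s) - (\<Sum>k\<le>n. A k * s ^ k)\<bar> \<le> D"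
    and n: "n \<le> \<alpha>" and A0: "A 0 = F x"
  shows "\<bar>(LINT u|lborel. K u * F (x + h * u)) - F x\<bar> \<le> D * K_L1"
proof -
  have int1: "integrable lborel (\<lambda>u. K u * F (x + h * u))"
    by (rule integrable_compact_support)
      (auto intro!: continuous_intros K_cont continuous_on_compose2[OF F] simp: K_zero)
  have int2: "integrable lborel (\<lambda>u. \<Sum>k\<le>n. A k * h ^ k * (u ^ k * K u))"
    by (intro Bochner_Integration.integrable_sum integrable_mult_right moment_integrable)
  have "(LINT u|lborel. (\<Sum>k\<le>n. A k * h ^ k * (u ^ k * K u))) = (\<Sum>k\<le>n. A k * h ^ k * (if k = 0 then 1 else 0))"
    using n by (subst Bochner_Integration.integral_sum) (auto intro!: moment_integrable sum.cong simp: moment)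
  also have "\<dots> = (\<Sum>k\<le>n. if k = 0 then F x else 0)"
    by (intro sum.cong refl) (simp add: A0)
  also have "\<dots> = F x" by simp
  finally have "(LINT u|lborel. K u * F (x + h * u)) - F x =
      (LINT u|lborel. K u * F (x + h * u) - (\<Sum>k\<le>n. A k * h ^ k * (u ^ k * K u)))"
    using int1 int2 by simp
  also have "norm \<dots> \<le> (LINT u|lborel. D * \<bar>K u\<bar>)"
  proof (rule Bochner_Integration.integral_norm_bound_integral)
    fix u
    have eq: "K u * F (x + h * u) - (\<Sum>k\<le>n. A k * h ^ k * (u ^ k * K u)) =
        K u * (F (x + h * u) - (\<Sum>k\<le>n. A k * (h * u) ^ k))"
      by (simp add: right_diff_distrib sum_distrib_left power_mult_distrib ac_simps)
    show "norm (K u * F (x + h * u) - (\<Sum>k\<le>n. A k * h ^ k * (u ^ k * K u))) \<le> D * \<bar>K u\<bar>"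
    proof (cases "\<bar>u\<bar> > 1")
      case False
      then have "\<bar>h * u\<bar> \<le> \<bar>h\<bar>" by (simp add: abs_mult mult_left_le)
      from mult_right_mono[OF poly[OF this], of "\<bar>K u\<bar>"] show ?thesis
        unfolding eq by (simp add: abs_mult mult.commute)
    qed (simp add: K_zero)
  qed (use int1 int2 K_integrable in auto)
  finally show ?thesis unfolding K_L1_def by simp
qed

text \<open>The approximating polynomial has degree \<open>m + 1\<close>, but only \<open>m\<close>
  when \<open>c = 0\<close>. The distinction lets one statement serve the density, with unknown
  slope and \<open>m < \<alpha>\<close>, and a function with bounded \<alpha>-th derivative, with
  zero slope and \<open>m = \<alpha>\<close>.\<close>

lemma smoothing_bias_oscillation:
  fixes d :: "nat \<Rightarrow> real \<Rightarrow> real"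
  assumes d: "\<And>k z. k < m \<Longrightarrow> (d k has_real_derivative d (Suc k) z) (at z)"
    and d0: "continuous_on UNIV (d 0)"
    and osc: "\<And>z. \<bar>z - x\<bar> \<le> \<rho> \<Longrightarrow> \<bar>d m z - d m x - c * (z - x)\<bar> \<le> C" and C: "0 \<le> C"
    and m: "c \<noteq> 0 \<Longrightarrow> Suc m \<le> \<alpha>" "m \<le> \<alpha>" and h: "\<bar>h\<bar> \<le> \<rho>"
  shows "\<bar>(LINT u|lborel. K u * d 0 (x + h * u)) - d 0 x\<bar> \<le> C * \<bar>h\<bar> ^ m * K_L1"
proof -
  define A where "A = (\<lambda>k. if k \<le> m then d k x / fact k else c / fact (Suc m))"
  have poly: "\<bar>d 0 (x + s) - (\<Sum>k\<le>Suc m. A k * s ^ k)\<bar> \<le> C * \<bar>h\<bar> ^ m" if s: "\<bar>s\<bar> \<le> \<bar>h\<bar>" for s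
  proof -
    have "(\<Sum>k\<le>Suc m. A k * s ^ k) = (\<Sum>k\<le>m. d k x / fact k * s ^ k) + c / fact (Suc m) * s ^ Suc m"
      unfolding A_def by simp
    then have "\<bar>d 0 (x + s) - (\<Sum>k\<le>Suc m. A k * s ^ k)\<bar> \<le> C * \<bar>s\<bar> ^ m"
      using Taylor_linear_oscillation[where d = d and m = m and x = x and \<rho> = \<rho> and c = c and C = C and z = "x + s"]
        d osc C s h by (simp add: diff_diff_eq)
    also have "\<dots> \<le> C * \<bar>h\<bar> ^ m"
      using s C by (intro mult_left_mono power_mono) auto
    finally show ?thesis .
  qed
  have A0: "A 0 = d 0 x" by (simp add: A_def)
  show ?thesis
  \<comment> \<open>For zero slope the top coefficient vanishes, so that moments up to order
    \<open>m\<close> suffice.\<close>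
  proof (cases "c = 0")
    case True
    then have eq: "(\<Sum>k\<le>Suc m. A k * s ^ k) = (\<Sum>k\<le>m. A k * s ^ k)" for s :: real unfolding A_def by simp
    from smoothing_bias[where n = m and A = A, OF d0 poly[unfolded eq] m(2) A0] show ?thesis .
  next
    case False
    from smoothing_bias[where n = "Suc m" and A = A, OF d0 poly m(1)[OF this] A0] show ?thesis .
  qed
qed

text \<open>The mean square shifts control the oscillation of the derivative of order
  \<open>\<alpha> - 1\<close> around affine functions. One power of \<open>h\<close> is thereby
  lost, two for the derivative; the radius \<open>1 / 2\<close> of that control restricts
  \<open>h\<close>.\<close>

lemma density_smoothing_bias:
  fixes f :: "real \<Rightarrow> real"
  assumes diff: "times_differentiable \<alpha> f" and \<alpha>: "\<alpha> \<ge> 2"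
    and shift: "\<And>t. integrable lborel (\<lambda>x. ((deriv ^^ \<alpha>) f (x + t) - (deriv ^^ \<alpha>) f x)\<^sup>2)"
      "\<And>t. sqrt (LINT x|lborel. ((deriv ^^ \<alpha>) f (x + t) - (deriv ^^ \<alpha>) f x)\<^sup>2) \<le> L"
  obtains D where "D \<ge> 0"
    "\<And>x h. 0 \<le> h \<Longrightarrow> h \<le> 1 / 2 \<Longrightarrow> \<bar>(LINT u|lborel. K u * f (x - h * u)) - f x\<bar> \<le> D * h ^ (\<alpha> - 1)"
    "\<And>x h. 0 \<le> h \<Longrightarrow> h \<le> 1 / 2 \<Longrightarrow> \<bar>(LINT u|lborel. K u * deriv f (x - h * u)) - deriv f x\<bar> \<le> D * h ^ (\<alpha> - 2)"
proof -
  define g where "g = (deriv ^^ (\<alpha> - 1)) f"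
  have Suc_\<alpha>: "Suc (\<alpha> - 1) = \<alpha>" using \<alpha> by simp
  have g: "(g has_real_derivative (deriv ^^ \<alpha>) f x) (at x)" for x
    using has_real_derivative_iterated_deriv[OF diff, of "\<alpha> - 1" x] \<alpha> unfolding g_def Suc_\<alpha> by simp
  obtain C where C: "C \<ge> 0" "\<And>x. \<exists>c. \<forall>z. \<bar>z - x\<bar> \<le> 1 / 2 \<longrightarrow> \<bar>g z - g x - c * (z - x)\<bar> \<le> C"
    using L2_shift_bound_imp_linear_oscillation[OF g shift] by blast
  have "\<bar>(LINT u|lborel. K u * f (x - h * u)) - f x\<bar> \<le> C * K_L1 * h ^ (\<alpha> - 1)" if h: "0 \<le> h" "h \<le> 1 / 2" for x h
  proof -
    obtain c where c: "\<And>z. \<bar>z - x\<bar> \<le> 1 / 2 \<Longrightarrow> \<bar>g z - g x - c * (z - x)\<bar> \<le> C" using C(2) by blast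
    have "\<bar>(LINT u|lborel. K u * (deriv ^^ 0) f (x + (- h) * u)) - (deriv ^^ 0) f x\<bar> \<le> C * \<bar>- h\<bar> ^ (\<alpha> - 1) * K_L1"
      using \<alpha> h C(1) c[unfolded g_def]
      by (intro smoothing_bias_oscillation[where \<rho> = "1 / 2" and c = c] has_real_derivative_iterated_deriv[OF diff]
          continuous_iterated_deriv[OF diff]) auto
    then show ?thesis using h by (simp add: ac_simps)
  qed
  moreover have "\<bar>(LINT u|lborel. K u * deriv f (x - h * u)) - deriv f x\<bar> \<le> C * K_L1 * h ^ (\<alpha> - 2)"
    if h: "0 \<le> h" "h \<le> 1 / 2" for x h
  proof -
    obtain c where c: "\<And>z. \<bar>z - x\<bar> \<le> 1 / 2 \<Longrightarrow> \<bar>g z - g x - c * (z - x)\<bar> \<le> C" using C(2) by blast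
    have e: "Suc (\<alpha> - 2) = \<alpha> - 1" using \<alpha> by simp
    have "\<bar>(LINT u|lborel. K u * (deriv ^^ Suc 0) f (x + (- h) * u)) - (deriv ^^ Suc 0) f x\<bar> \<le> C * \<bar>- h\<bar> ^ (\<alpha> - 2) * K_L1"
      using \<alpha> h C(1) c[unfolded g_def]
      by (intro smoothing_bias_oscillation[where \<rho> = "1 / 2" and c = c and d = "\<lambda>k. (deriv ^^ Suc k) f"]
          has_real_derivative_iterated_deriv[OF diff] continuous_iterated_deriv[OF diff]; (unfold e)?) auto
    then show ?thesis using h by (simp add: ac_simps)
  qed
  ultimately show ?thesis
    using that[of "C * K_L1"] C(1) K_L1_nonneg by simp
qed

text \<open>Here the \<alpha>-th derivative oscillates by at most twice its bound, at any distance.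
  The full power of \<open>h\<close> matters, since this bias will be multiplied by sqrt N without
  being squared.\<close>

lemma bounded_derivative_smoothing_bias:
  fixes f :: "real \<Rightarrow> real"
  assumes diff: "times_differentiable \<alpha> f" and \<alpha>: "\<alpha> \<ge> 1"
    and bdd: "bounded (range ((deriv ^^ \<alpha>) f))"
  obtains D where "D \<ge> 0"
    "\<And>x h. \<bar>(LINT u|lborel. K u * f (x + h * u)) - f x\<bar> \<le> D * \<bar>h\<bar> ^ \<alpha>"
proof -
  obtain B where B: "\<And>x. \<bar>(deriv ^^ \<alpha>) f x\<bar> \<le> B"
    using bdd unfolding bounded_iff by auto
  have B0: "0 \<le> B" using B[of 0] by linarith
  have "\<bar>(LINT u|lborel. K u * (deriv ^^ 0) f (x + h * u)) - (deriv ^^ 0) f x\<bar> \<le> (2 * B) * \<bar>h\<bar> ^ \<alpha> * K_L1" for x h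
  proof (rule smoothing_bias_oscillation[where \<rho> = "\<bar>h\<bar>" and c = 0])
    show "\<bar>(deriv ^^ \<alpha>) f z - (deriv ^^ \<alpha>) f x - 0 * (z - x)\<bar> \<le> 2 * B" for z
      using B[of z] B[of x] by simp
    show "continuous_on UNIV ((deriv ^^ 0) f)"
      using continuous_iterated_deriv[OF diff, of 0] \<alpha> by simp
  qed (use B0 has_real_derivative_iterated_deriv[OF diff] in auto)
  then show ?thesis
    using that[of "2 * B * K_L1"] B0 K_L1_nonneg by (simp add: ac_simps)
qed

section \<open>Change of variables for the rescaled kernel\<close>

lemma integral_kernel_affine:
  assumes "h > 0"
  shows "(LINT z|lborel. K ((x - z) / h) / h * f z) = (LINT u|lborel. K u * f (x - h * u))"
proof -
  have "(\<lambda>u. K ((x - (x - h * u)) / h) / h * f (x - h * u)) = (\<lambda>u. K u * f (x - h * u) / h)"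
    using assms by simp
  then show ?thesis
    using integral_affine_minus[OF assms, of "\<lambda>z. K ((x - z) / h) / h * f z" x] assms by simp
qed

lemma integral_kernel_affine':
  assumes "h > 0"
  shows "(LINT x|lborel. f x * (K ((x - z) / h) / h)) = (LINT u|lborel. K u * f (z + h * u))"
proof -
  have "(\<lambda>u. f (z + h * u) * (K ((z + h * u - z) / h) / h)) = (\<lambda>u. K u * f (z + h * u) / h)"
    using assms by (simp add: mult.commute)
  then show ?thesis
    using lborel_integral_real_affine[of h "\<lambda>x. f x * (K ((x - z) / h) / h)" z] assms by simp
qed

text \<open>Integration by parts moves the derivative from the kernel to \<open>f\<close> and
  absorbs one factor of \<open>h\<close>. Thus the expected derivative of the estimate is
  \<open>f'\<close> smoothed by the same kernel, with the same bias analysis.\<close>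

lemma integral_kernel_deriv_affine:
  assumes h: "h > 0" and f: "\<And>x. (f has_real_derivative f' x) (at x)" "continuous_on UNIV f'"
  shows "(LINT z|lborel. deriv K ((x - z) / h) / h\<^sup>2 * f z) = (LINT u|lborel. K u * f' (x - h * u))"
proof -
  have f_cont: "continuous_on UNIV f"
    using f(1) by (rule DERIV_imp_continuous_on_UNIV)
  have int1: "integrable lborel (\<lambda>u. deriv K u * f (x - h * u))"
    by (rule integrable_compact_support)
      (auto intro!: continuous_intros K'_cont continuous_on_compose2[OF f_cont] simp: K'_zero)
  have int2: "integrable lborel (\<lambda>u. K u * f' (x - h * u))"
    by (rule integrable_compact_support)
      (auto intro!: continuous_intros K_cont continuous_on_compose2[OF f(2)] simp: K_zero)
  have "(LINT u|lborel. deriv K u * f (x - h * u) - h * (K u * f' (x - h * u))) = 0"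
  proof (rule integral_derivative_vanishing_at_infinity[where F = "\<lambda>u. K u * f (x - h * u)"])
    show "((\<lambda>u. K u * f (x - h * u)) has_real_derivative deriv K u * f (x - h * u) - h * (K u * f' (x - h * u))) (at u)" for u
      by (rule derivative_eq_intros K_deriv DERIV_chain'[where f = "\<lambda>u. x - h * u", OF _ f(1)] refl)+
        (simp add: algebra_simps)
    show "continuous_on UNIV (\<lambda>u. deriv K u * f (x - h * u) - h * (K u * f' (x - h * u)))"
      by (intro continuous_intros K_cont K'_cont continuous_on_compose2[OF f_cont] continuous_on_compose2[OF f(2)]) auto
    show "integrable lborel (\<lambda>u. deriv K u * f (x - h * u) - h * (K u * f' (x - h * u)))"
      using int1 int2 by simp
    have "eventually (\<lambda>u. K u * f (x - h * u) = 0) at_infinity"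
      unfolding eventually_at_infinity by (rule exI[of _ 2]) (auto simp: K_zero)
    then show "((\<lambda>u. K u * f (x - h * u)) \<longlongrightarrow> 0) at_infinity" by (rule tendsto_eventually)
  qed
  then have "(LINT u|lborel. deriv K u * f (x - h * u)) = h * (LINT u|lborel. K u * f' (x - h * u))"
    using int1 int2 by simp
  moreover have "(LINT z|lborel. deriv K ((x - z) / h) / h\<^sup>2 * f z) = (LINT u|lborel. deriv K u * f (x - h * u)) / h"
  proof -
    have "(\<lambda>u. deriv K ((x - (x - h * u)) / h) / h\<^sup>2 * f (x - h * u)) = (\<lambda>u. deriv K u * f (x - h * u) / h\<^sup>2)"
      using h by simp
    then show ?thesis
      using integral_affine_minus[OF h, of "\<lambda>z. deriv K ((x - z) / h) / h\<^sup>2 * f z" x] h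
      by (simp add: power2_eq_square)
  qed
  ultimately show ?thesis using h by simp
qed

end

section \<open>The criterion for a fixed density estimate\<close>

text \<open>The derivative is a separate argument so that explicit expressions, such as the one for
  the kernel estimate, can be supplied for it.\<close>

definition smooth_bounded :: "(real \<Rightarrow> real) \<Rightarrow> (real \<Rightarrow> real) \<Rightarrow> bool" where
  "smooth_bounded f f' \<longleftrightarrow> (\<forall>x. (f has_real_derivative f' x) (at x)) \<and> continuous_on UNIV f' \<and>
     (\<exists>B. \<forall>x. \<bar>f x\<bar> \<le> B \<and> \<bar>f' x\<bar> \<le> B)"

lemma smooth_boundedD:
  assumes "smooth_bounded f f'"
  shows "(f has_real_derivative f' x) (at x)" "continuous_on UNIV f'" "continuous_on UNIV f"
    "f \<in> borel_measurable borel" "f' \<in> borel_measurable borel"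
proof -
  show d: "(f has_real_derivative f' x) (at x)" for x using assms by (simp add: smooth_bounded_def)
  show c': "continuous_on UNIV f'" using assms by (simp add: smooth_bounded_def)
  show c: "continuous_on UNIV f" using d by (rule DERIV_imp_continuous_on_UNIV)
  show "f \<in> borel_measurable borel" "f' \<in> borel_measurable borel"
    using c c' by (auto intro: borel_measurable_continuous_onI)
qed

lemma smooth_bounded_bound:
  assumes "smooth_bounded f f'"
  obtains B where "B > 0" "\<And>x. \<bar>f x\<bar> \<le> B" "\<And>x. \<bar>f' x\<bar> \<le> B"
proof -
  obtain B where B: "\<And>x. \<bar>f x\<bar> \<le> B" "\<And>x. \<bar>f' x\<bar> \<le> B"
    using assms unfolding smooth_bounded_def by blast
  have "\<bar>f x\<bar> \<le> \<bar>B\<bar> + 1" "\<bar>f' x\<bar> \<le> \<bar>B\<bar> + 1" for x using B[of x] by linarith+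
  then show ?thesis using that[of "\<bar>B\<bar> + 1"] by simp
qed

lemma smooth_bounded_diff:
  assumes "smooth_bounded f f'" "smooth_bounded g g'"
  shows "smooth_bounded (\<lambda>x. f x - g x) (\<lambda>x. f' x - g' x)"
proof -
  obtain B C where B: "\<And>x. \<bar>f x\<bar> \<le> B" "\<And>x. \<bar>f' x\<bar> \<le> B" and C: "\<And>x. \<bar>g x\<bar> \<le> C" "\<And>x. \<bar>g' x\<bar> \<le> C"
    using smooth_bounded_bound[OF assms(1)] smooth_bounded_bound[OF assms(2)] by metis
  have "\<bar>f x - g x\<bar> \<le> B + C \<and> \<bar>f' x - g' x\<bar> \<le> B + C" for x
    using B[of x] C[of x] by linarith
  then show ?thesis
    unfolding smooth_bounded_def
    using smooth_boundedD[OF assms(1)] smooth_boundedD[OF assms(2)]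
    by (intro conjI allI exI[of _ "B + C"] DERIV_diff continuous_on_diff) auto
qed

lemma smooth_bounded_mult:
  assumes "smooth_bounded f f'" "smooth_bounded g g'"
  shows "smooth_bounded (\<lambda>x. f x * g x) (\<lambda>x. f' x * g x + f x * g' x)"
proof -
  obtain B where B: "B > 0" "\<And>x. \<bar>f x\<bar> \<le> B" "\<And>x. \<bar>f' x\<bar> \<le> B" by (rule smooth_bounded_bound[OF assms(1)]) blast
  obtain C where C: "C > 0" "\<And>x. \<bar>g x\<bar> \<le> C" "\<And>x. \<bar>g' x\<bar> \<le> C" by (rule smooth_bounded_bound[OF assms(2)]) blast
  have prod: "\<bar>p * q\<bar> \<le> B * C" if "\<bar>p\<bar> \<le> B" "\<bar>q\<bar> \<le> C" for p q
    using that B(1) C(1) by (simp add: abs_mult mult_mono)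
  have "\<bar>f x * g x\<bar> \<le> 2 * (B * C)" "\<bar>f' x * g x + f x * g' x\<bar> \<le> 2 * (B * C)" for x
    using prod[OF B(2)[of x] C(2)[of x]] prod[OF B(3)[of x] C(2)[of x]] prod[OF B(2)[of x] C(3)[of x]] by linarith+
  then have "\<exists>D. \<forall>x. \<bar>f x * g x\<bar> \<le> D \<and> \<bar>f' x * g x + f x * g' x\<bar> \<le> D" by blast
  moreover have "((\<lambda>x. f x * g x) has_real_derivative f' x * g x + f x * g' x) (at x)" for x
    using DERIV_mult[OF smooth_boundedD(1)[OF assms(1)] smooth_boundedD(1)[OF assms(2)], of x] by (simp only: mult.commute add.commute)
  moreover have "continuous_on UNIV (\<lambda>x. f' x * g x + f x * g' x)"
    by (intro continuous_intros smooth_boundedD(2,3)[OF assms(1)] smooth_boundedD(2,3)[OF assms(2)])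
  ultimately show ?thesis unfolding smooth_bounded_def by blast
qed

lemma square_diff3_le: "(p - q - r)\<^sup>2 \<le> 3 * (p\<^sup>2 + q\<^sup>2 + r\<^sup>2)" for p q r :: real
proof -
  have "3 * (p\<^sup>2 + q\<^sup>2 + r\<^sup>2) - (p - q - r)\<^sup>2 = (p + q)\<^sup>2 + (p + r)\<^sup>2 + (q - r)\<^sup>2"
    by (simp add: power2_eq_square algebra_simps)
  moreover have "0 \<le> (p + q)\<^sup>2 + (p + r)\<^sup>2 + (q - r)\<^sup>2" by simp
  ultimately show ?thesis by linarith
qed

text \<open>The deterministic half of the argument. One integrable envelope \<open>G\<close>
  dominates all coefficient products that occur. \<open>m\<close> is the derivative of the drift in
  the parameter, \<open>m'\<close> that of \<open>m\<close> in x at \<open>\<theta>\<^sub>0\<close>;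
  the second parameter derivative enters only through the Lipschitz constant \<open>\<mu>3\<close>
  of \<open>m\<close>.\<close>

locale drift_regression =
  fixes a b \<theta>\<^sub>0 P :: real and \<mu> m :: "real \<Rightarrow> real \<Rightarrow> real"
    and m' \<sigma> \<sigma>' w w' \<pi> \<pi>' \<mu>1 \<mu>2 \<mu>3 G :: "real \<Rightarrow> real"
  assumes \<theta>\<^sub>0: "\<theta>\<^sub>0 \<in> {a<..<b}"
    and \<mu>_deriv: "\<And>x \<theta>. \<theta> \<in> {a..b} \<Longrightarrow> (\<mu> x has_real_derivative m x \<theta>) (at \<theta> within {a..b})"
    and m_lipschitz: "\<And>x \<theta>. \<theta> \<in> {a..b} \<Longrightarrow> \<bar>m x \<theta> - m x \<theta>\<^sub>0\<bar> \<le> \<mu>3 x * \<bar>\<theta> - \<theta>\<^sub>0\<bar>"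
    and \<mu>_cont: "\<And>\<theta>. \<theta> \<in> {a..b} \<Longrightarrow> continuous_on UNIV (\<lambda>x. \<mu> x \<theta>)"
    and m_cont: "\<And>\<theta>. \<theta> \<in> {a..b} \<Longrightarrow> continuous_on UNIV (\<lambda>x. m x \<theta>)"
    and m_deriv: "\<And>x. ((\<lambda>y. m y \<theta>\<^sub>0) has_real_derivative m' x) (at x)" "continuous_on UNIV m'"
    and \<sigma>_deriv: "\<And>x. (\<sigma> has_real_derivative \<sigma>' x) (at x)" "continuous_on UNIV \<sigma>'"
    and w_deriv: "\<And>x. (w has_real_derivative w' x) (at x)" "continuous_on UNIV w'"
    and w_nonneg: "\<And>x. 0 \<le> w x"
    and \<mu>_bound: "\<And>x \<theta>. \<theta> \<in> {a..b} \<Longrightarrow> \<bar>\<mu> x \<theta>\<bar> \<le> \<mu>1 x"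
    and m_bound: "\<And>x \<theta>. \<theta> \<in> {a..b} \<Longrightarrow> \<bar>m x \<theta>\<bar> \<le> \<mu>2 x"
    and \<mu>3_nonneg: "\<And>x. 0 \<le> \<mu>3 x"
    and density: "smooth_bounded \<pi> \<pi>'"
    and P: "0 < P" "\<And>x. \<bar>\<pi> x\<bar> \<le> P" "\<And>x. \<bar>\<pi>' x\<bar> \<le> P"
    and stationary_equation: "\<And>x. \<mu> x \<theta>\<^sub>0 * \<pi> x = \<sigma> x * \<sigma>' x * \<pi> x + (\<sigma> x)\<^sup>2 / 2 * \<pi>' x"
    and G_integrable: "integrable lborel G"
    and G_bounds: "\<And>x. (\<mu>1 x)\<^sup>2 * w x \<le> G x" "\<And>x. \<sigma> x ^ 4 * w x \<le> G x"
      "\<And>x. (\<sigma> x)\<^sup>2 * (\<sigma>' x)\<^sup>2 * w x \<le> G x"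
    and G_bounds_m': "\<And>x. \<bar>m' x\<bar> * (\<sigma> x)\<^sup>2 * w x \<le> G x" "\<And>x. \<mu>2 x * (\<sigma> x)\<^sup>2 * \<bar>w' x\<bar> \<le> G x"
    and G_bounds_\<mu>2: "\<And>x. \<mu>2 x * \<mu>1 x * w x \<le> G x" "\<And>x. \<mu>2 x * \<bar>\<sigma> x * \<sigma>' x\<bar> * w x \<le> G x"
      "\<And>x. \<mu>2 x * (\<sigma> x)\<^sup>2 * w x \<le> G x" "\<And>x. (\<mu>2 x)\<^sup>2 * w x \<le> G x"
    and G_bounds_\<mu>3: "\<And>x. \<mu>3 x * \<mu>1 x * w x \<le> G x" "\<And>x. \<mu>3 x * \<bar>\<sigma> x * \<sigma>' x\<bar> * w x \<le> G x"
      "\<And>x. \<mu>3 x * (\<sigma> x)\<^sup>2 * w x \<le> G x" "\<And>x. \<mu>3 x * \<mu>2 x * w x \<le> G x"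
    and decay: "((\<lambda>x. \<mu>2 x * w x * (\<sigma> x)\<^sup>2) \<longlongrightarrow> 0) at_infinity"
begin

lemma \<theta>\<^sub>0_in: "\<theta>\<^sub>0 \<in> {a..b}" using \<theta>\<^sub>0 by simp

lemma ab: "a < b" using \<theta>\<^sub>0 by simp

lemma G_nonneg: "0 \<le> G x"
  using G_bounds(2)[of x] w_nonneg[of x] by (meson order.trans mult_nonneg_nonneg zero_le_even_power even_numeral)

lemma \<mu>2_nonneg: "0 \<le> \<mu>2 x" using m_bound[OF \<theta>\<^sub>0_in, of x] by linarith

lemma \<sigma>_cont: "continuous_on UNIV \<sigma>" using \<sigma>_deriv(1) by (rule DERIV_imp_continuous_on_UNIV)

lemma w_cont: "continuous_on UNIV w" using w_deriv(1) by (rule DERIV_imp_continuous_on_UNIV)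

lemmas coefficient_continuity = \<mu>_cont m_cont m_deriv(2) \<sigma>_deriv(2) w_deriv(2) \<sigma>_cont w_cont
  smooth_boundedD(2)[OF density] smooth_boundedD(3)[OF density]

lemma integrable_of_G_bound:
  assumes "continuous_on UNIV g" "\<And>x. \<bar>g x\<bar> \<le> c * G x"
  shows "integrable lborel g"
proof (rule Bochner_Integration.integrable_bound[OF integrable_mult_right[OF G_integrable, of c]])
  show "g \<in> borel_measurable lborel" using borel_measurable_continuous_onI[OF assms(1)] by simp
  show "AE x in lborel. norm (g x) \<le> norm (c * G x)"
    using assms(2) by (auto intro: order.trans[OF _ abs_ge_self])
qed

text \<open>This is the operator \<open>L\<close> of the overview at a general parameter, with the
  derivative of the product expanded; it is linear in the pair \<open>f\<close>,
  \<open>f'\<close>.\<close>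

definition residual :: "(real \<Rightarrow> real) \<Rightarrow> (real \<Rightarrow> real) \<Rightarrow> real \<Rightarrow> real \<Rightarrow> real" where
  "residual f f' \<theta> x = \<mu> x \<theta> * f x - \<sigma> x * \<sigma>' x * f x - (\<sigma> x)\<^sup>2 / 2 * f' x"

definition score :: "(real \<Rightarrow> real) \<Rightarrow> (real \<Rightarrow> real) \<Rightarrow> real \<Rightarrow> real" where
  "score f f' \<theta> = (LINT x|lborel. 2 * residual f f' \<theta> x * m x \<theta> * f x * w x)"

text \<open>The second derivative of the limit criterion at \<open>\<theta>\<^sub>0\<close>: the
  term with the second derivative of the drift carries the factor
  \<open>residual \<pi> \<pi>'\<close>, which is zero there.\<close>

definition information :: real where
  "information = (LINT x|lborel. 2 * (m x \<theta>\<^sub>0)\<^sup>2 * (\<pi> x)\<^sup>2 * w x)"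

text \<open>Squares arise from products of errors and first powers from terms linear in the error. A
  single quantity that vanishes in mean then serves both consistency and linearization.\<close>

definition deviation :: "(real \<Rightarrow> real) \<Rightarrow> (real \<Rightarrow> real) \<Rightarrow> real" where
  "deviation f f' = (LINT x|lborel. G x * ((f x - \<pi> x)\<^sup>2 + (f' x - \<pi>' x)\<^sup>2 + \<bar>f x - \<pi> x\<bar> + \<bar>f' x - \<pi>' x\<bar>))"

text \<open>The function \<open>v\<close> of the theorem, with the derivative of the triple product
  written out.\<close>

definition influence :: "real \<Rightarrow> real" where
  "influence x = 2 * m x \<theta>\<^sub>0 * \<mu> x \<theta>\<^sub>0 * \<pi> x * w x +
     (m' x * \<pi> x * w x + m x \<theta>\<^sub>0 * \<pi>' x * w x + m x \<theta>\<^sub>0 * \<pi> x * w' x) * (\<sigma> x)\<^sup>2"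

section \<open>Pointwise bounds and integrability of the residual\<close>

lemma residual_density: "residual \<pi> \<pi>' \<theta>\<^sub>0 x = 0"
  unfolding residual_def using stationary_equation[of x] by simp

lemma residual_diff:
  "residual (\<lambda>x. f x - g x) (\<lambda>x. f' x - g' x) \<theta> x = residual f f' \<theta> x - residual g g' \<theta> x"
  unfolding residual_def by (simp add: field_simps)

lemma residual_cont:
  assumes "smooth_bounded f f'" "\<theta> \<in> {a..b}"
  shows "continuous_on UNIV (residual f f' \<theta>)"
  unfolding residual_def using assms
  by (intro continuous_intros coefficient_continuity smooth_boundedD(2,3)[OF assms(1)]) auto

lemma residual_square_bound:
  assumes "\<theta> \<in> {a..b}"
  shows "(residual f f' \<theta> x)\<^sup>2 * w x \<le> 6 * G x * ((f x)\<^sup>2 + (f' x)\<^sup>2)"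
proof -
  have "(\<mu> x \<theta>)\<^sup>2 \<le> (\<mu>1 x)\<^sup>2"
    using \<mu>_bound[OF assms, of x] by (metis abs_ge_zero power2_abs power_mono)
  then have \<mu>: "(\<mu> x \<theta>)\<^sup>2 * w x \<le> G x"
    using G_bounds(1)[of x] mult_right_mono[OF _ w_nonneg[of x]] by fastforce
  have "(residual f f' \<theta> x)\<^sup>2 * w x \<le> (3 * ((\<mu> x \<theta> * f x)\<^sup>2 + (\<sigma> x * \<sigma>' x * f x)\<^sup>2 + ((\<sigma> x)\<^sup>2 / 2 * f' x)\<^sup>2)) * w x"
    unfolding residual_def by (intro mult_right_mono square_diff3_le w_nonneg)
  also have "\<dots> = 3 * ((\<mu> x \<theta>)\<^sup>2 * w x * (f x)\<^sup>2 + (\<sigma> x)\<^sup>2 * (\<sigma>' x)\<^sup>2 * w x * (f x)\<^sup>2 + \<sigma> x ^ 4 * w x * ((f' x)\<^sup>2 / 4))"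
    by (simp add: power_mult_distrib power_divide algebra_simps)
  also have "\<dots> \<le> 3 * (G x * (f x)\<^sup>2 + G x * (f x)\<^sup>2 + G x * ((f' x)\<^sup>2 / 4))"
    by (intro mult_left_mono add_mono mult_right_mono \<mu> G_bounds) auto
  also have "\<dots> \<le> 6 * G x * ((f x)\<^sup>2 + (f' x)\<^sup>2)"
    using G_nonneg[of x] by (simp add: algebra_simps)
  finally show ?thesis .
qed

text \<open>The weight \<open>c\<close> is left generic because it will be \<open>\<mu>2\<close> for
  the score and \<open>\<mu>3\<close> for its increment.\<close>

lemma residual_weight_bound:
  assumes "\<theta> \<in> {a..b}" and c: "0 \<le> c" "c * \<mu>1 x * w x \<le> G x" "c * \<bar>\<sigma> x * \<sigma>' x\<bar> * w x \<le> G x" "c * (\<sigma> x)\<^sup>2 * w x \<le> G x"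
  shows "\<bar>residual f f' \<theta> x\<bar> * (c * w x) \<le> G x * (2 * \<bar>f x\<bar> + \<bar>f' x\<bar>)"
proof -
  have "\<bar>residual f f' \<theta> x\<bar> \<le> \<bar>\<mu> x \<theta>\<bar> * \<bar>f x\<bar> + \<bar>\<sigma> x * \<sigma>' x\<bar> * \<bar>f x\<bar> + (\<sigma> x)\<^sup>2 / 2 * \<bar>f' x\<bar>"
    unfolding residual_def
    by (rule order.trans[OF abs_triangle_ineq4 add_mono[OF abs_triangle_ineq4[THEN order.trans]]]) (auto simp: abs_mult)
  also have "\<dots> \<le> \<mu>1 x * \<bar>f x\<bar> + \<bar>\<sigma> x * \<sigma>' x\<bar> * \<bar>f x\<bar> + (\<sigma> x)\<^sup>2 * \<bar>f' x\<bar>"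
    using \<mu>_bound[OF assms(1), of x] by (intro add_mono mult_right_mono) auto
  finally have "\<bar>residual f f' \<theta> x\<bar> * (c * w x) \<le>
      (\<mu>1 x * \<bar>f x\<bar> + \<bar>\<sigma> x * \<sigma>' x\<bar> * \<bar>f x\<bar> + (\<sigma> x)\<^sup>2 * \<bar>f' x\<bar>) * (c * w x)"
    by (rule mult_right_mono) (use c(1) w_nonneg in simp)
  also have "\<dots> = c * \<mu>1 x * w x * \<bar>f x\<bar> + c * \<bar>\<sigma> x * \<sigma>' x\<bar> * w x * \<bar>f x\<bar> + c * (\<sigma> x)\<^sup>2 * w x * \<bar>f' x\<bar>"
    by (simp only: distrib_right distrib_left ac_simps)
  also have "\<dots> \<le> G x * \<bar>f x\<bar> + G x * \<bar>f x\<bar> + G x * \<bar>f' x\<bar>"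
    by (intro add_mono mult_right_mono c) auto
  finally show ?thesis by (simp add: algebra_simps)
qed

lemmas residual_\<mu>2_bound = residual_weight_bound[OF _ \<mu>2_nonneg G_bounds_\<mu>2(1-3)]
lemmas residual_\<mu>3_bound = residual_weight_bound[OF _ \<mu>3_nonneg G_bounds_\<mu>3(1-3)]

lemma residual_square_integrable:
  assumes f: "smooth_bounded f f'" and \<theta>: "\<theta> \<in> {a..b}"
  shows "integrable lborel (\<lambda>x. (residual f f' \<theta> x)\<^sup>2 * w x)"
proof -
  obtain B where B: "B > 0" "\<And>x. \<bar>f x\<bar> \<le> B" "\<And>x. \<bar>f' x\<bar> \<le> B" by (rule smooth_bounded_bound[OF f]) blast
  show ?thesis
  proof (rule integrable_of_G_bound[where c = "12 * B\<^sup>2"])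
    show "continuous_on UNIV (\<lambda>x. (residual f f' \<theta> x)\<^sup>2 * w x)"
      by (intro continuous_intros residual_cont f \<theta> w_cont)
    fix x
    have "(f x)\<^sup>2 \<le> B\<^sup>2" "(f' x)\<^sup>2 \<le> B\<^sup>2" using B by (metis abs_ge_zero power2_abs power_mono)+
    then have "6 * G x * ((f x)\<^sup>2 + (f' x)\<^sup>2) \<le> 6 * G x * (B\<^sup>2 + B\<^sup>2)"
      using G_nonneg[of x] by (intro mult_left_mono add_mono) auto
    from order.trans[OF residual_square_bound[OF \<theta>, of f f' x] this]
    have "(residual f f' \<theta> x)\<^sup>2 * w x \<le> 12 * B\<^sup>2 * G x" by (simp add: ac_simps)
    then show "\<bar>(residual f f' \<theta> x)\<^sup>2 * w x\<bar> \<le> 12 * B\<^sup>2 * G x"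
      using w_nonneg[of x] by (simp add: abs_of_nonneg)
  qed
qed

section \<open>Score integrals and derivatives of the criterion\<close>

lemma score_integrand_bound:
  assumes \<theta>: "\<theta> \<in> {a..b}" and B: "\<bar>f x\<bar> \<le> B" "\<bar>f' x\<bar> \<le> B"
  shows "\<bar>2 * residual f f' \<theta> x * m x \<theta> * f x * w x\<bar> \<le> 6 * B\<^sup>2 * G x"
proof -
  have B0: "0 \<le> B" using B(1) by linarith
  have "\<bar>2 * residual f f' \<theta> x * m x \<theta> * f x * w x\<bar> = 2 * (\<bar>residual f f' \<theta> x\<bar> * (\<bar>m x \<theta>\<bar> * w x)) * \<bar>f x\<bar>"
    using w_nonneg[of x] by (simp add: abs_mult)
  also have "\<dots> \<le> 2 * (\<bar>residual f f' \<theta> x\<bar> * (\<mu>2 x * w x)) * B"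
    using m_bound[OF \<theta>, of x] w_nonneg[of x] B \<mu>2_nonneg[of x] by (intro mult_mono mult_left_mono mult_right_mono) auto
  also have "\<dots> \<le> 2 * (G x * (2 * \<bar>f x\<bar> + \<bar>f' x\<bar>)) * B"
    using residual_\<mu>2_bound[OF \<theta>] B0 by (intro mult_right_mono mult_left_mono) auto
  also have "\<dots> \<le> 2 * (G x * (2 * B + B)) * B"
    using G_nonneg B B0 by (intro mult_right_mono mult_left_mono add_mono) auto
  finally show ?thesis by (simp add: power2_eq_square ac_simps)
qed

lemma score_integrand_cont:
  assumes f: "smooth_bounded f f'" and \<theta>: "\<theta> \<in> {a..b}"
  shows "continuous_on UNIV (\<lambda>x. 2 * residual f f' \<theta> x * m x \<theta> * f x * w x)"
  by (intro continuous_intros residual_cont f \<theta> coefficient_continuity smooth_boundedD(3)[OF f])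

lemma score_integrable:
  assumes f: "smooth_bounded f f'" and \<theta>: "\<theta> \<in> {a..b}"
  shows "integrable lborel (\<lambda>x. 2 * residual f f' \<theta> x * m x \<theta> * f x * w x)"
proof -
  obtain B where B: "B > 0" "\<And>x. \<bar>f x\<bar> \<le> B" "\<And>x. \<bar>f' x\<bar> \<le> B" by (rule smooth_bounded_bound[OF f]) blast
  show ?thesis
    by (rule integrable_of_G_bound[OF score_integrand_cont[OF f \<theta>], of "6 * B\<^sup>2"]) (intro score_integrand_bound \<theta> B)
qed

lemma criterion_eq:
  assumes f: "smooth_bounded f f'"
  shows "criterion \<mu> \<sigma> w f = (\<lambda>\<theta>. LINT x|lborel. (residual f f' \<theta> x)\<^sup>2 * w x)"
proof -
  have "deriv (\<lambda>y. (\<sigma> y)\<^sup>2 * f y) x = 2 * \<sigma> x * \<sigma>' x * f x + (\<sigma> x)\<^sup>2 * f' x" for x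
    by (rule DERIV_imp_deriv) (rule derivative_eq_intros \<sigma>_deriv(1) smooth_boundedD(1)[OF f] refl | simp add: algebra_simps)+
  then show ?thesis
    unfolding criterion_def residual_def by (simp add: algebra_simps)
qed

lemma criterion_has_derivative:
  assumes f: "smooth_bounded f f'" and \<theta>: "\<theta> \<in> {a..b}"
  shows "(criterion \<mu> \<sigma> w f has_real_derivative score f f' \<theta>) (at \<theta> within {a..b})"
proof -
  obtain B where B: "B > 0" "\<And>x. \<bar>f x\<bar> \<le> B" "\<And>x. \<bar>f' x\<bar> \<le> B" by (rule smooth_bounded_bound[OF f]) blast
  show ?thesis
    unfolding criterion_eq[OF f] score_def
  proof (rule has_real_derivative_integral[where g = "\<lambda>x. 6 * B\<^sup>2 * G x"])
    show "((\<lambda>\<theta>. (residual f f' \<theta> x)\<^sup>2 * w x) has_real_derivative 2 * residual f f' t x * m x t * f x * w x) (at t within {a..b})"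
      if "t \<in> {a..b}" for x t
    proof -
      have "((\<lambda>\<theta>. residual f f' \<theta> x) has_real_derivative m x t * f x) (at t within {a..b})"
        unfolding residual_def
        by (rule derivative_eq_intros \<mu>_deriv[OF that] refl)+ simp
      from DERIV_cmult_right[OF DERIV_power[OF this, of 2], of "w x"] show ?thesis
        by (simp add: ac_simps)
    qed
    show "\<bar>2 * residual f f' t x * m x t * f x * w x\<bar> \<le> 6 * B\<^sup>2 * G x" if "t \<in> {a..b}" for x t
      by (intro score_integrand_bound that B)
    show "(\<lambda>x. 2 * residual f f' \<theta> x * m x \<theta> * f x * w x) \<in> borel_measurable borel"
      by (rule borel_measurable_continuous_onI[OF score_integrand_cont[OF f \<theta>]])
  qed (use G_integrable residual_square_integrable[OF f] \<theta> in auto)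
qed

lemma deviation_integrable:
  assumes f: "smooth_bounded f f'"
  shows "integrable lborel (\<lambda>x. G x * ((f x - \<pi> x)\<^sup>2 + (f' x - \<pi>' x)\<^sup>2 + \<bar>f x - \<pi> x\<bar> + \<bar>f' x - \<pi>' x\<bar>))"
proof -
  obtain B where B: "B > 0" "\<And>x. \<bar>f x - \<pi> x\<bar> \<le> B" "\<And>x. \<bar>f' x - \<pi>' x\<bar> \<le> B"
    by (rule smooth_bounded_bound[OF smooth_bounded_diff[OF f density]]) blast
  have [measurable]: "f \<in> borel_measurable borel" "f' \<in> borel_measurable borel" "\<pi> \<in> borel_measurable borel" "\<pi>' \<in> borel_measurable borel"
    "G \<in> borel_measurable borel"
    using smooth_boundedD[OF f] smooth_boundedD[OF density] G_integrable by auto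
  show ?thesis
  proof (rule Bochner_Integration.integrable_bound[OF integrable_mult_right[OF G_integrable, of "2 * B\<^sup>2 + 2 * B"]])
    show "AE x in lborel. norm (G x * ((f x - \<pi> x)\<^sup>2 + (f' x - \<pi>' x)\<^sup>2 + \<bar>f x - \<pi> x\<bar> + \<bar>f' x - \<pi>' x\<bar>)) \<le> norm ((2 * B\<^sup>2 + 2 * B) * G x)"
    proof (rule AE_I2)
      fix x
      have "(f x - \<pi> x)\<^sup>2 \<le> B\<^sup>2" "(f' x - \<pi>' x)\<^sup>2 \<le> B\<^sup>2" using B by (metis abs_ge_zero power2_abs power_mono)+
      then have "(f x - \<pi> x)\<^sup>2 + (f' x - \<pi>' x)\<^sup>2 + \<bar>f x - \<pi> x\<bar> + \<bar>f' x - \<pi>' x\<bar> \<le> 2 * B\<^sup>2 + 2 * B"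
        using B(2)[of x] B(3)[of x] by linarith
      then have le: "G x * ((f x - \<pi> x)\<^sup>2 + (f' x - \<pi>' x)\<^sup>2 + \<bar>f x - \<pi> x\<bar> + \<bar>f' x - \<pi>' x\<bar>) \<le> (2 * B\<^sup>2 + 2 * B) * G x"
        unfolding mult.commute[of _ "G x"] by (rule mult_left_mono[OF _ G_nonneg])
      have "0 \<le> (f x - \<pi> x)\<^sup>2 + (f' x - \<pi>' x)\<^sup>2 + \<bar>f x - \<pi> x\<bar> + \<bar>f' x - \<pi>' x\<bar>" by simp
      from mult_nonneg_nonneg[OF G_nonneg[of x] this] order.trans[OF mult_nonneg_nonneg[OF G_nonneg[of x] this] le] le
      show "norm (G x * ((f x - \<pi> x)\<^sup>2 + (f' x - \<pi>' x)\<^sup>2 + \<bar>f x - \<pi> x\<bar> + \<bar>f' x - \<pi>' x\<bar>)) \<le> norm ((2 * B\<^sup>2 + 2 * B) * G x)"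
        by (simp only: real_norm_def abs_of_nonneg)
    qed
  qed simp
qed

lemma squared_deviation_integrable:
  assumes f: "smooth_bounded f f'"
  shows "integrable lborel (\<lambda>x. G x * (f x - \<pi> x)\<^sup>2)" "integrable lborel (\<lambda>x. G x * ((f x - \<pi> x)\<^sup>2 + (f' x - \<pi>' x)\<^sup>2))"
proof -
  have [measurable]: "f \<in> borel_measurable borel" "f' \<in> borel_measurable borel" "\<pi> \<in> borel_measurable borel" "\<pi>' \<in> borel_measurable borel"
    "G \<in> borel_measurable borel"
    using smooth_boundedD[OF f] smooth_boundedD[OF density] G_integrable by auto
  show "integrable lborel (\<lambda>x. G x * (f x - \<pi> x)\<^sup>2)" "integrable lborel (\<lambda>x. G x * ((f x - \<pi> x)\<^sup>2 + (f' x - \<pi>' x)\<^sup>2))"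
    by (rule Bochner_Integration.integrable_bound[OF deviation_integrable[OF f]];
        use G_nonneg in \<open>auto simp: abs_mult intro!: mult_left_mono\<close>)+
qed

lemma squared_deviation_le:
  assumes f: "smooth_bounded f f'"
  shows "(LINT x|lborel. G x * ((f x - \<pi> x)\<^sup>2 + (f' x - \<pi>' x)\<^sup>2)) \<le> deviation f f'"
  unfolding deviation_def using G_nonneg
  by (intro integral_mono squared_deviation_integrable deviation_integrable f mult_left_mono) auto

text \<open>The source of consistency. At \<open>\<theta>\<^sub>0\<close> the residual of
  \<open>f\<close> is that of the error, so by minimality the criterion of \<open>f\<close> at
  \<open>t\<close> is at most \<open>6 * deviation f f'\<close>. Subtracting the residual of the
  error at \<open>t\<close> and using
  \<open>(p - q)\<^sup>2 \<le> 2 * p\<^sup>2 + 2 * q\<^sup>2\<close> gives 12 + 12.\<close>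

lemma criterion_at_minimizer:
  assumes f: "smooth_bounded f f'" and t: "is_arg_min (criterion \<mu> \<sigma> w f) (\<lambda>\<theta>. \<theta> \<in> {a..b}) t"
  shows "criterion \<mu> \<sigma> w \<pi> t \<le> 24 * deviation f f'"
proof -
  define e e' where "e = (\<lambda>x. f x - \<pi> x)" and "e' = (\<lambda>x. f' x - \<pi>' x)"
  have e: "smooth_bounded e e'" unfolding e_def e'_def by (rule smooth_bounded_diff[OF f density])
  have t_in: "t \<in> {a..b}" and min: "criterion \<mu> \<sigma> w f t \<le> criterion \<mu> \<sigma> w f \<theta>\<^sub>0"
    using t \<theta>\<^sub>0_in unfolding is_arg_min_def by (auto simp: not_less)
  let ?I = "\<lambda>g g' \<theta>. LINT x|lborel. (residual g g' \<theta> x)\<^sup>2 * w x"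
  have e_le: "?I e e' \<theta> \<le> 6 * deviation f f'" if "\<theta> \<in> {a..b}" for \<theta>
  proof -
    have "?I e e' \<theta> \<le> (LINT x|lborel. 6 * (G x * ((f x - \<pi> x)\<^sup>2 + (f' x - \<pi>' x)\<^sup>2)))"
    proof (rule integral_mono[OF residual_square_integrable[OF e that]])
      show "integrable lborel (\<lambda>x. 6 * (G x * ((f x - \<pi> x)\<^sup>2 + (f' x - \<pi>' x)\<^sup>2)))"
        by (intro integrable_mult_right squared_deviation_integrable f)
      show "(residual e e' \<theta> x)\<^sup>2 * w x \<le> 6 * (G x * ((f x - \<pi> x)\<^sup>2 + (f' x - \<pi>' x)\<^sup>2))" for x
        using residual_square_bound[OF that, of e e' x] unfolding e_def e'_def by (simp only: mult.assoc)
    qed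
    also have "\<dots> = 6 * (LINT x|lborel. G x * ((f x - \<pi> x)\<^sup>2 + (f' x - \<pi>' x)\<^sup>2))" by (rule integral_mult_right_zero)
    finally show ?thesis using squared_deviation_le[OF f] by linarith
  qed
  have "?I f f' \<theta>\<^sub>0 = ?I e e' \<theta>\<^sub>0"
    unfolding e_def e'_def residual_diff residual_density by simp
  then have f_t: "?I f f' t \<le> 6 * deviation f f'"
    using min e_le[OF \<theta>\<^sub>0_in] unfolding criterion_eq[OF f] by simp
  have "?I \<pi> \<pi>' t \<le> (LINT x|lborel. 2 * ((residual f f' t x)\<^sup>2 * w x) + 2 * ((residual e e' t x)\<^sup>2 * w x))"
  proof (rule integral_mono[OF residual_square_integrable[OF density t_in]])
    show "integrable lborel (\<lambda>x. 2 * ((residual f f' t x)\<^sup>2 * w x) + 2 * ((residual e e' t x)\<^sup>2 * w x))"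
      by (intro Bochner_Integration.integrable_add integrable_mult_right residual_square_integrable f e t_in)
    fix x
    have "residual \<pi> \<pi>' t x = residual f f' t x - residual e e' t x"
      unfolding e_def e'_def residual_diff by simp
    moreover have "(p - q)\<^sup>2 \<le> 2 * p\<^sup>2 + 2 * q\<^sup>2" for p q :: real
      using zero_le_power2[of "p + q"] by (simp add: power2_eq_square algebra_simps)
    ultimately have "(residual \<pi> \<pi>' t x)\<^sup>2 * w x \<le> (2 * (residual f f' t x)\<^sup>2 + 2 * (residual e e' t x)\<^sup>2) * w x"
      by (intro mult_right_mono w_nonneg) simp
    then show "(residual \<pi> \<pi>' t x)\<^sup>2 * w x \<le> 2 * ((residual f f' t x)\<^sup>2 * w x) + 2 * ((residual e e' t x)\<^sup>2 * w x)"
      by (simp only: distrib_right mult.assoc)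
  qed
  also have "\<dots> = 2 * ?I f f' t + 2 * ?I e e' t"
    using residual_square_integrable[OF f t_in] residual_square_integrable[OF e t_in] by simp
  finally show ?thesis
    using f_t e_le[OF t_in] unfolding criterion_eq[OF density] by linarith
qed

text \<open>After subtraction of the linear part the derivative in the parameter is
  \<open>m x t - m x \<theta>\<^sub>0\<close>, itself of first order by the Lipschitz bound.\<close>

lemma drift_taylor:
  assumes \<theta>: "\<theta> \<in> {a..b}"
  shows "\<bar>\<mu> x \<theta> - \<mu> x \<theta>\<^sub>0 - (\<theta> - \<theta>\<^sub>0) * m x \<theta>\<^sub>0\<bar> \<le> \<mu>3 x * (\<theta> - \<theta>\<^sub>0)\<^sup>2"
proof -
  let ?S = "closed_segment \<theta>\<^sub>0 \<theta>" and ?g = "\<lambda>t. \<mu> x t - t * m x \<theta>\<^sub>0"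
  have sub: "?S \<subseteq> {a..b}"
    by (rule closed_segment_subset) (use \<theta> \<theta>\<^sub>0_in in auto)
  have "norm (?g \<theta> - ?g \<theta>\<^sub>0) \<le> (\<mu>3 x * \<bar>\<theta> - \<theta>\<^sub>0\<bar>) * norm (\<theta> - \<theta>\<^sub>0)"
  proof (rule field_differentiable_bound[of ?S ?g "\<lambda>t. m x t - m x \<theta>\<^sub>0"])
    fix t assume t: "t \<in> ?S"
    then have t_in: "t \<in> {a..b}" using sub by blast
    have "(?g has_real_derivative m x t - m x \<theta>\<^sub>0) (at t within {a..b})"
      by (rule derivative_eq_intros \<mu>_deriv[OF t_in] refl)+ simp
    then show "(?g has_field_derivative m x t - m x \<theta>\<^sub>0) (at t within ?S)"
      using sub by (rule DERIV_subset)
    have "\<bar>t - \<theta>\<^sub>0\<bar> \<le> \<bar>\<theta> - \<theta>\<^sub>0\<bar>"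
      using t by (auto simp: closed_segment_eq_real_ivl split: if_splits)
    then show "norm (m x t - m x \<theta>\<^sub>0) \<le> \<mu>3 x * \<bar>\<theta> - \<theta>\<^sub>0\<bar>"
      using m_lipschitz[OF t_in, of x] mult_left_mono[OF _ \<mu>3_nonneg[of x]] by (fastforce intro: order.trans)
  qed auto
  then show ?thesis by (simp add: algebra_simps power2_eq_square)
qed

text \<open>Three effects are separated: \<open>T1\<close> is of second order in the parameter,
  \<open>T2\<close> replaces the squared estimate by the squared density in the main term, and
  \<open>T3\<close> pairs the residual at \<open>\<theta>\<^sub>0\<close>, which is linear in the
  error, with the increment of \<open>m\<close>.\<close>

lemma score_increment_integrand:
  assumes f: "smooth_bounded f f'" and \<theta>: "\<theta> \<in> {a..b}"
  defines "N \<equiv> \<bar>\<theta> - \<theta>\<^sub>0\<bar>"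
    and "e \<equiv> \<lambda>x. f x - \<pi> x" and "e' \<equiv> \<lambda>x. f' x - \<pi>' x"
  shows "\<bar>2 * residual f f' \<theta> x * m x \<theta> * f x * w x - 2 * residual f f' \<theta>\<^sub>0 x * m x \<theta>\<^sub>0 * f x * w x
      - (\<theta> - \<theta>\<^sub>0) * (2 * (m x \<theta>\<^sub>0)\<^sup>2 * (\<pi> x)\<^sup>2 * w x)\<bar>
    \<le> N\<^sup>2 * (8 * P\<^sup>2 * G x) + N * ((8 * (b - a) + 8 * P + 8) * (G x * ((e x)\<^sup>2 + (e' x)\<^sup>2 + \<bar>e x\<bar> + \<bar>e' x\<bar>)))"
proof -
  define d where "d = \<theta> - \<theta>\<^sub>0"
  define \<rho> where "\<rho> = m x \<theta> - m x \<theta>\<^sub>0"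
  define r where "r = \<mu> x \<theta> - \<mu> x \<theta>\<^sub>0 - d * m x \<theta>\<^sub>0"
  define c where "c = residual e e' \<theta>\<^sub>0 x"
  have N: "0 \<le> N" "N \<le> b - a" "\<bar>d\<bar> = N" "d\<^sup>2 = N\<^sup>2"
    using \<theta> \<theta>\<^sub>0_in unfolding N_def d_def by auto
  have \<rho>: "\<bar>\<rho>\<bar> \<le> \<mu>3 x * N" unfolding \<rho>_def N_def by (rule m_lipschitz[OF \<theta>])
  have r: "\<bar>r\<bar> \<le> \<mu>3 x * N\<^sup>2" using drift_taylor[OF \<theta>, of x] unfolding r_def N(4)[symmetric] d_def .
  have c: "residual f f' \<theta>\<^sub>0 x = c"
    unfolding c_def e_def e'_def residual_diff residual_density by simp
  have c_\<theta>: "residual f f' \<theta> x = c + (r + d * m x \<theta>\<^sub>0) * f x"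
    unfolding c[symmetric] r_def residual_def by (simp add: algebra_simps)
  have m_\<theta>: "m x \<theta> = m x \<theta>\<^sub>0 + \<rho>" unfolding \<rho>_def by simp
  define T1 where "T1 = 2 * (f x)\<^sup>2 * (w x * (d * m x \<theta>\<^sub>0 * \<rho> + r * m x \<theta>))"
  define T2 where "T2 = 2 * d * ((m x \<theta>\<^sub>0)\<^sup>2 * w x) * ((f x)\<^sup>2 - (\<pi> x)\<^sup>2)"
  define T3 where "T3 = 2 * (c * (\<rho> * w x)) * f x"
  have split: "2 * residual f f' \<theta> x * m x \<theta> * f x * w x - 2 * residual f f' \<theta>\<^sub>0 x * m x \<theta>\<^sub>0 * f x * w x
      - (\<theta> - \<theta>\<^sub>0) * (2 * (m x \<theta>\<^sub>0)\<^sup>2 * (\<pi> x)\<^sup>2 * w x) = T1 + T2 + T3"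
    unfolding T1_def T2_def T3_def c_\<theta> c d_def[symmetric] m_\<theta> by (simp add: algebra_simps power2_eq_square)
  have f_sq: "(f x)\<^sup>2 \<le> 2 * P\<^sup>2 + 2 * (e x)\<^sup>2"
  proof -
    have "(\<pi> x)\<^sup>2 \<le> P\<^sup>2" using P(2)[of x] by (metis abs_ge_zero power2_abs power_mono)
    moreover have "(f x)\<^sup>2 \<le> 2 * (\<pi> x)\<^sup>2 + 2 * (e x)\<^sup>2"
      using zero_le_power2[of "\<pi> x - e x"] unfolding e_def by (simp add: power2_eq_square algebra_simps)
    ultimately show ?thesis by linarith
  qed
  have f_abs: "\<bar>f x\<bar> \<le> P + \<bar>e x\<bar>" using P(2)[of x] unfolding e_def by linarith
  have T1_le: "\<bar>T1\<bar> \<le> N\<^sup>2 * (8 * P\<^sup>2 * G x) + N * (8 * (b - a) * (G x * (e x)\<^sup>2))"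
  proof -
    have "\<bar>d * m x \<theta>\<^sub>0 * \<rho> + r * m x \<theta>\<bar> \<le> \<bar>d\<bar> * \<bar>m x \<theta>\<^sub>0\<bar> * \<bar>\<rho>\<bar> + \<bar>r\<bar> * \<bar>m x \<theta>\<bar>"
      unfolding abs_mult[symmetric] by (rule abs_triangle_ineq)
    also have "\<dots> \<le> N * \<mu>2 x * (\<mu>3 x * N) + (\<mu>3 x * N\<^sup>2) * \<mu>2 x"
      using \<rho> r N m_bound[OF \<theta>] m_bound[OF \<theta>\<^sub>0_in] \<mu>2_nonneg[of x] \<mu>3_nonneg[of x] by (intro add_mono mult_mono) auto
    also have "\<dots> = 2 * N\<^sup>2 * (\<mu>3 x * \<mu>2 x)" by (simp add: power2_eq_square)
    finally have "w x * \<bar>d * m x \<theta>\<^sub>0 * \<rho> + r * m x \<theta>\<bar> \<le> w x * (2 * N\<^sup>2 * (\<mu>3 x * \<mu>2 x))"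
      by (rule mult_left_mono[OF _ w_nonneg])
    also have "\<dots> = 2 * N\<^sup>2 * (\<mu>3 x * \<mu>2 x * w x)" by (simp only: ac_simps)
    also have "\<dots> \<le> 2 * N\<^sup>2 * G x" by (intro mult_left_mono G_bounds_\<mu>3) simp
    finally have "w x * \<bar>d * m x \<theta>\<^sub>0 * \<rho> + r * m x \<theta>\<bar> \<le> 2 * N\<^sup>2 * G x" .
    then have "\<bar>T1\<bar> \<le> 2 * (f x)\<^sup>2 * (2 * N\<^sup>2 * G x)"
    proof -
      have "\<bar>T1\<bar> = 2 * (f x)\<^sup>2 * (w x * \<bar>d * m x \<theta>\<^sub>0 * \<rho> + r * m x \<theta>\<bar>)"
        unfolding T1_def using w_nonneg[of x] by (simp add: abs_mult)
      then show ?thesis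
        using mult_left_mono[OF \<open>w x * \<bar>d * m x \<theta>\<^sub>0 * \<rho> + r * m x \<theta>\<bar> \<le> 2 * N\<^sup>2 * G x\<close>, of "2 * (f x)\<^sup>2"] by simp
    qed
    also have "\<dots> \<le> 2 * (2 * P\<^sup>2 + 2 * (e x)\<^sup>2) * (2 * N\<^sup>2 * G x)"
      using G_nonneg[of x] by (intro mult_right_mono mult_left_mono f_sq) auto
    also have "\<dots> = N\<^sup>2 * (8 * P\<^sup>2 * G x) + N * (N * (8 * (G x * (e x)\<^sup>2)))"
      by (simp add: algebra_simps power2_eq_square)
    \<comment> \<open>One of the two factors \<open>N\<close> is bounded by the length of the
      parameter interval, so that the error part becomes linear in \<open>N\<close> like the other
      terms.\<close>
    also have "\<dots> \<le> N\<^sup>2 * (8 * P\<^sup>2 * G x) + N * ((b - a) * (8 * (G x * (e x)\<^sup>2)))"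
      using N G_nonneg[of x] by (intro add_mono mult_left_mono mult_right_mono) auto
    finally show ?thesis by (simp only: ac_simps)
  qed
  have T2_le: "\<bar>T2\<bar> \<le> N * (G x * (4 * P * \<bar>e x\<bar> + 2 * (e x)\<^sup>2))"
  proof -
    have "(m x \<theta>\<^sub>0)\<^sup>2 \<le> (\<mu>2 x)\<^sup>2" using m_bound[OF \<theta>\<^sub>0_in, of x] by (metis abs_ge_zero power2_abs power_mono)
    then have mw: "(m x \<theta>\<^sub>0)\<^sup>2 * w x \<le> G x"
      by (intro order.trans[OF mult_right_mono[OF _ w_nonneg] G_bounds_\<mu>2(4)])
    have "(f x)\<^sup>2 - (\<pi> x)\<^sup>2 = 2 * \<pi> x * e x + (e x)\<^sup>2"
      unfolding e_def by (simp add: power2_eq_square algebra_simps)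
    then have "\<bar>(f x)\<^sup>2 - (\<pi> x)\<^sup>2\<bar> \<le> 2 * \<bar>\<pi> x\<bar> * \<bar>e x\<bar> + (e x)\<^sup>2"
      using abs_triangle_ineq[of "2 * \<pi> x * e x" "(e x)\<^sup>2"] by (simp add: abs_mult)
    also have "\<dots> \<le> 2 * P * \<bar>e x\<bar> + (e x)\<^sup>2"
      using P(2)[of x] by (intro add_mono mult_right_mono mult_left_mono) auto
    finally have *: "\<bar>(f x)\<^sup>2 - (\<pi> x)\<^sup>2\<bar> \<le> 2 * P * \<bar>e x\<bar> + (e x)\<^sup>2" .
    have "\<bar>T2\<bar> = 2 * N * ((m x \<theta>\<^sub>0)\<^sup>2 * w x) * \<bar>(f x)\<^sup>2 - (\<pi> x)\<^sup>2\<bar>"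
      unfolding T2_def using w_nonneg[of x] N by (simp add: abs_mult)
    also have "\<dots> \<le> 2 * N * G x * (2 * P * \<bar>e x\<bar> + (e x)\<^sup>2)"
      using N G_nonneg[of x] mw * by (intro mult_mono mult_left_mono) auto
    finally show ?thesis by (simp add: algebra_simps)
  qed
  have T3_le: "\<bar>T3\<bar> \<le> N * (G x * (4 * P * \<bar>e x\<bar> + 6 * (e x)\<^sup>2 + 2 * P * \<bar>e' x\<bar> + 2 * (e' x)\<^sup>2))"
  proof -
    have "\<bar>T3\<bar> = 2 * (\<bar>c\<bar> * (\<bar>\<rho>\<bar> * w x)) * \<bar>f x\<bar>"
      unfolding T3_def using w_nonneg[of x] by (simp add: abs_mult)
    also have "\<dots> \<le> 2 * (\<bar>c\<bar> * (\<mu>3 x * N * w x)) * (P + \<bar>e x\<bar>)"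
      using \<rho> f_abs w_nonneg[of x] N \<mu>3_nonneg[of x] by (intro mult_mono mult_left_mono mult_right_mono) auto
    also have "\<dots> = 2 * N * (\<bar>c\<bar> * (\<mu>3 x * w x)) * (P + \<bar>e x\<bar>)" by (simp only: ac_simps)
    also have "\<dots> \<le> 2 * N * (G x * (2 * \<bar>e x\<bar> + \<bar>e' x\<bar>)) * (P + \<bar>e x\<bar>)"
      using residual_\<mu>3_bound[OF \<theta>\<^sub>0_in] N P(1) unfolding c_def by (intro mult_right_mono mult_left_mono) auto
    also have "\<dots> = N * (G x * (4 * P * \<bar>e x\<bar> + 4 * (e x)\<^sup>2 + 2 * P * \<bar>e' x\<bar> + 2 * (\<bar>e x\<bar> * \<bar>e' x\<bar>)))"
      by (simp add: algebra_simps power2_eq_square)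
    also have "\<dots> \<le> N * (G x * (4 * P * \<bar>e x\<bar> + 4 * (e x)\<^sup>2 + 2 * P * \<bar>e' x\<bar> + (2 * (e x)\<^sup>2 + 2 * (e' x)\<^sup>2)))"
    proof (intro mult_left_mono add_left_mono)
      have "2 * (\<bar>e x\<bar> * \<bar>e' x\<bar>) \<le> (e x)\<^sup>2 + (e' x)\<^sup>2"
        using sum_squares_bound[of "\<bar>e x\<bar>" "\<bar>e' x\<bar>"] by simp
      also have "\<dots> \<le> 2 * (e x)\<^sup>2 + 2 * (e' x)\<^sup>2" by simp
      finally show "2 * (\<bar>e x\<bar> * \<bar>e' x\<bar>) \<le> 2 * (e x)\<^sup>2 + 2 * (e' x)\<^sup>2" .
    qed (use N G_nonneg in auto)
    finally show ?thesis by (simp add: algebra_simps)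
  qed
  have "\<bar>T1 + T2 + T3\<bar> \<le> \<bar>T1\<bar> + \<bar>T2\<bar> + \<bar>T3\<bar>" by linarith
  also have "\<dots> \<le> N\<^sup>2 * (8 * P\<^sup>2 * G x) + N * (8 * (b - a) * (G x * (e x)\<^sup>2))
      + N * (G x * (4 * P * \<bar>e x\<bar> + 2 * (e x)\<^sup>2))
      + N * (G x * (4 * P * \<bar>e x\<bar> + 6 * (e x)\<^sup>2 + 2 * P * \<bar>e' x\<bar> + 2 * (e' x)\<^sup>2))"
    using T1_le T2_le T3_le by linarith
  also have "\<dots> = N\<^sup>2 * (8 * P\<^sup>2 * G x) + N * (G x * ((8 * (b - a) + 8) * (e x)\<^sup>2 + 2 * (e' x)\<^sup>2 + 8 * P * \<bar>e x\<bar> + 2 * P * \<bar>e' x\<bar>))"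
    by (simp add: algebra_simps)
  \<comment> \<open>The common constant dominates the four coefficients
    \<open>8 * (b - a) + 8\<close>, \<open>2\<close>, \<open>8 * P\<close> and
    \<open>2 * P\<close>.\<close>
  also have "\<dots> \<le> N\<^sup>2 * (8 * P\<^sup>2 * G x) + N * (G x * ((8 * (b - a) + 8 * P + 8) * (e x)\<^sup>2 + (8 * (b - a) + 8 * P + 8) * (e' x)\<^sup>2
      + (8 * (b - a) + 8 * P + 8) * \<bar>e x\<bar> + (8 * (b - a) + 8 * P + 8) * \<bar>e' x\<bar>))"
    using N G_nonneg[of x] P(1) ab by (intro add_left_mono mult_left_mono add_mono mult_right_mono) auto
  finally show ?thesis unfolding split by (simp only: distrib_left mult.left_commute)
qed

lemma information_integrable: "integrable lborel (\<lambda>x. 2 * (m x \<theta>\<^sub>0)\<^sup>2 * (\<pi> x)\<^sup>2 * w x)"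
proof (rule integrable_of_G_bound[where c = "2 * P\<^sup>2"])
  show "continuous_on UNIV (\<lambda>x. 2 * (m x \<theta>\<^sub>0)\<^sup>2 * (\<pi> x)\<^sup>2 * w x)"
    by (intro continuous_intros coefficient_continuity \<theta>\<^sub>0_in)
  fix x
  have "(m x \<theta>\<^sub>0)\<^sup>2 \<le> (\<mu>2 x)\<^sup>2" using m_bound[OF \<theta>\<^sub>0_in, of x] by (metis abs_ge_zero power2_abs power_mono)
  then have mw: "(m x \<theta>\<^sub>0)\<^sup>2 * w x \<le> G x"
    by (intro order.trans[OF mult_right_mono[OF _ w_nonneg] G_bounds_\<mu>2(4)])
  have "(\<pi> x)\<^sup>2 \<le> P\<^sup>2" using P(2)[of x] by (metis abs_ge_zero power2_abs power_mono)
  then have "2 * (\<pi> x)\<^sup>2 * ((m x \<theta>\<^sub>0)\<^sup>2 * w x) \<le> 2 * P\<^sup>2 * G x"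
    using mw w_nonneg[of x] by (intro mult_mono mult_left_mono) auto
  then show "\<bar>2 * (m x \<theta>\<^sub>0)\<^sup>2 * (\<pi> x)\<^sup>2 * w x\<bar> \<le> 2 * P\<^sup>2 * G x"
    using w_nonneg[of x] by (simp add: abs_mult ac_simps)
qed

lemma score_increment:
  assumes f: "smooth_bounded f f'" and \<theta>: "\<theta> \<in> {a..b}"
  shows "\<bar>score f f' \<theta> - score f f' \<theta>\<^sub>0 - (\<theta> - \<theta>\<^sub>0) * information\<bar>
    \<le> (\<theta> - \<theta>\<^sub>0)\<^sup>2 * (8 * P\<^sup>2 * (LINT x|lborel. G x)) + \<bar>\<theta> - \<theta>\<^sub>0\<bar> * ((8 * (b - a) + 8 * P + 8) * deviation f f')"
proof -
  let ?F = "\<lambda>x. 2 * residual f f' \<theta> x * m x \<theta> * f x * w x - 2 * residual f f' \<theta>\<^sub>0 x * m x \<theta>\<^sub>0 * f x * w x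
      - (\<theta> - \<theta>\<^sub>0) * (2 * (m x \<theta>\<^sub>0)\<^sup>2 * (\<pi> x)\<^sup>2 * w x)"
  let ?G = "\<lambda>x. \<bar>\<theta> - \<theta>\<^sub>0\<bar>\<^sup>2 * (8 * P\<^sup>2 * G x) + \<bar>\<theta> - \<theta>\<^sub>0\<bar> * ((8 * (b - a) + 8 * P + 8) *
      (G x * ((f x - \<pi> x)\<^sup>2 + (f' x - \<pi>' x)\<^sup>2 + \<bar>f x - \<pi> x\<bar> + \<bar>f' x - \<pi>' x\<bar>)))"
  note ints = score_integrable[OF f \<theta>] score_integrable[OF f \<theta>\<^sub>0_in] integrable_mult_right[OF information_integrable, of "\<theta> - \<theta>\<^sub>0"]
  have F: "integrable lborel ?F"
    by (intro Bochner_Integration.integrable_diff ints)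
  have F_eq: "(LINT x|lborel. ?F x) = score f f' \<theta> - score f f' \<theta>\<^sub>0 - (\<theta> - \<theta>\<^sub>0) * information"
    unfolding score_def information_def integral_mult_right_zero[symmetric]
    by (subst Bochner_Integration.integral_diff[OF Bochner_Integration.integrable_diff[OF ints(1,2)] ints(3)],
        subst Bochner_Integration.integral_diff[OF ints(1,2)]) (rule refl)
  have G: "integrable lborel ?G"
    by (intro Bochner_Integration.integrable_add integrable_mult_right G_integrable deviation_integrable f)
  have G_eq: "(LINT x|lborel. ?G x) = \<bar>\<theta> - \<theta>\<^sub>0\<bar>\<^sup>2 * (8 * P\<^sup>2 * (LINT x|lborel. G x)) + \<bar>\<theta> - \<theta>\<^sub>0\<bar> * ((8 * (b - a) + 8 * P + 8) * deviation f f')"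
    unfolding deviation_def
    by (subst Bochner_Integration.integral_add)
      (intro integrable_mult_right G_integrable deviation_integrable f | simp only: integral_mult_right_zero)+
  have "norm (LINT x|lborel. ?F x) \<le> (LINT x|lborel. ?G x)"
    by (rule Bochner_Integration.integral_norm_bound_integral[OF F G])
      (use score_increment_integrand[OF f \<theta>] in simp)
  then show ?thesis unfolding F_eq G_eq by simp
qed

lemma score_density: "score \<pi> \<pi>' \<theta>\<^sub>0 = 0"
  unfolding score_def residual_density by simp

text \<open>For \<open>f = \<pi>\<close> the deviation is zero, and \<open>score_increment\<close>
  says that the score differs from a linear function by a quadratic error. Differentiability with
  slope \<open>information\<close> is immediate.\<close>

lemma criterion_second_derivative:
  "(param_deriv {a..b} ^^ 2) (criterion \<mu> \<sigma> w \<pi>) \<theta>\<^sub>0 = information"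
proof -
  have first: "param_deriv {a..b} (criterion \<mu> \<sigma> w \<pi>) t = score \<pi> \<pi>' t" if "t \<in> {a..b}" for t
    unfolding param_deriv_def
    by (rule vector_derivative_within_closed_interval[OF ab that])
      (use criterion_has_derivative[OF density that] in \<open>simp add: has_real_derivative_iff_has_vector_derivative\<close>)
  have dev: "deviation \<pi> \<pi>' = 0" unfolding deviation_def by simp
  define C where "C = 8 * P\<^sup>2 * (LINT x|lborel. G x)"
  have incr: "\<bar>score \<pi> \<pi>' t - (t - \<theta>\<^sub>0) * information\<bar> \<le> (t - \<theta>\<^sub>0)\<^sup>2 * C" if "t \<in> {a..b}" for t
    using score_increment[OF density that] unfolding dev score_density C_def by simp
  have "((\<lambda>t. (score \<pi> \<pi>' t - score \<pi> \<pi>' \<theta>\<^sub>0) / (t - \<theta>\<^sub>0)) \<longlongrightarrow> information) (at \<theta>\<^sub>0 within {a..b})"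
  proof (rule LIM_zero_cancel, rule Lim_null_comparison)
    show "eventually (\<lambda>t. norm ((score \<pi> \<pi>' t - score \<pi> \<pi>' \<theta>\<^sub>0) / (t - \<theta>\<^sub>0) - information) \<le> \<bar>t - \<theta>\<^sub>0\<bar> * C) (at \<theta>\<^sub>0 within {a..b})"
      unfolding eventually_at_filter
    proof (intro always_eventually allI impI)
      fix t assume t: "t \<noteq> \<theta>\<^sub>0" "t \<in> {a..b}"
      have "(score \<pi> \<pi>' t - score \<pi> \<pi>' \<theta>\<^sub>0) / (t - \<theta>\<^sub>0) - information = (score \<pi> \<pi>' t - (t - \<theta>\<^sub>0) * information) / (t - \<theta>\<^sub>0)"
        using t(1) unfolding score_density by (simp add: diff_divide_distrib)
      moreover have "\<bar>score \<pi> \<pi>' t - (t - \<theta>\<^sub>0) * information\<bar> \<le> (\<bar>t - \<theta>\<^sub>0\<bar> * C) * \<bar>t - \<theta>\<^sub>0\<bar>"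
        using incr[OF t(2)] by (simp add: power2_eq_square ac_simps flip: abs_mult)
      ultimately show "norm ((score \<pi> \<pi>' t - score \<pi> \<pi>' \<theta>\<^sub>0) / (t - \<theta>\<^sub>0) - information) \<le> \<bar>t - \<theta>\<^sub>0\<bar> * C"
        using t(1) by (simp add: abs_divide pos_divide_le_eq)
    qed
    have "((\<lambda>t. \<bar>t - \<theta>\<^sub>0\<bar> * C) \<longlongrightarrow> \<bar>\<theta>\<^sub>0 - \<theta>\<^sub>0\<bar> * C) (at \<theta>\<^sub>0 within {a..b})"
      by (intro tendsto_intros)
    then show "((\<lambda>t. \<bar>t - \<theta>\<^sub>0\<bar> * C) \<longlongrightarrow> 0) (at \<theta>\<^sub>0 within {a..b})" by simp
  qed
  then have "(score \<pi> \<pi>' has_real_derivative information) (at \<theta>\<^sub>0 within {a..b})"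
    by (simp add: has_field_derivative_iff)
  \<comment> \<open>The first parameter derivative is known to equal the score only on the interval,
    which suffices since derivatives are taken within it.\<close>
  then have "(param_deriv {a..b} (criterion \<mu> \<sigma> w \<pi>) has_real_derivative information) (at \<theta>\<^sub>0 within {a..b})"
    by (rule has_field_derivative_transform_within[OF _ zero_less_one \<theta>\<^sub>0_in]) (simp add: first)
  then show ?thesis
    unfolding numeral_2_eq_2 funpow.simps comp_def id_def
    unfolding param_deriv_def[of _ "param_deriv _ _"]
    by (intro vector_derivative_within_closed_interval[OF ab \<theta>\<^sub>0_in])
      (simp add: has_real_derivative_iff_has_vector_derivative)
qed

lemma score_at_minimizer:
  assumes f: "smooth_bounded f f'" and t: "is_arg_min (criterion \<mu> \<sigma> w f) (\<lambda>\<theta>. \<theta> \<in> {a..b}) t"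
    and interior: "t \<in> {a<..<b}"
  shows "score f f' t = 0"
proof -
  have "(criterion \<mu> \<sigma> w f has_real_derivative score f f' t) (at t within {a..b})"
    using interior by (intro criterion_has_derivative[OF f]) simp
  then have deriv: "(criterion \<mu> \<sigma> w f has_real_derivative score f f' t) (at t)"
    using interior at_within_Icc_at[of a t b] by simp
  define d where "d = min (t - a) (b - t)"
  have "0 < d" unfolding d_def using interior by simp
  moreover have "\<forall>y. \<bar>t - y\<bar> < d \<longrightarrow> criterion \<mu> \<sigma> w f t \<le> criterion \<mu> \<sigma> w f y"
    using t unfolding is_arg_min_def d_def by (auto simp: not_less abs_if split: if_splits)
  ultimately show ?thesis by (rule DERIV_local_min[OF deriv])
qed

section \<open>The influence function and the expansion of the score\<close>

lemma influence_cont: "continuous_on UNIV influence"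
  unfolding influence_def
  by (intro continuous_intros coefficient_continuity \<theta>\<^sub>0_in)

lemma influence_bound: "\<bar>influence x\<bar> \<le> 5 * P * G x"
proof -
  let ?m = "m x \<theta>\<^sub>0" and ?s = "(\<sigma> x)\<^sup>2"
  have m: "\<bar>?m\<bar> \<le> \<mu>2 x" and \<mu>: "\<bar>\<mu> x \<theta>\<^sub>0\<bar> \<le> \<mu>1 x" by (rule m_bound[OF \<theta>\<^sub>0_in] \<mu>_bound[OF \<theta>\<^sub>0_in])+
  have w: "\<bar>w x\<bar> = w x" using w_nonneg[of x] by simp
  have "\<bar>?m\<bar> * \<bar>\<mu> x \<theta>\<^sub>0\<bar> * w x \<le> \<mu>2 x * \<mu>1 x * w x"
    using m \<mu> w_nonneg \<mu>2_nonneg by (intro mult_right_mono mult_mono) auto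
  then have 1: "\<bar>?m\<bar> * \<bar>\<mu> x \<theta>\<^sub>0\<bar> * w x \<le> G x" using G_bounds_\<mu>2(1) by (rule order.trans)
  have "\<bar>?m\<bar> * ?s * w x \<le> \<mu>2 x * ?s * w x"
    using m w_nonneg by (intro mult_right_mono) auto
  then have 2: "\<bar>?m\<bar> * ?s * w x \<le> G x" using G_bounds_\<mu>2(3) by (rule order.trans)
  have "\<bar>?m\<bar> * ?s * \<bar>w' x\<bar> \<le> \<mu>2 x * ?s * \<bar>w' x\<bar>"
    using m by (intro mult_right_mono) auto
  then have 3: "\<bar>?m\<bar> * ?s * \<bar>w' x\<bar> \<le> G x" using G_bounds_m'(2) by (rule order.trans)
  have eq: "influence x = 2 * \<pi> x * (?m * \<mu> x \<theta>\<^sub>0 * w x) + \<pi> x * (m' x * ?s * w x) + \<pi>' x * (?m * ?s * w x) + \<pi> x * (?m * ?s * w' x)"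
    unfolding influence_def by (simp add: algebra_simps)
  have "\<bar>influence x\<bar> \<le> 2 * \<bar>\<pi> x\<bar> * (\<bar>?m\<bar> * \<bar>\<mu> x \<theta>\<^sub>0\<bar> * w x) + \<bar>\<pi> x\<bar> * (\<bar>m' x\<bar> * ?s * w x) +
      \<bar>\<pi>' x\<bar> * (\<bar>?m\<bar> * ?s * w x) + \<bar>\<pi> x\<bar> * (\<bar>?m\<bar> * ?s * \<bar>w' x\<bar>)"
  proof -
    have tri: "\<bar>p + q + r + s\<bar> \<le> \<bar>p\<bar> + \<bar>q\<bar> + \<bar>r\<bar> + \<bar>s\<bar>" for p q r s :: real by linarith
    show ?thesis unfolding eq by (rule order.trans[OF tri]) (simp add: abs_mult w)
  qed
  also have "\<dots> \<le> 2 * P * G x + P * G x + P * G x + P * G x"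
    using P 1 2 3 G_bounds_m'(1)[of x] w_nonneg[of x] by (intro add_mono mult_mono mult_left_mono) auto
  finally show ?thesis by (simp add: algebra_simps)
qed

lemma decay_bounded:
  assumes B: "\<And>x. \<bar>g x\<bar> \<le> B"
  shows "((\<lambda>x. m x \<theta>\<^sub>0 * w x * (\<sigma> x)\<^sup>2 * g x) \<longlongrightarrow> 0) at_infinity"
proof (rule Lim_null_comparison)
  have B0: "0 \<le> B" using B[of 0] by linarith
  show "eventually (\<lambda>x. norm (m x \<theta>\<^sub>0 * w x * (\<sigma> x)\<^sup>2 * g x) \<le> \<mu>2 x * w x * (\<sigma> x)\<^sup>2 * B) at_infinity"
  proof (intro always_eventually allI)
    fix x
    have "norm (m x \<theta>\<^sub>0 * w x * (\<sigma> x)\<^sup>2 * g x) = \<bar>m x \<theta>\<^sub>0\<bar> * w x * (\<sigma> x)\<^sup>2 * \<bar>g x\<bar>"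
      using w_nonneg[of x] by (simp add: abs_mult)
    also have "\<dots> \<le> \<mu>2 x * w x * (\<sigma> x)\<^sup>2 * B"
      using m_bound[OF \<theta>\<^sub>0_in, of x] B[of x] w_nonneg[of x] \<mu>2_nonneg[of x] by (intro mult_mono mult_right_mono) auto
    finally show "norm (m x \<theta>\<^sub>0 * w x * (\<sigma> x)\<^sup>2 * g x) \<le> \<mu>2 x * w x * (\<sigma> x)\<^sup>2 * B" .
  qed
  show "((\<lambda>x. \<mu>2 x * w x * (\<sigma> x)\<^sup>2 * B) \<longlongrightarrow> 0) at_infinity"
    using tendsto_mult_right[OF decay, of B] by simp
qed

lemma mws_deriv:
  "((\<lambda>x. m x \<theta>\<^sub>0 * w x * (\<sigma> x)\<^sup>2) has_real_derivative
      m' x * w x * (\<sigma> x)\<^sup>2 + m x \<theta>\<^sub>0 * w' x * (\<sigma> x)\<^sup>2 + 2 * m x \<theta>\<^sub>0 * w x * \<sigma> x * \<sigma>' x) (at x)"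
  by (rule derivative_eq_intros m_deriv(1) w_deriv(1) \<sigma>_deriv(1) refl | simp add: algebra_simps)+

lemma mws_deriv_bound:
  "\<bar>m' x * w x * (\<sigma> x)\<^sup>2 + m x \<theta>\<^sub>0 * w' x * (\<sigma> x)\<^sup>2 + 2 * m x \<theta>\<^sub>0 * w x * \<sigma> x * \<sigma>' x\<bar> \<le> 4 * G x"
  "\<bar>m x \<theta>\<^sub>0 * w x * (\<sigma> x)\<^sup>2\<bar> \<le> G x" "\<bar>m x \<theta>\<^sub>0 * w x * \<sigma> x * \<sigma>' x\<bar> \<le> G x" "\<bar>m x \<theta>\<^sub>0 * \<mu> x \<theta>\<^sub>0 * w x\<bar> \<le> G x"
proof -
  have m: "\<bar>m x \<theta>\<^sub>0\<bar> \<le> \<mu>2 x" and \<mu>: "\<bar>\<mu> x \<theta>\<^sub>0\<bar> \<le> \<mu>1 x" by (rule m_bound[OF \<theta>\<^sub>0_in] \<mu>_bound[OF \<theta>\<^sub>0_in])+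
  have "\<bar>m x \<theta>\<^sub>0 * w x * \<sigma> x * \<sigma>' x\<bar> = \<bar>m x \<theta>\<^sub>0\<bar> * \<bar>\<sigma> x * \<sigma>' x\<bar> * w x"
    using w_nonneg[of x] by (simp add: abs_mult)
  also have "\<dots> \<le> \<mu>2 x * \<bar>\<sigma> x * \<sigma>' x\<bar> * w x"
    using m w_nonneg by (intro mult_right_mono) auto
  finally show 1: "\<bar>m x \<theta>\<^sub>0 * w x * \<sigma> x * \<sigma>' x\<bar> \<le> G x" using G_bounds_\<mu>2(2) by (rule order.trans)
  have "\<bar>m x \<theta>\<^sub>0 * w' x * (\<sigma> x)\<^sup>2\<bar> = \<bar>m x \<theta>\<^sub>0\<bar> * (\<sigma> x)\<^sup>2 * \<bar>w' x\<bar>" by (simp add: abs_mult)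
  also have "\<dots> \<le> \<mu>2 x * (\<sigma> x)\<^sup>2 * \<bar>w' x\<bar>"
    using m by (intro mult_right_mono) auto
  finally have 2: "\<bar>m x \<theta>\<^sub>0 * w' x * (\<sigma> x)\<^sup>2\<bar> \<le> G x" using G_bounds_m'(2) by (rule order.trans)
  have 3: "\<bar>m' x * w x * (\<sigma> x)\<^sup>2\<bar> \<le> G x"
    using G_bounds_m'(1)[of x] w_nonneg[of x] by (simp add: abs_mult ac_simps)
  show "\<bar>m' x * w x * (\<sigma> x)\<^sup>2 + m x \<theta>\<^sub>0 * w' x * (\<sigma> x)\<^sup>2 + 2 * m x \<theta>\<^sub>0 * w x * \<sigma> x * \<sigma>' x\<bar> \<le> 4 * G x"
  proof -
    have tri: "\<bar>p + q + 2 * r\<bar> \<le> 4 * g" if "\<bar>p\<bar> \<le> g" "\<bar>q\<bar> \<le> g" "\<bar>r\<bar> \<le> g" for p q r g :: real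
      using that by linarith
    show ?thesis using tri[OF 3 2 1] by (simp only: mult.assoc)
  qed
  have "\<bar>m x \<theta>\<^sub>0 * w x * (\<sigma> x)\<^sup>2\<bar> = \<bar>m x \<theta>\<^sub>0\<bar> * (\<sigma> x)\<^sup>2 * w x"
    using w_nonneg[of x] by (simp add: abs_mult)
  also have "\<dots> \<le> \<mu>2 x * (\<sigma> x)\<^sup>2 * w x"
    using m w_nonneg by (intro mult_right_mono) auto
  finally show "\<bar>m x \<theta>\<^sub>0 * w x * (\<sigma> x)\<^sup>2\<bar> \<le> G x" using G_bounds_\<mu>2(3) by (rule order.trans)
  have "\<bar>m x \<theta>\<^sub>0 * \<mu> x \<theta>\<^sub>0 * w x\<bar> = \<bar>m x \<theta>\<^sub>0\<bar> * \<bar>\<mu> x \<theta>\<^sub>0\<bar> * w x"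
    using w_nonneg[of x] by (simp add: abs_mult)
  also have "\<dots> \<le> \<mu>2 x * \<mu>1 x * w x"
    using m \<mu> w_nonneg \<mu>2_nonneg by (intro mult_right_mono mult_mono) auto
  finally show "\<bar>m x \<theta>\<^sub>0 * \<mu> x \<theta>\<^sub>0 * w x\<bar> \<le> G x" using G_bounds_\<mu>2(1) by (rule order.trans)
qed

text \<open>Integration by parts: every \<open>smooth_bounded\<close> factor \<open>g\<close> leaves no boundary term against
  \<open>m w \<sigma>\<^sup>2\<close>, by the decay assumption.\<close>

lemma integral_mws_deriv:
  assumes g: "smooth_bounded g g'"
  defines "D \<equiv> \<lambda>x. (m' x * w x * (\<sigma> x)\<^sup>2 + m x \<theta>\<^sub>0 * w' x * (\<sigma> x)\<^sup>2 + 2 * m x \<theta>\<^sub>0 * w x * \<sigma> x * \<sigma>' x) * g x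
      + m x \<theta>\<^sub>0 * w x * (\<sigma> x)\<^sup>2 * g' x"
  shows "integrable lborel D" "(LINT x|lborel. D x) = 0"
proof -
  obtain B where B: "B > 0" "\<And>x. \<bar>g x\<bar> \<le> B" "\<And>x. \<bar>g' x\<bar> \<le> B" by (rule smooth_bounded_bound[OF g]) blast
  have cont: "continuous_on UNIV D"
    unfolding D_def by (intro continuous_intros coefficient_continuity \<theta>\<^sub>0_in smooth_boundedD(2,3)[OF g])
  show int: "integrable lborel D"
  proof (rule integrable_of_G_bound[OF cont])
    fix x
    have "\<bar>D x\<bar> \<le> \<bar>m' x * w x * (\<sigma> x)\<^sup>2 + m x \<theta>\<^sub>0 * w' x * (\<sigma> x)\<^sup>2 + 2 * m x \<theta>\<^sub>0 * w x * \<sigma> x * \<sigma>' x\<bar> * \<bar>g x\<bar>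
        + \<bar>m x \<theta>\<^sub>0 * w x * (\<sigma> x)\<^sup>2\<bar> * \<bar>g' x\<bar>"
      unfolding D_def abs_mult[symmetric] by (rule abs_triangle_ineq)
    also have "\<dots> \<le> (4 * G x) * B + G x * B"
      using B G_nonneg[of x] by (intro add_mono mult_mono mws_deriv_bound) auto
    finally show "\<bar>D x\<bar> \<le> (5 * B) * G x" by (simp add: algebra_simps)
  qed
  show "(LINT x|lborel. D x) = 0"
  proof (rule integral_derivative_vanishing_at_infinity[OF _ cont int decay_bounded[OF B(2)]])
    show "((\<lambda>x. m x \<theta>\<^sub>0 * w x * (\<sigma> x)\<^sup>2 * g x) has_real_derivative D x) (at x)" for x
      unfolding D_def using DERIV_mult[OF mws_deriv smooth_boundedD(1)[OF g], of x] by (simp only: mult.commute add.commute)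
  qed
qed

text \<open>The two integrands differ exactly by the derivative of
  \<open>m * w * \<sigma>\<^sup>2 * \<pi> * f\<close>: this explains the shape of
  \<open>influence\<close>, in which no derivative of \<open>f\<close> or of \<open>\<sigma>\<close>
  is left.\<close>

lemma influence_integral:
  assumes f: "smooth_bounded f f'"
  shows "integrable lborel (\<lambda>x. influence x * f x)"
    "(LINT x|lborel. influence x * f x) = (LINT x|lborel. 2 * residual f f' \<theta>\<^sub>0 x * m x \<theta>\<^sub>0 * \<pi> x * w x)"
    "integrable lborel (\<lambda>x. 2 * residual f f' \<theta>\<^sub>0 x * m x \<theta>\<^sub>0 * \<pi> x * w x)"
proof -
  obtain B where B: "B > 0" "\<And>x. \<bar>f x\<bar> \<le> B" "\<And>x. \<bar>f' x\<bar> \<le> B" by (rule smooth_bounded_bound[OF f]) blast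
  show int: "integrable lborel (\<lambda>x. influence x * f x)"
  proof (rule integrable_of_G_bound)
    show "continuous_on UNIV (\<lambda>x. influence x * f x)"
      by (intro continuous_intros influence_cont smooth_boundedD(3)[OF f])
    show "\<bar>influence x * f x\<bar> \<le> (5 * P * B) * G x" for x
    proof -
      have "\<bar>influence x * f x\<bar> \<le> (5 * P * G x) * B"
        unfolding abs_mult using influence_bound[of x] B(2)[of x] G_nonneg[of x] P(1) by (intro mult_mono) auto
      then show ?thesis by (simp only: ac_simps)
    qed
  qed
  note parts = integral_mws_deriv[OF smooth_bounded_mult[OF density f]]
  have eq: "2 * residual f f' \<theta>\<^sub>0 x * m x \<theta>\<^sub>0 * \<pi> x * w x = influence x * f x -
     ((m' x * w x * (\<sigma> x)\<^sup>2 + m x \<theta>\<^sub>0 * w' x * (\<sigma> x)\<^sup>2 + 2 * m x \<theta>\<^sub>0 * w x * \<sigma> x * \<sigma>' x) * (\<pi> x * f x)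
      + m x \<theta>\<^sub>0 * w x * (\<sigma> x)\<^sup>2 * (\<pi>' x * f x + \<pi> x * f' x))" for x
    unfolding influence_def residual_def by (simp add: field_simps)
  show "integrable lborel (\<lambda>x. 2 * residual f f' \<theta>\<^sub>0 x * m x \<theta>\<^sub>0 * \<pi> x * w x)"
    unfolding eq by (rule Bochner_Integration.integrable_diff[OF int parts(1)])
  show "(LINT x|lborel. influence x * f x) = (LINT x|lborel. 2 * residual f f' \<theta>\<^sub>0 x * m x \<theta>\<^sub>0 * \<pi> x * w x)"
    unfolding eq Bochner_Integration.integral_diff[OF int parts(1)] parts(2) by simp
qed

text \<open>The centring required by the central limit theorem; it is the stationary equation after
  integration by parts.\<close>

lemma influence_mean: "(LINT x|lborel. influence x * \<pi> x) = 0"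
  unfolding influence_integral(2)[OF density] residual_density by simp

lemma score_expansion:
  assumes f: "smooth_bounded f f'"
  shows "\<bar>score f f' \<theta>\<^sub>0 - (LINT x|lborel. influence x * f x)\<bar> \<le> 6 * (LINT x|lborel. G x * (f x - \<pi> x)\<^sup>2)"
proof -
  define e e' where "e = (\<lambda>x. f x - \<pi> x)" and "e' = (\<lambda>x. f' x - \<pi>' x)"
  have e: "smooth_bounded e e'" unfolding e_def e'_def by (rule smooth_bounded_diff[OF f density])
  define Dm where "Dm = (\<lambda>x. m' x * w x * (\<sigma> x)\<^sup>2 + m x \<theta>\<^sub>0 * w' x * (\<sigma> x)\<^sup>2 + 2 * m x \<theta>\<^sub>0 * w x * \<sigma> x * \<sigma>' x)"
  \<comment> \<open>The product \<open>e * e'\<close> is half the derivative of the square of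
    \<open>e\<close>; moving that derivative to the coefficient yields \<open>Dm x / 2\<close>. The
    constant 6 below is 2 + 2 + 4 / 2.\<close>
  define Q where "Q = (\<lambda>x. (2 * (m x \<theta>\<^sub>0 * \<mu> x \<theta>\<^sub>0 * w x) - 2 * (m x \<theta>\<^sub>0 * w x * \<sigma> x * \<sigma>' x) + Dm x / 2) * (e x)\<^sup>2)"
  have parts: "integrable lborel (\<lambda>x. Dm x * (e x * e x) + m x \<theta>\<^sub>0 * w x * (\<sigma> x)\<^sup>2 * (e' x * e x + e x * e' x))"
    "(LINT x|lborel. Dm x * (e x * e x) + m x \<theta>\<^sub>0 * w x * (\<sigma> x)\<^sup>2 * (e' x * e x + e x * e' x)) = 0"
    unfolding Dm_def by (rule integral_mws_deriv[OF smooth_bounded_mult[OF e e]])+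
  have res: "residual f f' \<theta>\<^sub>0 x = residual e e' \<theta>\<^sub>0 x" for x
    unfolding e_def e'_def residual_diff residual_density by simp
  have f_e: "f x = \<pi> x + e x" for x unfolding e_def by simp
  have split: "2 * residual f f' \<theta>\<^sub>0 x * m x \<theta>\<^sub>0 * f x * w x = 2 * residual f f' \<theta>\<^sub>0 x * m x \<theta>\<^sub>0 * \<pi> x * w x
      + (Q x - (Dm x * (e x * e x) + m x \<theta>\<^sub>0 * w x * (\<sigma> x)\<^sup>2 * (e' x * e x + e x * e' x)) / 2)" for x
    unfolding res Q_def unfolding f_e residual_def by (simp add: power2_eq_square field_simps)
  have Q_bound: "\<bar>Q x\<bar> \<le> 6 * (G x * (f x - \<pi> x)\<^sup>2)" for x
  proof -
    have "\<bar>2 * (m x \<theta>\<^sub>0 * \<mu> x \<theta>\<^sub>0 * w x) - 2 * (m x \<theta>\<^sub>0 * w x * \<sigma> x * \<sigma>' x) + Dm x / 2\<bar> \<le> 6 * G x"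
    proof -
      have tri: "\<bar>2 * p - 2 * q + r / 2\<bar> \<le> 6 * g" if "\<bar>p\<bar> \<le> g" "\<bar>q\<bar> \<le> g" "\<bar>r\<bar> \<le> 4 * g" for p q r g :: real
        using that by linarith
      show ?thesis unfolding Dm_def by (intro tri mws_deriv_bound)
    qed
    from mult_right_mono[OF this zero_le_power2[of "e x"]] show ?thesis
      unfolding Q_def e_def by (simp add: abs_mult mult.assoc)
  qed
  have sq: "integrable lborel (\<lambda>x. 6 * (G x * (f x - \<pi> x)\<^sup>2))"
    by (intro integrable_mult_right squared_deviation_integrable[OF f])
  have Q_int: "integrable lborel Q"
  proof (rule Bochner_Integration.integrable_bound[OF sq])
    have "continuous_on UNIV Q"
      unfolding Q_def Dm_def by (intro continuous_intros coefficient_continuity \<theta>\<^sub>0_in smooth_boundedD(3)[OF e]) auto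
    then show "Q \<in> borel_measurable lborel" by (simp add: borel_measurable_continuous_onI)
    show "AE x in lborel. norm (Q x) \<le> norm (6 * (G x * (f x - \<pi> x)\<^sup>2))"
      using order.trans[OF Q_bound abs_ge_self] by simp
  qed
  have rest_int: "integrable lborel (\<lambda>x. (Dm x * (e x * e x) + m x \<theta>\<^sub>0 * w x * (\<sigma> x)\<^sup>2 * (e' x * e x + e x * e' x)) / 2)"
    using parts(1) by (rule integrable_divide)
  have "score f f' \<theta>\<^sub>0 = (LINT x|lborel. influence x * f x) + (LINT x|lborel. Q x)"
    unfolding score_def split influence_integral(2)[OF f]
    using parts(2) influence_integral(3)[OF f] Q_int rest_int by simp
  moreover have "norm (LINT x|lborel. Q x) \<le> (LINT x|lborel. 6 * (G x * (f x - \<pi> x)\<^sup>2))"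
    by (rule Bochner_Integration.integral_norm_bound_integral[OF Q_int sq]) (use Q_bound in simp)
  ultimately show ?thesis by simp
qed

end

section \<open>Mean square error of the kernel estimator\<close>

lemma (in prob_space) expectation_abs_le_sqrt:
  fixes Y :: "'a \<Rightarrow> real"
  assumes [measurable]: "Y \<in> borel_measurable M" and B: "\<And>\<omega>. \<omega> \<in> space M \<Longrightarrow> \<bar>Y \<omega>\<bar> \<le> B"
    and le: "expectation (\<lambda>\<omega>. (Y \<omega>)\<^sup>2) \<le> s"
  shows "expectation (\<lambda>\<omega>. \<bar>Y \<omega>\<bar>) \<le> sqrt s"
proof (rule real_le_rsqrt)
  have 1: "integrable M (\<lambda>\<omega>. \<bar>Y \<omega>\<bar>)"
    by (rule integrable_const_bound[of _ B]) (use B in auto)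
  have 2: "integrable M (\<lambda>\<omega>. \<bar>Y \<omega>\<bar>\<^sup>2)"
    unfolding power2_abs by (rule integrable_square_of_bounded[OF assms(1) B])
  have "0 \<le> variance (\<lambda>\<omega>. \<bar>Y \<omega>\<bar>)" by (rule variance_positive)
  then show "(expectation (\<lambda>\<omega>. \<bar>Y \<omega>\<bar>))\<^sup>2 \<le> s"
    using variance_eq[OF 1 2] le by simp
qed

text \<open>By Fubini a bound in mean at each fixed \<open>x\<close> is enough. The deterministic
  bound \<open>c\<close> secures integrability only and does not enter the conclusion, so it may
  blow up with the bandwidth.\<close>

lemma (in prob_space) expectation_weighted_integral:
  fixes Y :: "'a \<Rightarrow> real \<Rightarrow> real" and G :: "real \<Rightarrow> real"
  assumes Y: "case_prod Y \<in> borel_measurable (M \<Otimes>\<^sub>M lborel)"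
    and G: "integrable lborel G" "\<And>x. 0 \<le> G x"
    and bounds: "\<And>\<omega> x. \<omega> \<in> space M \<Longrightarrow> 0 \<le> Y \<omega> x \<and> Y \<omega> x \<le> c"
    and s: "\<And>x. expectation (\<lambda>\<omega>. Y \<omega> x) \<le> s"
  shows "integrable M (\<lambda>\<omega>. LINT x|lborel. G x * Y \<omega> x)"
    "expectation (\<lambda>\<omega>. LINT x|lborel. G x * Y \<omega> x) \<le> s * (LINT x|lborel. G x)"
proof -
  interpret pair_sigma_finite M lborel ..
  have [measurable]: "G \<in> borel_measurable lborel" using G by auto
  note Y[measurable]
  have G_pair: "integrable (M \<Otimes>\<^sub>M lborel) (\<lambda>z. G (snd z))"
  proof (rule Fubini_integrable)
    show "(\<lambda>z. G (snd z)) \<in> borel_measurable (M \<Otimes>\<^sub>M lborel)" by measurable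
  qed (use G in auto)
  have int: "integrable (M \<Otimes>\<^sub>M lborel) (\<lambda>(\<omega>, x). G x * Y \<omega> x)"
  proof (rule Bochner_Integration.integrable_bound[OF integrable_mult_right[OF G_pair, of c]])
    show "AE z in M \<Otimes>\<^sub>M lborel. norm (case z of (\<omega>, x) \<Rightarrow> G x * Y \<omega> x) \<le> norm (c * G (snd z))"
    proof (rule AE_I2)
      fix z :: "'a \<times> real" assume z: "z \<in> space (M \<Otimes>\<^sub>M lborel)"
      obtain \<omega> x where zx: "z = (\<omega>, x)" by (cases z)
      then have b: "0 \<le> Y \<omega> x" "Y \<omega> x \<le> c" using z bounds[of \<omega> x] by (auto simp: space_pair_measure)
      have "\<bar>G x * Y \<omega> x\<bar> = Y \<omega> x * G x" using b(1) G(2)[of x] by (simp add: abs_mult)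
      also have "\<dots> \<le> c * G x" using b(2) G(2)[of x] by (rule mult_right_mono)
      finally show "norm (case z of (\<omega>, x) \<Rightarrow> G x * Y \<omega> x) \<le> norm (c * G (snd z))" unfolding zx by simp
    qed
  qed (use Y in \<open>simp add: case_prod_beta'\<close>)
  show "integrable M (\<lambda>\<omega>. LINT x|lborel. G x * Y \<omega> x)"
    using integrable_fst'[OF int] by simp
  have "expectation (\<lambda>\<omega>. LINT x|lborel. G x * Y \<omega> x) = (LINT x|lborel. expectation (\<lambda>\<omega>. G x * Y \<omega> x))"
    by (rule Fubini_integral[OF int, symmetric])
  also have "\<dots> = (LINT x|lborel. G x * expectation (\<lambda>\<omega>. Y \<omega> x))" by simp
  also have "\<dots> \<le> (LINT x|lborel. s * G x)"
  proof (rule integral_mono)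
    show "integrable lborel (\<lambda>x. G x * expectation (\<lambda>\<omega>. Y \<omega> x))"
      using integrable_snd[OF int] by simp
    show "G x * expectation (\<lambda>\<omega>. Y \<omega> x) \<le> s * G x" for x
      using mult_left_mono[OF s G(2)] by (simp add: mult.commute)
  qed (use G in auto)
  finally show "expectation (\<lambda>\<omega>. LINT x|lborel. G x * Y \<omega> x) \<le> s * (LINT x|lborel. G x)" by simp
qed

context stationary_mixing
begin

text \<open>Splitting into variance and squared bias for an arbitrary target \<open>c\<close>;
  centring doubles the supremum bound, hence \<open>2 * B\<close>.\<close>

lemma mean_square_error_bound:
  fixes g :: "real \<Rightarrow> real"
  assumes g[measurable]: "g \<in> borel_measurable borel" and B: "\<And>x. \<bar>g x\<bar> \<le> B" "B > 0" and N: "N > 0"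
  shows "expectation (\<lambda>\<omega>. ((\<Sum>j<N. g (Z j \<omega>)) / real N - c)\<^sup>2)
    \<le> mixing_const * (2 * B)\<^sup>2 / real N + (expectation (\<lambda>\<omega>. g (Z 0 \<omega>)) - c)\<^sup>2"
proof -
  define \<nu> where "\<nu> = expectation (\<lambda>\<omega>. g (Z 0 \<omega>))"
  define S where "S = (\<lambda>\<omega>. \<Sum>j<N. g (Z j \<omega>) - \<nu>)"
  have gi: "integrable M (\<lambda>\<omega>. g (Z j \<omega>))" for j
    by (rule integrable_const_bound[of _ B]) (use B in auto)
  have "\<bar>\<nu>\<bar> \<le> expectation (\<lambda>\<omega>. \<bar>g (Z 0 \<omega>)\<bar>)" unfolding \<nu>_def by (rule integral_abs_bound)
  also have "\<dots> \<le> expectation (\<lambda>\<omega>. B)" using gi B by (intro integral_mono) auto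
  finally have \<nu>: "\<bar>\<nu>\<bar> \<le> B" by (simp add: prob_space)
  have centred: "\<bar>g x - \<nu>\<bar> \<le> 2 * B" for x using B(1)[of x] \<nu> by linarith
  have mean0: "expectation (\<lambda>\<omega>. g (Z 0 \<omega>) - \<nu>) = 0"
    unfolding \<nu>_def using gi by (simp add: prob_space)
  have S_int: "integrable M S" unfolding S_def using gi by simp
  have S_mean: "expectation S = 0"
  proof -
    have "expectation (\<lambda>\<omega>. g (Z j \<omega>)) = \<nu>" for j unfolding \<nu>_def by (rule stationary_mean[OF g])
    then show ?thesis unfolding S_def using gi by (simp add: prob_space)
  qed
  have S_meas: "S \<in> borel_measurable M" using S_int by simp
  have S_bound: "\<bar>S \<omega>\<bar> \<le> real N * (2 * B)" for \<omega>
    unfolding S_def using sum_norm_bound[of "{..<N}" "\<lambda>j. g (Z j \<omega>) - \<nu>" "2 * B"] centred by simp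
  have S2_int: "integrable M (\<lambda>\<omega>. (S \<omega>)\<^sup>2)"
    by (rule integrable_square_of_bounded[OF S_meas S_bound])
  have S2: "expectation (\<lambda>\<omega>. (S \<omega>)\<^sup>2) \<le> mixing_const * (2 * B)\<^sup>2 * real N"
    using second_moment_sum_bound[of "\<lambda>x. g x - \<nu>" "2 * B" "{..<N}"] centred mean0 B unfolding S_def by simp
  have eq: "(\<Sum>j<N. g (Z j \<omega>)) / real N - c = S \<omega> / real N + (\<nu> - c)" for \<omega>
    unfolding S_def using N by (simp add: sum_subtractf field_simps)
  have "expectation (\<lambda>\<omega>. (S \<omega> / real N + (\<nu> - c))\<^sup>2) =
      expectation (\<lambda>\<omega>. (S \<omega>)\<^sup>2 / (real N)\<^sup>2 + 2 * (\<nu> - c) / real N * S \<omega> + (\<nu> - c)\<^sup>2)"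
    by (rule arg_cong[where f = expectation]) (simp add: fun_eq_iff power2_sum power_divide)
  also have "\<dots> = expectation (\<lambda>\<omega>. (S \<omega>)\<^sup>2) / (real N)\<^sup>2 + (\<nu> - c)\<^sup>2"
    using S_int S2_int S_mean by (simp add: prob_space)
  also have "\<dots> \<le> mixing_const * (2 * B)\<^sup>2 * real N / (real N)\<^sup>2 + (\<nu> - c)\<^sup>2"
    using S2 by (intro add_right_mono divide_right_mono) auto
  also have "\<dots> = mixing_const * (2 * B)\<^sup>2 / real N + (\<nu> - c)\<^sup>2"
    using N by (simp add: power2_eq_square)
  finally show ?thesis unfolding eq \<nu>_def .
qed

end

locale kernel_density_estimation = stationary_mixing M Z + smoothing_kernel \<alpha> K
  for M :: "'a measure" and Z and \<alpha> and K +
  fixes f f' :: "real \<Rightarrow> real" and D :: real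
  assumes law: "distributed M lborel (Z 0) (\<lambda>x. ennreal (f x))" and f_nonneg: "\<And>x. 0 \<le> f x"
    and f_smooth: "smooth_bounded f f'"
    and D_nonneg: "0 \<le> D"
    and f_bias: "\<And>x h. 0 \<le> h \<Longrightarrow> h \<le> 1 / 2 \<Longrightarrow> \<bar>(LINT u|lborel. K u * f (x - h * u)) - f x\<bar> \<le> D * h ^ (\<alpha> - 1)"
    and f'_bias: "\<And>x h. 0 \<le> h \<Longrightarrow> h \<le> 1 / 2 \<Longrightarrow> \<bar>(LINT u|lborel. K u * f' (x - h * u)) - f' x\<bar> \<le> D * h ^ (\<alpha> - 2)"
begin

text \<open>\<open>N\<close> counts observations: the kernel estimator with index \<open>n\<close>
  is the case \<open>N = Suc n\<close>.\<close>

definition estimate :: "real \<Rightarrow> nat \<Rightarrow> 'a \<Rightarrow> real \<Rightarrow> real" where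
  "estimate h N \<omega> x = (\<Sum>j<N. K ((x - Z j \<omega>) / h) / h) / real N"

definition estimate_deriv :: "real \<Rightarrow> nat \<Rightarrow> 'a \<Rightarrow> real \<Rightarrow> real" where
  "estimate_deriv h N \<omega> x = (\<Sum>j<N. deriv K ((x - Z j \<omega>) / h) / h\<^sup>2) / real N"

definition kernel_bound :: real where
  "kernel_bound = (SOME B. B > 0 \<and> (\<forall>u. \<bar>K u\<bar> \<le> B) \<and> (\<forall>u. \<bar>deriv K u\<bar> \<le> B))"

lemma kernel_bound: "kernel_bound > 0" "\<bar>K u\<bar> \<le> kernel_bound" "\<bar>deriv K u\<bar> \<le> kernel_bound"
proof -
  obtain B where B: "\<And>u. \<bar>K u\<bar> \<le> B" "B > 0" by (rule bounded_compact_support[OF K_cont K_zero]) auto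
  obtain C where C: "\<And>u. \<bar>deriv K u\<bar> \<le> C" "C > 0" by (rule bounded_compact_support[OF K'_cont K'_zero]) auto
  have "max B C > 0 \<and> (\<forall>u. \<bar>K u\<bar> \<le> max B C) \<and> (\<forall>u. \<bar>deriv K u\<bar> \<le> max B C)"
    using B C by (auto intro: max.coboundedI1 max.coboundedI2)
  then have "kernel_bound > 0 \<and> (\<forall>u. \<bar>K u\<bar> \<le> kernel_bound) \<and> (\<forall>u. \<bar>deriv K u\<bar> \<le> kernel_bound)"
    unfolding kernel_bound_def by (rule someI)
  then show "kernel_bound > 0" "\<bar>K u\<bar> \<le> kernel_bound" "\<bar>deriv K u\<bar> \<le> kernel_bound" by auto
qed

lemma expectation_density:
  assumes "g \<in> borel_measurable borel"
  shows "expectation (\<lambda>\<omega>. g (Z 0 \<omega>)) = (LINT z|lborel. g z * f z)"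
  using distributed_integral[OF law, of g] assms f_nonneg by (simp add: mult.commute)

text \<open>Using the supremum bound of order 1 / h gives a variance of order 1 / (N h^2) rather
  than the familiar 1 / (N h). Even multiplied by sqrt N this vanishes once N h^4 grows.\<close>

lemma estimate_mean_square_error:
  assumes h: "0 < h" "h \<le> 1 / 2" and N: "N > 0"
  shows "expectation (\<lambda>\<omega>. (estimate h N \<omega> x - f x)\<^sup>2)
    \<le> mixing_const * (2 * (kernel_bound / h))\<^sup>2 / real N + (D * h ^ (\<alpha> - 1))\<^sup>2"
proof -
  let ?g = "\<lambda>z. K ((x - z) / h) / h"
  have g: "?g \<in> borel_measurable borel" by measurable
  have "\<bar>?g z\<bar> \<le> kernel_bound / h" for z
    using h kernel_bound(2) by (simp add: abs_divide divide_right_mono)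
  from mean_square_error_bound[OF g this _ N, of "f x"]
  have "expectation (\<lambda>\<omega>. (estimate h N \<omega> x - f x)\<^sup>2)
      \<le> mixing_const * (2 * (kernel_bound / h))\<^sup>2 / real N + (expectation (\<lambda>\<omega>. ?g (Z 0 \<omega>)) - f x)\<^sup>2"
    unfolding estimate_def using h kernel_bound(1) by simp
  moreover have "(expectation (\<lambda>\<omega>. ?g (Z 0 \<omega>)) - f x)\<^sup>2 \<le> (D * h ^ (\<alpha> - 1))\<^sup>2"
    unfolding expectation_density[OF g] integral_kernel_affine[OF h(1)]
    by (rule power2_le_iff_abs_le[THEN iffD2]) (use f_bias[of h x] h D_nonneg in auto)
  ultimately show ?thesis by linarith
qed

text \<open>The variance is now of order 1 / (N h^4), which merely has to vanish: no error of the
  derivative is ever multiplied by sqrt N.\<close>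

lemma estimate_deriv_mean_square_error:
  assumes h: "0 < h" "h \<le> 1 / 2" and N: "N > 0"
  shows "expectation (\<lambda>\<omega>. (estimate_deriv h N \<omega> x - f' x)\<^sup>2)
    \<le> mixing_const * (2 * (kernel_bound / h\<^sup>2))\<^sup>2 / real N + (D * h ^ (\<alpha> - 2))\<^sup>2"
proof -
  let ?g = "\<lambda>z. deriv K ((x - z) / h) / h\<^sup>2"
  have g: "?g \<in> borel_measurable borel" by measurable
  have "\<bar>?g z\<bar> \<le> kernel_bound / h\<^sup>2" for z
    using h kernel_bound(3) by (simp add: abs_divide divide_right_mono)
  from mean_square_error_bound[OF g this _ N, of "f' x"]
  have "expectation (\<lambda>\<omega>. (estimate_deriv h N \<omega> x - f' x)\<^sup>2)
      \<le> mixing_const * (2 * (kernel_bound / h\<^sup>2))\<^sup>2 / real N + (expectation (\<lambda>\<omega>. ?g (Z 0 \<omega>)) - f' x)\<^sup>2"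
    unfolding estimate_deriv_def using h kernel_bound(1) by simp
  moreover have "(expectation (\<lambda>\<omega>. ?g (Z 0 \<omega>)) - f' x)\<^sup>2 \<le> (D * h ^ (\<alpha> - 2))\<^sup>2"
    unfolding expectation_density[OF g] integral_kernel_deriv_affine[OF h(1) smooth_boundedD(1,2)[OF f_smooth]]
    by (rule power2_le_iff_abs_le[THEN iffD2]) (use f'_bias[of h x] h D_nonneg in auto)
  ultimately show ?thesis by linarith
qed

lemma estimate_bounds:
  assumes h: "0 < h" and N: "N > 0"
  shows "\<bar>estimate h N \<omega> x\<bar> \<le> kernel_bound / h" "\<bar>estimate_deriv h N \<omega> x\<bar> \<le> kernel_bound / h\<^sup>2"
proof -
  have avg: "\<bar>(\<Sum>j<N. g j) / real N\<bar> \<le> B" if "\<And>j. \<bar>g j\<bar> \<le> B" for g :: "nat \<Rightarrow> real" and B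
    using sum_norm_bound[of "{..<N}" g B] that N by (simp add: abs_divide divide_le_eq mult.commute)
  show "\<bar>estimate h N \<omega> x\<bar> \<le> kernel_bound / h"
    unfolding estimate_def by (rule avg) (use h kernel_bound in \<open>simp add: abs_divide divide_right_mono\<close>)
  show "\<bar>estimate_deriv h N \<omega> x\<bar> \<le> kernel_bound / h\<^sup>2"
    unfolding estimate_deriv_def by (rule avg) (use h kernel_bound in \<open>simp add: abs_divide divide_right_mono\<close>)
qed

lemma estimate_smooth_bounded:
  assumes h: "0 < h" and N: "N > 0"
  shows "smooth_bounded (estimate h N \<omega>) (estimate_deriv h N \<omega>)"
  unfolding smooth_bounded_def
proof (intro conjI allI)
  fix x
  have summand: "((\<lambda>x. K ((x - z) / h) / h) has_real_derivative deriv K ((x - z) / h) / h\<^sup>2) (at x)" for z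
    by (rule derivative_eq_intros DERIV_chain'[where f = "\<lambda>x. (x - z) / h", OF _ K_deriv] refl | use h in \<open>simp add: power2_eq_square\<close>)+
  show "(estimate h N \<omega> has_real_derivative estimate_deriv h N \<omega> x) (at x)"
    unfolding estimate_def[abs_def] estimate_deriv_def by (intro DERIV_cdivide DERIV_sum summand)
next
  show "continuous_on UNIV (estimate_deriv h N \<omega>)"
    unfolding estimate_deriv_def[abs_def] using h N
    by (intro continuous_intros continuous_on_compose2[OF K'_cont]) auto
  show "\<exists>B. \<forall>x. \<bar>estimate h N \<omega> x\<bar> \<le> B \<and> \<bar>estimate_deriv h N \<omega> x\<bar> \<le> B"
    using estimate_bounds[OF h N]
    by (intro exI[of _ "max (kernel_bound / h) (kernel_bound / h\<^sup>2)"]) (auto intro: max.coboundedI1 max.coboundedI2)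
qed

lemma estimate_measurable:
  "case_prod (estimate h N) \<in> borel_measurable (M \<Otimes>\<^sub>M lborel)"
  "case_prod (estimate_deriv h N) \<in> borel_measurable (M \<Otimes>\<^sub>M lborel)"
  unfolding estimate_def[abs_def] estimate_deriv_def[abs_def] by measurable

lemma kernel_estimator_eq:
  assumes "h n \<noteq> 0"
  shows "kernel_estimator K h Z n \<omega> = estimate (h n) (Suc n) \<omega>"
  unfolding kernel_estimator_def estimate_def
  by (simp add: fun_eq_iff sum_divide_distrib[symmetric] atLeast0AtMost lessThan_Suc_atMost add.commute mult.commute)

text \<open>The change of variables moves the smoothing from the data to \<open>v\<close>. The bias
  of the linear term is therefore governed by the smoothness of \<open>v\<close> instead of that of
  the density.\<close>

lemma integral_estimate:
  assumes h: "0 < h" and v: "continuous_on UNIV v"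
  shows "(LINT x|lborel. v x * estimate h N \<omega> x) = (\<Sum>j<N. LINT u|lborel. K u * v (Z j \<omega> + h * u)) / real N"
proof -
  have int: "integrable lborel (\<lambda>x. v x * (K ((x - z) / h) / h))" for z
  proof -
    have "integrable lborel (\<lambda>u. v (z + h * u) * (K u / h))"
      by (rule integrable_compact_support)
        (use h in \<open>auto intro!: continuous_intros K_cont continuous_on_compose2[OF v] simp: K_zero\<close>)
    moreover have "(\<lambda>u. v (z + h * u) * (K u / h)) = (\<lambda>u. v (z + h * u) * (K ((z + h * u - z) / h) / h))"
      using h by simp
    ultimately show ?thesis
      using lborel_integrable_real_affine_iff[of h "\<lambda>x. v x * (K ((x - z) / h) / h)" z] h by simp
  qed
  have "(LINT x|lborel. v x * estimate h N \<omega> x) = (LINT x|lborel. (\<Sum>j<N. v x * (K ((x - Z j \<omega>) / h) / h)) / real N)"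
    unfolding estimate_def by (simp add: sum_distrib_left)
  also have "\<dots> = (\<Sum>j<N. LINT x|lborel. v x * (K ((x - Z j \<omega>) / h) / h)) / real N"
    using int by (simp add: Bochner_Integration.integral_sum)
  finally show ?thesis unfolding integral_kernel_affine'[OF h] .
qed

text \<open>The mean square error for the estimate when \<open>k = 0\<close> and for its derivative
  when \<open>k = 1\<close>.\<close>

definition error_bound :: "real \<Rightarrow> nat \<Rightarrow> nat \<Rightarrow> real" where
  "error_bound h N k = mixing_const * (2 * (kernel_bound / h ^ Suc k))\<^sup>2 / real N + (D * h ^ (\<alpha> - Suc k))\<^sup>2"

lemma expectation_integrated_square_error:
  assumes h: "0 < h" "h \<le> 1 / 2" and N: "N > 0" and G: "integrable lborel G" "\<And>x. 0 \<le> G x"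
  shows "integrable M (\<lambda>\<omega>. LINT x|lborel. G x * (estimate h N \<omega> x - f x)\<^sup>2)"
    "expectation (\<lambda>\<omega>. LINT x|lborel. G x * (estimate h N \<omega> x - f x)\<^sup>2) \<le> error_bound h N 0 * (LINT x|lborel. G x)"
proof -
  obtain B where B: "B > 0" "\<And>x. \<bar>f x\<bar> \<le> B" "\<And>x. \<bar>f' x\<bar> \<le> B" by (rule smooth_bounded_bound[OF f_smooth]) blast
  have b: "\<bar>estimate h N \<omega> x - f x\<bar> \<le> kernel_bound / h + B" for \<omega> x
    using estimate_bounds(1)[OF h(1) N, of \<omega> x] B(2)[of x] by linarith
  have c: "0 \<le> (estimate h N \<omega> x - f x)\<^sup>2 \<and> (estimate h N \<omega> x - f x)\<^sup>2 \<le> (kernel_bound / h + B)\<^sup>2" for \<omega> x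
    using power_mono[OF b abs_ge_zero, of \<omega> x 2] by simp
  note [measurable] = estimate_measurable smooth_boundedD(4)[OF f_smooth]
  have m: "case_prod (\<lambda>\<omega> x. (estimate h N \<omega> x - f x)\<^sup>2) \<in> borel_measurable (M \<Otimes>\<^sub>M lborel)"
    by measurable
  have e: "expectation (\<lambda>\<omega>. (estimate h N \<omega> x - f x)\<^sup>2) \<le> error_bound h N 0" for x
    using estimate_mean_square_error[OF h N, of x] unfolding error_bound_def by simp
  show "integrable M (\<lambda>\<omega>. LINT x|lborel. G x * (estimate h N \<omega> x - f x)\<^sup>2)"
    "expectation (\<lambda>\<omega>. LINT x|lborel. G x * (estimate h N \<omega> x - f x)\<^sup>2) \<le> error_bound h N 0 * (LINT x|lborel. G x)"
    by (rule expectation_weighted_integral[OF m G c e])+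
qed

lemma expectation_deviation:
  assumes h: "0 < h" "h \<le> 1 / 2" and N: "N > 0" and G: "integrable lborel G" "\<And>x. 0 \<le> G x"
  defines "Y \<equiv> \<lambda>\<omega> x. (estimate h N \<omega> x - f x)\<^sup>2 + (estimate_deriv h N \<omega> x - f' x)\<^sup>2
      + \<bar>estimate h N \<omega> x - f x\<bar> + \<bar>estimate_deriv h N \<omega> x - f' x\<bar>"
  shows "integrable M (\<lambda>\<omega>. LINT x|lborel. G x * Y \<omega> x)"
    "expectation (\<lambda>\<omega>. LINT x|lborel. G x * Y \<omega> x)
      \<le> (error_bound h N 0 + error_bound h N 1 + sqrt (error_bound h N 0) + sqrt (error_bound h N 1)) * (LINT x|lborel. G x)"
proof -
  obtain B where B: "B > 0" "\<And>x. \<bar>f x\<bar> \<le> B" "\<And>x. \<bar>f' x\<bar> \<le> B" by (rule smooth_bounded_bound[OF f_smooth]) blast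
  let ?b = "kernel_bound / h + B" and ?b' = "kernel_bound / h\<^sup>2 + B"
  have b: "\<bar>estimate h N \<omega> x - f x\<bar> \<le> ?b" for \<omega> x
    using estimate_bounds(1)[OF h(1) N, of \<omega> x] B(2)[of x] by linarith
  have b': "\<bar>estimate_deriv h N \<omega> x - f' x\<bar> \<le> ?b'" for \<omega> x
    using estimate_bounds(2)[OF h(1) N, of \<omega> x] B(3)[of x] by linarith
  have c: "0 \<le> Y \<omega> x \<and> Y \<omega> x \<le> ?b\<^sup>2 + ?b'\<^sup>2 + ?b + ?b'" for \<omega> x
    using power_mono[OF b abs_ge_zero, of \<omega> x 2] power_mono[OF b' abs_ge_zero, of \<omega> x 2] b[of \<omega> x] b'[of \<omega> x]
    unfolding Y_def by simp
  note [measurable] = estimate_measurable smooth_boundedD(4,5)[OF f_smooth]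
  have m: "case_prod Y \<in> borel_measurable (M \<Otimes>\<^sub>M lborel)"
    unfolding Y_def by measurable
  have m1: "(\<lambda>\<omega>. estimate h N \<omega> x - f x) \<in> borel_measurable M"
    and m2: "(\<lambda>\<omega>. estimate_deriv h N \<omega> x - f' x) \<in> borel_measurable M" for x
    unfolding estimate_def estimate_deriv_def by measurable
  have e1: "expectation (\<lambda>\<omega>. (estimate h N \<omega> x - f x)\<^sup>2) \<le> error_bound h N 0"
    and e2: "expectation (\<lambda>\<omega>. (estimate_deriv h N \<omega> x - f' x)\<^sup>2) \<le> error_bound h N 1" for x
    using estimate_mean_square_error[OF h N, of x] estimate_deriv_mean_square_error[OF h N, of x]
    unfolding error_bound_def by (simp_all add: power2_eq_square numeral_2_eq_2)
  have i: "integrable M (\<lambda>\<omega>. (estimate h N \<omega> x - f x)\<^sup>2)" "integrable M (\<lambda>\<omega>. (estimate_deriv h N \<omega> x - f' x)\<^sup>2)"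
    "integrable M (\<lambda>\<omega>. \<bar>estimate h N \<omega> x - f x\<bar>)" "integrable M (\<lambda>\<omega>. \<bar>estimate_deriv h N \<omega> x - f' x\<bar>)" for x
  proof -
    show "integrable M (\<lambda>\<omega>. (estimate h N \<omega> x - f x)\<^sup>2)" by (rule integrable_square_of_bounded[OF m1 b])
    show "integrable M (\<lambda>\<omega>. (estimate_deriv h N \<omega> x - f' x)\<^sup>2)" by (rule integrable_square_of_bounded[OF m2 b'])
    show "integrable M (\<lambda>\<omega>. \<bar>estimate h N \<omega> x - f x\<bar>)"
      by (rule integrable_const_bound[of _ ?b]) (use b m1[of x] in auto)
    show "integrable M (\<lambda>\<omega>. \<bar>estimate_deriv h N \<omega> x - f' x\<bar>)"
      by (rule integrable_const_bound[of _ ?b']) (use b' m2[of x] in auto)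
  qed
  have e: "expectation (\<lambda>\<omega>. Y \<omega> x) \<le> error_bound h N 0 + error_bound h N 1 + sqrt (error_bound h N 0) + sqrt (error_bound h N 1)" for x
  proof -
    have "expectation (\<lambda>\<omega>. Y \<omega> x) = expectation (\<lambda>\<omega>. (estimate h N \<omega> x - f x)\<^sup>2) + expectation (\<lambda>\<omega>. (estimate_deriv h N \<omega> x - f' x)\<^sup>2)
        + expectation (\<lambda>\<omega>. \<bar>estimate h N \<omega> x - f x\<bar>) + expectation (\<lambda>\<omega>. \<bar>estimate_deriv h N \<omega> x - f' x\<bar>)"
      unfolding Y_def using i by simp
    also have "\<dots> \<le> error_bound h N 0 + error_bound h N 1 + sqrt (error_bound h N 0) + sqrt (error_bound h N 1)"
      by (intro add_mono e1 e2 expectation_abs_le_sqrt[OF m1 b e1] expectation_abs_le_sqrt[OF m2 b' e2])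
    finally show ?thesis .
  qed
  show "integrable M (\<lambda>\<omega>. LINT x|lborel. G x * Y \<omega> x)"
    "expectation (\<lambda>\<omega>. LINT x|lborel. G x * Y \<omega> x)
      \<le> (error_bound h N 0 + error_bound h N 1 + sqrt (error_bound h N 0) + sqrt (error_bound h N 1)) * (LINT x|lborel. G x)"
    by (rule expectation_weighted_integral[OF m G c e])+
qed

end

section \<open>Asymptotics of the estimator\<close>

lemma sqrt_mult_divide:
  assumes "0 < (y :: real)"
  shows "sqrt y * (x / y) = x / sqrt y"
proof -
  define s where "s = sqrt y"
  have s: "0 < s" "y = s * s" unfolding s_def using assms by simp_all
  have "s * (x / (s * s)) = x / s" using s(1) by simp
  then show ?thesis unfolding s_def[symmetric] s(2)[symmetric] .
qed

text \<open>The clause \<open>identifiable\<close> asks for a gap above 0 because the limit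
  criterion is zero at \<open>\<theta>\<^sub>0\<close>.\<close>

locale minimum_distance_estimation =
  stationary_mixing M Z + kernel_density_estimation M Z \<alpha> K \<pi> \<pi>' D +
  drift_regression a b \<theta>\<^sub>0 P \<mu> m m' \<sigma> \<sigma>' w w' \<pi> \<pi>' \<mu>1 \<mu>2 \<mu>3 G
  for M :: "'a measure" and Z \<alpha> K \<pi> \<pi>' D a b \<theta>\<^sub>0 P \<mu> m m' \<sigma> \<sigma>' w w' \<mu>1 \<mu>2 \<mu>3 G +
  fixes h :: "nat \<Rightarrow> real" and \<theta>hat :: "nat \<Rightarrow> 'a \<Rightarrow> real" and B\<^sub>v D\<^sub>v :: real
  assumes order: "\<alpha> > 4"
    and influence_le: "\<And>x. \<bar>influence x\<bar> \<le> B\<^sub>v"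
    and influence_bias: "\<And>x h. \<bar>(LINT u|lborel. K u * influence (x + h * u)) - influence x\<bar> \<le> D\<^sub>v * \<bar>h\<bar> ^ \<alpha>"
    and h_pos: "\<And>n. n \<ge> 1 \<Longrightarrow> h n > 0" and h_null: "h \<longlonglongrightarrow> 0"
    and nh4: "filterlim (\<lambda>n. real n * h n ^ 4) at_top sequentially"
    and bias_rate: "(\<lambda>n. sqrt (real (Suc n)) * h n ^ \<alpha>) \<longlonglongrightarrow> 0"
    and estimator_measurable: "\<And>n. n \<ge> 1 \<Longrightarrow> \<theta>hat n \<in> borel_measurable M"
    and estimator: "\<And>n \<omega>. n \<ge> 1 \<Longrightarrow> \<omega> \<in> space M \<Longrightarrow>
      is_arg_min (criterion \<mu> \<sigma> w (kernel_estimator K h Z n \<omega>)) (\<lambda>\<theta>. \<theta> \<in> {a..b}) (\<theta>hat n \<omega>)"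
    and identifiable: "\<And>\<epsilon>. \<epsilon> > 0 \<Longrightarrow> \<exists>c>0. \<forall>\<theta>\<in>{a..b}. \<epsilon> \<le> \<bar>\<theta> - \<theta>\<^sub>0\<bar> \<longrightarrow> c \<le> criterion \<mu> \<sigma> w \<pi> \<theta>"
    and information_nonzero: "information \<noteq> 0"
begin

definition asymptotic_variance :: real where
  "asymptotic_variance = expectation (\<lambda>\<omega>. (influence (Z 0 \<omega>))\<^sup>2) +
     2 * (\<Sum>j. expectation (\<lambda>\<omega>. influence (Z 0 \<omega>) * influence (Z (Suc j) \<omega>)))"

definition normalized_sum :: "nat \<Rightarrow> 'a \<Rightarrow> real" where
  "normalized_sum n \<omega> = (\<Sum>j<Suc n. influence (Z j \<omega>)) / sqrt (real (Suc n))"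

definition dev :: "nat \<Rightarrow> 'a \<Rightarrow> real" where
  "dev n \<omega> = deviation (estimate (h n) (Suc n) \<omega>) (estimate_deriv (h n) (Suc n) \<omega>)"

text \<open>Smoothing bias of \<open>influence\<close> plus the quadratic error of
  \<open>score_expansion\<close>, on the scale sqrt N.\<close>

definition remainder :: "nat \<Rightarrow> 'a \<Rightarrow> real" where
  "remainder n \<omega> = sqrt (real (Suc n)) *
     (D\<^sub>v * h n ^ \<alpha> + 6 * (LINT x|lborel. G x * (estimate (h n) (Suc n) \<omega> x - \<pi> x)\<^sup>2))"

lemma B\<^sub>v_nonneg: "0 \<le> B\<^sub>v" using influence_le[of 0] by linarith

lemma influence_measurable [measurable]: "influence \<in> borel_measurable borel"
  using influence_cont by (rule borel_measurable_continuous_onI)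

lemma influence_mean_zero: "expectation (\<lambda>\<omega>. influence (Z 0 \<omega>)) = 0"
  using expectation_density[OF influence_measurable] influence_mean by simp

text \<open>The added 1 makes the bound strictly positive, as the moment bounds require.\<close>

lemma influence_le': "\<bar>influence x\<bar> \<le> B\<^sub>v + 1" "0 < B\<^sub>v + 1"
  using influence_le[of x] B\<^sub>v_nonneg by linarith+

lemma normalized_sum_clt:
  "(\<lambda>n. expectation (\<lambda>\<omega>. iexp (t * normalized_sum n \<omega>)))
    \<longlonglongrightarrow> complex_of_real (exp (- (t\<^sup>2 * asymptotic_variance / 2)))"
  using LIMSEQ_Suc[OF central_limit_theorem[OF influence_measurable influence_le' influence_mean_zero, of t]]
  unfolding normalized_sum_def asymptotic_variance_def .

lemma normalized_sum_measurable [measurable]: "normalized_sum n \<in> borel_measurable M"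
  unfolding normalized_sum_def[abs_def] by measurable

lemma normalized_sum_bounded: "\<bar>normalized_sum n \<omega>\<bar> \<le> real (Suc n) * (B\<^sub>v + 1) / sqrt (real (Suc n))"
proof -
  have "\<bar>\<Sum>j<Suc n. influence (Z j \<omega>)\<bar> \<le> real (card {..<Suc n}) * (B\<^sub>v + 1)"
    using sum_norm_bound[of "{..<Suc n}" "\<lambda>j. influence (Z j \<omega>)" "B\<^sub>v + 1"] influence_le'(1) by simp
  then have "\<bar>\<Sum>j<Suc n. influence (Z j \<omega>)\<bar> / sqrt (real (Suc n)) \<le> real (Suc n) * (B\<^sub>v + 1) / sqrt (real (Suc n))"
    unfolding card_lessThan by (rule divide_right_mono) simp
  then show ?thesis unfolding normalized_sum_def abs_divide by simp
qed

text \<open>Uniformity in \<open>n\<close> is the point: the linearization error contains a small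
  multiple of \<open>normalized_sum\<close>, and stays small in mean.\<close>

lemma expectation_abs_normalized_sum:
  "expectation (\<lambda>\<omega>. \<bar>normalized_sum n \<omega>\<bar>) \<le> sqrt (mixing_const * (B\<^sub>v + 1)\<^sup>2)"
proof (rule expectation_abs_le_sqrt[OF normalized_sum_measurable normalized_sum_bounded])
  have "expectation (\<lambda>\<omega>. (normalized_sum n \<omega>)\<^sup>2) = expectation (\<lambda>\<omega>. (\<Sum>j<Suc n. influence (Z j \<omega>))\<^sup>2 / real (Suc n))"
    unfolding normalized_sum_def power_divide by simp
  also have "\<dots> = expectation (\<lambda>\<omega>. (\<Sum>j<Suc n. influence (Z j \<omega>))\<^sup>2) / real (Suc n)"
    by (rule integral_divide_zero)
  also have "\<dots> \<le> mixing_const * (B\<^sub>v + 1)\<^sup>2 * real (card {..<Suc n}) / real (Suc n)"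
    by (intro divide_right_mono second_moment_sum_bound influence_measurable influence_le' influence_mean_zero) auto
  also have "\<dots> = mixing_const * (B\<^sub>v + 1)\<^sup>2" by simp
  finally show "expectation (\<lambda>\<omega>. (normalized_sum n \<omega>)\<^sup>2) \<le> mixing_const * (B\<^sub>v + 1)\<^sup>2" .
qed

lemma estimate_smooth:
  assumes "n \<ge> 1"
  shows "smooth_bounded (estimate (h n) (Suc n) \<omega>) (estimate_deriv (h n) (Suc n) \<omega>)"
  using estimate_smooth_bounded[OF h_pos[OF assms]] by simp

lemma estimator_arg_min:
  assumes "n \<ge> 1" "\<omega> \<in> space M"
  shows "is_arg_min (criterion \<mu> \<sigma> w (estimate (h n) (Suc n) \<omega>)) (\<lambda>\<theta>. \<theta> \<in> {a..b}) (\<theta>hat n \<omega>)"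
  using estimator[OF assms] h_pos[OF assms(1)] kernel_estimator_eq[of h n \<omega>] by simp

lemma dev_nonneg: "0 \<le> dev n \<omega>"
  unfolding dev_def deviation_def using G_nonneg by simp

lemma remainder_nonneg:
  assumes "n \<ge> 1"
  shows "0 \<le> remainder n \<omega>"
proof -
  have "0 \<le> D\<^sub>v * \<bar>1\<bar> ^ \<alpha>"
    using influence_bias[of 0 1] by linarith
  then have "0 \<le> D\<^sub>v * h n ^ \<alpha>" using h_pos[OF assms] by simp
  then show ?thesis unfolding remainder_def using G_nonneg by simp
qed

lemma score_approximation:
  assumes n: "n \<ge> 1"
  shows "\<bar>sqrt (real (Suc n)) * score (estimate (h n) (Suc n) \<omega>) (estimate_deriv (h n) (Suc n) \<omega>) \<theta>\<^sub>0
      - normalized_sum n \<omega>\<bar> \<le> remainder n \<omega>"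
proof -
  let ?N = "Suc n" and ?f = "estimate (h n) (Suc n) \<omega>" and ?f' = "estimate_deriv (h n) (Suc n) \<omega>"
  let ?I = "LINT x|lborel. influence x * ?f x"
  let ?v = "(\<Sum>j<?N. influence (Z j \<omega>)) / real ?N"
  have "\<bar>?I - ?v\<bar> \<le> D\<^sub>v * h n ^ \<alpha>"
  proof -
    have "?I - ?v = (\<Sum>j<?N. (LINT u|lborel. K u * influence (Z j \<omega> + h n * u)) - influence (Z j \<omega>)) / real ?N"
      unfolding integral_estimate[OF h_pos[OF n] influence_cont] sum_subtractf diff_divide_distrib ..
    then have eq: "\<bar>?I - ?v\<bar> = \<bar>\<Sum>j<?N. (LINT u|lborel. K u * influence (Z j \<omega> + h n * u)) - influence (Z j \<omega>)\<bar> / real ?N"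
      by (simp add: abs_divide)
    have "\<bar>\<Sum>j<?N. (LINT u|lborel. K u * influence (Z j \<omega> + h n * u)) - influence (Z j \<omega>)\<bar> \<le> real (card {..<?N}) * (D\<^sub>v * \<bar>h n\<bar> ^ \<alpha>)"
      unfolding real_norm_def[symmetric] by (rule sum_norm_bound) (use influence_bias in simp)
    then have "\<bar>?I - ?v\<bar> \<le> real (card {..<?N}) * (D\<^sub>v * \<bar>h n\<bar> ^ \<alpha>) / real ?N"
      unfolding eq by (rule divide_right_mono) simp
    then show ?thesis using h_pos[OF n] by simp
  qed
  moreover have "\<bar>score ?f ?f' \<theta>\<^sub>0 - ?I\<bar> \<le> 6 * (LINT x|lborel. G x * (?f x - \<pi> x)\<^sup>2)"
    by (rule score_expansion[OF estimate_smooth[OF n]])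
  ultimately have "\<bar>score ?f ?f' \<theta>\<^sub>0 - ?v\<bar> \<le> D\<^sub>v * h n ^ \<alpha> + 6 * (LINT x|lborel. G x * (?f x - \<pi> x)\<^sup>2)"
    by linarith
  then have "sqrt (real ?N) * \<bar>score ?f ?f' \<theta>\<^sub>0 - ?v\<bar> \<le> remainder n \<omega>"
    unfolding remainder_def by (rule mult_left_mono) simp
  moreover have "sqrt (real ?N) * ?v = normalized_sum n \<omega>"
    unfolding normalized_sum_def by (rule sqrt_mult_divide) simp
  then have "sqrt (real ?N) * score ?f ?f' \<theta>\<^sub>0 - normalized_sum n \<omega> = sqrt (real ?N) * (score ?f ?f' \<theta>\<^sub>0 - ?v)"
    by (simp only: right_diff_distrib)
  ultimately show ?thesis by (simp add: abs_mult)
qed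

definition lin_const :: real where
  "lin_const = 8 * P\<^sup>2 * (LINT x|lborel. G x) + (8 * (b - a) + 8 * P + 8)"

lemma lin_const_nonneg: "0 \<le> lin_const"
  unfolding lin_const_def using G_nonneg P(1) ab by (intro add_nonneg_nonneg mult_nonneg_nonneg integral_nonneg) auto

text \<open>At the interior minimizer the score vanishes, so its increment from
  \<open>\<theta>\<^sub>0\<close> gives an equation for the scaled error whose perturbation is
  proportional to that error. Closeness \<open>\<eta>\<close> makes the proportion small against
  \<open>information\<close>, and the perturbation is absorbed.\<close>

lemma linearization:
  assumes n: "n \<ge> 1" and \<omega>: "\<omega> \<in> space M"
    and \<eta>: "0 \<le> \<eta>" "\<eta> \<le> (b - \<theta>\<^sub>0) / 2" "\<eta> \<le> (\<theta>\<^sub>0 - a) / 2" "2 * (lin_const * \<eta>) \<le> \<bar>information\<bar>"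
    and close: "\<bar>\<theta>hat n \<omega> - \<theta>\<^sub>0\<bar> \<le> \<eta>" "dev n \<omega> \<le> \<eta>"
  shows "\<bar>sqrt (real (Suc n)) * (\<theta>hat n \<omega> - \<theta>\<^sub>0) - (- (normalized_sum n \<omega> / information))\<bar>
    \<le> (2 * lin_const * \<eta> / \<bar>information\<bar> * (\<bar>normalized_sum n \<omega>\<bar> + remainder n \<omega>) + remainder n \<omega>) / \<bar>information\<bar>"
proof -
  let ?f = "estimate (h n) (Suc n) \<omega>" and ?f' = "estimate_deriv (h n) (Suc n) \<omega>"
  let ?I = information and ?U = "normalized_sum n \<omega>" and ?q = "remainder n \<omega>" and ?C = lin_const
  define d where "d = \<theta>hat n \<omega> - \<theta>\<^sub>0"
  define V where "V = sqrt (real (Suc n)) * d"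
  define s where "s = score ?f ?f' \<theta>\<^sub>0"
  define Y where "Y = sqrt (real (Suc n)) * s"
  have interior: "\<theta>hat n \<omega> \<in> {a<..<b}"
    using close(1) \<eta> \<theta>\<^sub>0 by (auto simp: field_simps abs_le_iff)
  have in_ab: "\<theta>hat n \<omega> \<in> {a..b}" using interior by simp
  have zero: "score ?f ?f' (\<theta>hat n \<omega>) = 0"
    by (rule score_at_minimizer[OF estimate_smooth[OF n] estimator_arg_min[OF n \<omega>] interior])
  have "\<bar>score ?f ?f' (\<theta>hat n \<omega>) - s - d * ?I\<bar> \<le> d\<^sup>2 * (8 * P\<^sup>2 * (LINT x|lborel. G x)) + \<bar>d\<bar> * ((8 * (b - a) + 8 * P + 8) * dev n \<omega>)"
    using score_increment[OF estimate_smooth[OF n] in_ab] unfolding s_def d_def dev_def .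
  also have "\<dots> \<le> \<bar>d\<bar> * ((8 * P\<^sup>2 * (LINT x|lborel. G x)) * \<eta>) + \<bar>d\<bar> * ((8 * (b - a) + 8 * P + 8) * \<eta>)"
  proof (intro add_mono mult_left_mono)
    have GI: "0 \<le> 8 * P\<^sup>2 * (LINT x|lborel. G x)" using G_nonneg by simp
    have "d\<^sup>2 * (8 * P\<^sup>2 * (LINT x|lborel. G x)) = \<bar>d\<bar> * ((8 * P\<^sup>2 * (LINT x|lborel. G x)) * \<bar>d\<bar>)"
      by (simp add: power2_eq_square flip: abs_mult)
    also have "\<dots> \<le> \<bar>d\<bar> * ((8 * P\<^sup>2 * (LINT x|lborel. G x)) * \<eta>)"
      using close(1) unfolding d_def by (intro mult_left_mono GI) auto
    finally show "d\<^sup>2 * (8 * P\<^sup>2 * (LINT x|lborel. G x)) \<le> \<bar>d\<bar> * ((8 * P\<^sup>2 * (LINT x|lborel. G x)) * \<eta>)" .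
  qed (use close(2) ab P(1) in auto)
  also have "\<dots> = \<bar>d\<bar> * (?C * \<eta>)" unfolding lin_const_def by (simp add: algebra_simps)
  finally have lin: "\<bar>s + d * ?I\<bar> \<le> \<bar>d\<bar> * (?C * \<eta>)" unfolding zero by linarith
  have VI: "\<bar>Y + V * ?I\<bar> \<le> \<bar>V\<bar> * (?C * \<eta>)"
  proof -
    have "\<bar>Y + V * ?I\<bar> = sqrt (real (Suc n)) * \<bar>s + d * ?I\<bar>"
    proof -
      have eq: "Y + V * ?I = sqrt (real (Suc n)) * (s + d * ?I)"
        unfolding Y_def V_def by (simp only: distrib_left mult.assoc)
      show ?thesis unfolding eq abs_mult by simp
    qed
    also have "\<dots> \<le> sqrt (real (Suc n)) * (\<bar>d\<bar> * (?C * \<eta>))" using lin by (rule mult_left_mono) simp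
    finally show ?thesis unfolding V_def by (simp add: abs_mult mult.assoc)
  qed
  have YU: "\<bar>Y - ?U\<bar> \<le> ?q"
    unfolding Y_def s_def by (rule score_approximation[OF n])
  have I0: "0 < \<bar>?I\<bar>" using information_nonzero by simp
  \<comment> \<open>Absorption: the perturbation takes at most half of
    \<open>\<bar>V * ?I\<bar>\<close>, which bounds \<open>V\<close> by the score, and this bound is
    inserted back into the perturbation.\<close>
  have "\<bar>V\<bar> * (?C * \<eta>) \<le> \<bar>V\<bar> * (\<bar>?I\<bar> / 2)" using \<eta>(4) by (intro mult_left_mono) auto
  moreover have "\<bar>V * ?I\<bar> = \<bar>V\<bar> * \<bar>?I\<bar>" by (rule abs_mult)
  ultimately have "\<bar>V\<bar> * \<bar>?I\<bar> \<le> \<bar>Y\<bar> + \<bar>V\<bar> * \<bar>?I\<bar> / 2" using VI by linarith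
  then have "\<bar>V\<bar> * \<bar>?I\<bar> \<le> 2 * \<bar>Y\<bar>" by linarith
  then have V_le: "\<bar>V\<bar> \<le> 2 * \<bar>Y\<bar> / \<bar>?I\<bar>" using I0 by (simp add: pos_le_divide_eq)
  have Y_le: "\<bar>Y\<bar> \<le> \<bar>?U\<bar> + ?q" using YU by linarith
  have "\<bar>V\<bar> * (?C * \<eta>) \<le> 2 * (\<bar>?U\<bar> + ?q) / \<bar>?I\<bar> * (?C * \<eta>)"
    using V_le Y_le I0 lin_const_nonneg \<eta>(1)
    by (intro mult_right_mono order.trans[OF V_le] divide_right_mono mult_left_mono) auto
  then have "\<bar>V * ?I + ?U\<bar> \<le> 2 * (\<bar>?U\<bar> + ?q) / \<bar>?I\<bar> * (?C * \<eta>) + ?q"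
    using VI YU by linarith
  also have "\<dots> = 2 * ?C * \<eta> / \<bar>?I\<bar> * (\<bar>?U\<bar> + ?q) + ?q" by simp
  finally have "\<bar>V * ?I + ?U\<bar> / \<bar>?I\<bar> \<le> (2 * ?C * \<eta> / \<bar>?I\<bar> * (\<bar>?U\<bar> + ?q) + ?q) / \<bar>?I\<bar>"
    by (rule divide_right_mono) simp
  moreover have "V - (- (?U / ?I)) = (V * ?I + ?U) / ?I"
    using information_nonzero by (simp add: field_simps)
  ultimately show ?thesis unfolding V_def d_def abs_divide[symmetric] by simp
qed

section \<open>Rates of the error bounds\<close>

lemma eventually_h: "eventually (\<lambda>n. 0 < h n \<and> h n \<le> 1 / 2) sequentially"
proof -
  have "eventually (\<lambda>n. h n < 1 / 2) sequentially"
    by (rule order_tendstoD(2)[OF h_null]) simp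
  then show ?thesis
    using eventually_ge_at_top[of 1] by eventually_elim (use h_pos in auto)
qed

text \<open>Since \<open>h\<close> is eventually below 1, the case \<open>k = 1\<close> is the
  worst, and the growth of \<open>n h^4\<close> covers both.\<close>

lemma variance_rate:
  assumes "k \<le> 1"
  shows "(\<lambda>n. mixing_const * (2 * (kernel_bound / h n ^ Suc k))\<^sup>2 / real (Suc n)) \<longlonglongrightarrow> 0"
proof (rule tendsto_sandwich[OF _ _ tendsto_const])
  show "(\<lambda>n. mixing_const * (2 * kernel_bound)\<^sup>2 / (real n * h n ^ 4)) \<longlonglongrightarrow> 0"
    by (rule real_tendsto_divide_at_top[OF tendsto_const nh4])
  show "eventually (\<lambda>n. mixing_const * (2 * (kernel_bound / h n ^ Suc k))\<^sup>2 / real (Suc n)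
      \<le> mixing_const * (2 * kernel_bound)\<^sup>2 / (real n * h n ^ 4)) sequentially"
    using eventually_h eventually_ge_at_top[of 1]
  proof eventually_elim
    case (elim n)
    have "h n ^ 4 \<le> h n ^ (2 * Suc k)"
      using elim assms by (intro power_decreasing) auto
    then have "real n * h n ^ 4 \<le> real (Suc n) * h n ^ (2 * Suc k)"
      using elim by (intro mult_mono) auto
    then have "mixing_const * (2 * kernel_bound)\<^sup>2 / (real (Suc n) * h n ^ (2 * Suc k)) \<le> mixing_const * (2 * kernel_bound)\<^sup>2 / (real n * h n ^ 4)"
      using elim mixing_const_nonneg by (intro divide_left_mono) auto
    moreover have "mixing_const * (2 * (kernel_bound / h n ^ Suc k))\<^sup>2 / real (Suc n) =
        mixing_const * (2 * kernel_bound)\<^sup>2 / (real (Suc n) * h n ^ (2 * Suc k))"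
    proof -
      have "h n ^ (2 * Suc k) = (h n ^ Suc k)\<^sup>2" by (simp only: power_mult[symmetric] mult.commute)
      then show ?thesis by (simp add: power_divide power_mult_distrib ac_simps del: of_nat_Suc power_Suc)
    qed
    ultimately show ?case by simp
  qed
qed (use mixing_const_nonneg in auto)

lemma error_bound_null:
  assumes "k \<le> 1"
  shows "(\<lambda>n. error_bound (h n) (Suc n) k) \<longlonglongrightarrow> 0"
proof -
  have "(\<lambda>n. mixing_const * (2 * (kernel_bound / h n ^ Suc k))\<^sup>2 / real (Suc n) + (D * h n ^ (\<alpha> - Suc k))\<^sup>2)
      \<longlonglongrightarrow> 0 + (D * 0 ^ (\<alpha> - Suc k))\<^sup>2"
    by (intro tendsto_intros variance_rate assms h_null)
  \<comment> \<open>With exponent zero the power of zero in the limit would be 1.\<close>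
  moreover have "\<alpha> - Suc k \<noteq> 0" using assms order by simp
  ultimately show ?thesis unfolding error_bound_def by (simp add: power_0_left)
qed

text \<open>The variance contributes the reciprocal of the root of \<open>n h^4\<close>. The squared
  bias has exponent \<open>2 * (\<alpha> - 1)\<close>, at least \<alpha>, so the rate assumed for
  the bias of \<open>influence\<close> covers it too.\<close>

lemma error_bound_rate:
  "(\<lambda>n. sqrt (real (Suc n)) * error_bound (h n) (Suc n) 0) \<longlonglongrightarrow> 0"
proof -
  define c where "c = mixing_const * (2 * kernel_bound)\<^sup>2"
  have c0: "0 \<le> c" unfolding c_def using mixing_const_nonneg by simp
  have top: "filterlim (\<lambda>n. sqrt (real n * h n ^ 4)) at_top sequentially"
    by (rule filterlim_compose[OF sqrt_at_top nh4])
  have "(\<lambda>n. c / sqrt (real n * h n ^ 4)) \<longlonglongrightarrow> 0"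
    by (rule real_tendsto_divide_at_top[OF tendsto_const top])
  moreover have "(\<lambda>n. D\<^sup>2 * (sqrt (real (Suc n)) * h n ^ \<alpha>)) \<longlonglongrightarrow> D\<^sup>2 * 0"
    by (intro tendsto_intros bias_rate)
  ultimately have lim: "(\<lambda>n. c / sqrt (real n * h n ^ 4) + D\<^sup>2 * (sqrt (real (Suc n)) * h n ^ \<alpha>)) \<longlonglongrightarrow> 0"
    using tendsto_add by fastforce
  show ?thesis
  proof (rule tendsto_sandwich[OF _ _ tendsto_const lim])
    show "eventually (\<lambda>n. 0 \<le> sqrt (real (Suc n)) * error_bound (h n) (Suc n) 0) sequentially"
      unfolding error_bound_def using mixing_const_nonneg by (intro always_eventually allI) auto
    show "eventually (\<lambda>n. sqrt (real (Suc n)) * error_bound (h n) (Suc n) 0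
        \<le> c / sqrt (real n * h n ^ 4) + D\<^sup>2 * (sqrt (real (Suc n)) * h n ^ \<alpha>)) sequentially"
      using eventually_h eventually_ge_at_top[of 1]
    proof eventually_elim
      case (elim n)
      let ?N = "real (Suc n)"
      have hn: "0 < h n" "h n \<le> 1" using elim by auto
      have "sqrt ?N * (mixing_const * (2 * (kernel_bound / h n ^ Suc 0))\<^sup>2 / ?N) = c / (sqrt ?N * (h n)\<^sup>2)"
      proof -
        have "sqrt ?N / ?N = 1 / sqrt ?N"
          using real_sqrt_mult_self[of ?N] by (simp add: field_simps del: of_nat_Suc)
        then have "sqrt ?N * (c / (h n)\<^sup>2 / ?N) = c / (h n)\<^sup>2 * (1 / sqrt ?N)"
          by (metis mult.commute times_divide_eq_right)
        moreover have "mixing_const * (2 * (kernel_bound / h n ^ Suc 0))\<^sup>2 = c / (h n)\<^sup>2"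
          unfolding c_def by (simp add: power_divide power_mult_distrib)
        ultimately show ?thesis by (simp add: mult.commute)
      qed
      also have "\<dots> \<le> c / sqrt (real n * h n ^ 4)"
      proof (rule divide_left_mono[OF _ c0])
        have "sqrt (real n * h n ^ 4) = sqrt (real n) * (h n)\<^sup>2"
          using hn by (simp add: real_sqrt_mult power4_eq_xxxx power2_eq_square real_sqrt_unique)
        also have "\<dots> \<le> sqrt ?N * (h n)\<^sup>2" by (intro mult_right_mono) auto
        finally show "sqrt (real n * h n ^ 4) \<le> sqrt ?N * (h n)\<^sup>2" .
        show "0 < sqrt ?N * (h n)\<^sup>2 * sqrt (real n * h n ^ 4)" using hn elim by simp
      qed
      finally have 1: "sqrt ?N * (mixing_const * (2 * (kernel_bound / h n ^ Suc 0))\<^sup>2 / ?N) \<le> c / sqrt (real n * h n ^ 4)" .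
      have "(D * h n ^ (\<alpha> - Suc 0))\<^sup>2 = D\<^sup>2 * h n ^ (2 * (\<alpha> - Suc 0))"
        by (simp add: power_mult_distrib mult.commute flip: power_mult)
      also have "\<dots> \<le> D\<^sup>2 * h n ^ \<alpha>"
        using hn order by (intro mult_left_mono power_decreasing) auto
      finally have "sqrt ?N * (D * h n ^ (\<alpha> - Suc 0))\<^sup>2 \<le> sqrt ?N * (D\<^sup>2 * h n ^ \<alpha>)"
        by (rule mult_left_mono) simp
      then have 2: "sqrt ?N * (D * h n ^ (\<alpha> - Suc 0))\<^sup>2 \<le> D\<^sup>2 * (sqrt ?N * h n ^ \<alpha>)"
        by (simp only: ac_simps)
      show ?case unfolding error_bound_def distrib_left using 1 2 by linarith
    qed
  qed
qed

definition dev_bound :: "nat \<Rightarrow> real" where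
  "dev_bound n = (error_bound (h n) (Suc n) 0 + error_bound (h n) (Suc n) 1
     + sqrt (error_bound (h n) (Suc n) 0) + sqrt (error_bound (h n) (Suc n) 1)) * (LINT x|lborel. G x)"

definition remainder_bound :: "nat \<Rightarrow> real" where
  "remainder_bound n = D\<^sub>v * (sqrt (real (Suc n)) * h n ^ \<alpha>)
     + 6 * (sqrt (real (Suc n)) * error_bound (h n) (Suc n) 0 * (LINT x|lborel. G x))"

lemma dev_bound_null: "dev_bound \<longlonglongrightarrow> 0"
proof -
  have "dev_bound \<longlonglongrightarrow> (0 + 0 + sqrt 0 + sqrt 0) * (LINT x|lborel. G x)"
    unfolding dev_bound_def by (intro tendsto_intros error_bound_null) auto
  then show ?thesis by simp
qed

lemma remainder_bound_null: "remainder_bound \<longlonglongrightarrow> 0"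
proof -
  have "remainder_bound \<longlonglongrightarrow> D\<^sub>v * 0 + 6 * (0 * (LINT x|lborel. G x))"
    unfolding remainder_bound_def by (intro tendsto_intros error_bound_rate bias_rate)
  then show ?thesis by simp
qed

lemma expectation_dev:
  assumes "0 < h n" "h n \<le> 1 / 2"
  shows "integrable M (dev n)" "expectation (dev n) \<le> dev_bound n"
  using expectation_deviation[OF assms, of "Suc n" G] G_integrable G_nonneg
  unfolding dev_def[abs_def] deviation_def dev_bound_def by auto

lemma expectation_remainder:
  assumes "0 < h n" "h n \<le> 1 / 2"
  shows "integrable M (remainder n)" "expectation (remainder n) \<le> remainder_bound n"
proof -
  let ?T = "\<lambda>\<omega>. LINT x|lborel. G x * (estimate (h n) (Suc n) \<omega> x - \<pi> x)\<^sup>2"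
  have T: "integrable M ?T" "expectation ?T \<le> error_bound (h n) (Suc n) 0 * (LINT x|lborel. G x)"
    using expectation_integrated_square_error[OF assms, of "Suc n" G] G_integrable G_nonneg by auto
  show "integrable M (remainder n)"
    unfolding remainder_def[abs_def] using T(1) by simp
  have "expectation (remainder n) = sqrt (real (Suc n)) * (D\<^sub>v * h n ^ \<alpha> + 6 * expectation ?T)"
    unfolding remainder_def[abs_def] using T(1) by (simp add: prob_space)
  also have "\<dots> \<le> sqrt (real (Suc n)) * (D\<^sub>v * h n ^ \<alpha> + 6 * (error_bound (h n) (Suc n) 0 * (LINT x|lborel. G x)))"
    using T(2) by (intro mult_left_mono add_left_mono) auto
  also have "\<dots> = remainder_bound n" unfolding remainder_bound_def by (simp only: distrib_left ac_simps)
  finally show "expectation (remainder n) \<le> remainder_bound n" .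
qed

text \<open>Consistency and linearization are merged into one pointwise inequality whose expectation
  is taken; no separate statement of convergence in probability is needed.\<close>

lemma estimator_char_close:
  "(\<lambda>n. cmod (expectation (\<lambda>\<omega>. iexp (t * (sqrt (real (Suc n)) * (\<theta>hat n \<omega> - \<theta>\<^sub>0))))
     - expectation (\<lambda>\<omega>. iexp (t * (- (normalized_sum n \<omega> / information)))))) \<longlonglongrightarrow> 0"
proof -
  let ?I = information
  \<comment> \<open>This radius keeps the estimator in the interior and the perturbation below half
    of \<open>information\<close>; \<open>lin_const + 1\<close> avoids a division by zero.\<close>
  define \<eta>0 where "\<eta>0 = min (min ((b - \<theta>\<^sub>0) / 2) ((\<theta>\<^sub>0 - a) / 2)) (\<bar>?I\<bar> / (2 * (lin_const + 1)))"
  have I0: "0 < \<bar>?I\<bar>" using information_nonzero by simp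
  have \<eta>0: "0 < \<eta>0" unfolding \<eta>0_def using \<theta>\<^sub>0 I0 lin_const_nonneg by auto
  define \<eta> where "\<eta> = (\<lambda>L. \<eta>0 / real (Suc L))"
  have \<eta>_pos: "0 < \<eta> L" for L unfolding \<eta>_def using \<eta>0 by simp
  have \<eta>_le: "\<eta> L \<le> \<eta>0" for L unfolding \<eta>_def using \<eta>0 by (simp add: divide_le_eq mult_left_mono)
  have \<eta>_conds: "\<eta> L \<le> (b - \<theta>\<^sub>0) / 2" "\<eta> L \<le> (\<theta>\<^sub>0 - a) / 2" "2 * (lin_const * \<eta> L) \<le> \<bar>?I\<bar>" for L
  proof -
    show "\<eta> L \<le> (b - \<theta>\<^sub>0) / 2" "\<eta> L \<le> (\<theta>\<^sub>0 - a) / 2" using \<eta>_le[of L] unfolding \<eta>0_def by auto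
    have "lin_const * \<eta> L \<le> (lin_const + 1) * \<eta> L" using \<eta>_pos[of L] by (intro mult_right_mono) auto
    also have "\<dots> \<le> (lin_const + 1) * (\<bar>?I\<bar> / (2 * (lin_const + 1)))"
      using \<eta>_le[of L] lin_const_nonneg unfolding \<eta>0_def by (intro mult_left_mono) auto
    also have "\<dots> = \<bar>?I\<bar> / 2" using lin_const_nonneg by (simp add: field_simps)
    finally show "2 * (lin_const * \<eta> L) \<le> \<bar>?I\<bar>" by simp
  qed
  \<comment> \<open>Identifiability gives a gap for each radius; the gaps are chosen simultaneously
    for all \<open>L\<close>.\<close>
  have "\<exists>c. \<forall>L. 0 < c L \<and> (\<forall>\<theta>\<in>{a..b}. \<eta> L \<le> \<bar>\<theta> - \<theta>\<^sub>0\<bar> \<longrightarrow> c L \<le> criterion \<mu> \<sigma> w \<pi> \<theta>)"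
    using identifiable[OF \<eta>_pos] by (intro choice allI) blast
  then obtain c where c: "\<And>L. 0 < c L" "\<And>L \<theta>. \<theta> \<in> {a..b} \<Longrightarrow> \<eta> L \<le> \<bar>\<theta> - \<theta>\<^sub>0\<bar> \<Longrightarrow> c L \<le> criterion \<mu> \<sigma> w \<pi> \<theta>"
    by blast
  define C\<^sub>U where "C\<^sub>U = sqrt (mixing_const * (B\<^sub>v + 1)\<^sup>2)"
  \<comment> \<open>The outer 2 is the diameter of the unit circle. \<open>24 / c L\<close> comes
    from \<open>criterion_at_minimizer\<close> and covers a distant estimator;
    \<open>1 / \<eta> L\<close> covers a large deviation, as in Markov's inequality.\<close>
  define \<kappa> where "\<kappa> = (\<lambda>L. 2 * (24 / c L + 1 / \<eta> L))"
  define \<rho> where "\<rho> = (\<lambda>L. 2 * lin_const * \<eta> L / \<bar>?I\<bar>)"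
  have \<rho>_nonneg: "0 \<le> \<rho> L" for L unfolding \<rho>_def using lin_const_nonneg \<eta>_pos[of L] by simp
  have \<kappa>_nonneg: "0 \<le> \<kappa> L" for L unfolding \<kappa>_def using c(1)[of L] \<eta>_pos[of L] by simp
  define Bd where "Bd = (\<lambda>L n. \<kappa> L * dev_bound n + \<bar>t\<bar> * ((\<rho> L * (C\<^sub>U + remainder_bound n) + remainder_bound n) / \<bar>?I\<bar>))"
  \<comment> \<open>Although \<open>\<kappa> L\<close> may grow with \<open>L\<close>, it meets only
    the limit 0 of \<open>dev_bound\<close>, because \<open>n\<close> goes to infinity
    first.\<close>
  define d where "d = (\<lambda>L. \<kappa> L * 0 + \<bar>t\<bar> * ((\<rho> L * (C\<^sub>U + 0) + 0) / \<bar>?I\<bar>))"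
  let ?V = "\<lambda>n \<omega>. sqrt (real (Suc n)) * (\<theta>hat n \<omega> - \<theta>\<^sub>0)" and ?W = "\<lambda>n \<omega>. - (normalized_sum n \<omega> / ?I)"
  txt \<open>Where the estimator or the deviation is not within \<open>\<eta> L\<close>, the term \<open>\<kappa> L * dev n \<omega>\<close> is at
    least \<open>2\<close>, so that no exceptional event has to be treated separately.\<close>
  have pointwise: "cmod (iexp (t * ?V n \<omega>) - iexp (t * ?W n \<omega>)) \<le> \<kappa> L * dev n \<omega> +
      \<bar>t\<bar> * ((\<rho> L * (\<bar>normalized_sum n \<omega>\<bar> + remainder n \<omega>) + remainder n \<omega>) / \<bar>?I\<bar>)"
    if n: "n \<ge> 1" and \<omega>: "\<omega> \<in> space M" for n \<omega> L
  proof (cases "\<bar>\<theta>hat n \<omega> - \<theta>\<^sub>0\<bar> \<le> \<eta> L \<and> dev n \<omega> \<le> \<eta> L")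
    case True
    have "cmod (iexp (t * ?V n \<omega>) - iexp (t * ?W n \<omega>)) \<le> \<bar>t * ?V n \<omega> - t * ?W n \<omega>\<bar>"
      by (rule cmod_iexp_diff_le)
    also have "\<dots> = \<bar>t\<bar> * \<bar>?V n \<omega> - ?W n \<omega>\<bar>" by (simp only: right_diff_distrib[symmetric] abs_mult)
    also have "\<dots> \<le> \<bar>t\<bar> * ((\<rho> L * (\<bar>normalized_sum n \<omega>\<bar> + remainder n \<omega>) + remainder n \<omega>) / \<bar>?I\<bar>)"
      unfolding \<rho>_def using True \<eta>_pos[of L] \<eta>_conds[of L] by (intro mult_left_mono linearization[OF n \<omega>]) auto
    also have "\<dots> \<le> \<kappa> L * dev n \<omega> + \<bar>t\<bar> * ((\<rho> L * (\<bar>normalized_sum n \<omega>\<bar> + remainder n \<omega>) + remainder n \<omega>) / \<bar>?I\<bar>)"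
      using \<kappa>_nonneg[of L] dev_nonneg[of n \<omega>] by simp
    finally show ?thesis .
  next
    case False
    have "1 \<le> (24 / c L + 1 / \<eta> L) * dev n \<omega>"
    proof (cases "dev n \<omega> \<le> \<eta> L")
      case True
      then have far: "\<eta> L \<le> \<bar>\<theta>hat n \<omega> - \<theta>\<^sub>0\<bar>" using False by simp
      have "\<theta>hat n \<omega> \<in> {a..b}" using estimator_arg_min[OF n \<omega>] by (simp add: is_arg_min_def)
      then have "c L \<le> criterion \<mu> \<sigma> w \<pi> (\<theta>hat n \<omega>)" using c(2) far by blast
      also have "\<dots> \<le> 24 * dev n \<omega>"
        unfolding dev_def by (rule criterion_at_minimizer[OF estimate_smooth[OF n] estimator_arg_min[OF n \<omega>]])
      finally have "1 \<le> 24 / c L * dev n \<omega>" using c(1)[of L] by (simp add: pos_le_divide_eq)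
      also have "\<dots> \<le> (24 / c L + 1 / \<eta> L) * dev n \<omega>"
        using \<eta>_pos[of L] by (intro mult_right_mono dev_nonneg) simp
      finally show ?thesis .
    next
      case False
      then have "1 \<le> 1 / \<eta> L * dev n \<omega>" using \<eta>_pos[of L] by (simp add: pos_le_divide_eq)
      also have "\<dots> \<le> (24 / c L + 1 / \<eta> L) * dev n \<omega>"
        using c(1)[of L] by (intro mult_right_mono dev_nonneg) simp
      finally show ?thesis .
    qed
    moreover have "cmod (iexp (t * ?V n \<omega>) - iexp (t * ?W n \<omega>)) \<le> 2"
      using norm_triangle_ineq4[of "iexp (t * ?V n \<omega>)" "iexp (t * ?W n \<omega>)"] unfolding norm_exp_i_times by simp
    moreover have "0 \<le> \<bar>t\<bar> * ((\<rho> L * (\<bar>normalized_sum n \<omega>\<bar> + remainder n \<omega>) + remainder n \<omega>) / \<bar>?I\<bar>)"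
      using \<rho>_nonneg[of L] remainder_nonneg[OF n, of \<omega>] by simp
    ultimately show ?thesis unfolding \<kappa>_def by (simp only: mult.assoc)
  qed
  show ?thesis
  proof (rule tendsto_zero_of_double_limit[where D = Bd and d = d])
    show "eventually (\<lambda>n. cmod (expectation (\<lambda>\<omega>. iexp (t * ?V n \<omega>)) - expectation (\<lambda>\<omega>. iexp (t * ?W n \<omega>))) \<le> Bd L n) sequentially" for L
      using eventually_h eventually_ge_at_top[of 1]
    proof eventually_elim
      case (elim n)
      have h: "0 < h n" "h n \<le> 1 / 2" using elim by auto
      have [measurable]: "\<theta>hat n \<in> borel_measurable M" by (rule estimator_measurable) (use elim in simp)
      have U_int: "integrable M (\<lambda>\<omega>. \<bar>normalized_sum n \<omega>\<bar>)"
        by (rule integrable_const_bound[of _ "real (Suc n) * (B\<^sub>v + 1) / sqrt (real (Suc n))"]) (use normalized_sum_bounded in auto)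
      note ints = expectation_dev[OF h] expectation_remainder[OF h] U_int
      have i1: "complex_integrable M (\<lambda>\<omega>. iexp (t * ?V n \<omega>))" by (rule integrable_const_bound[of _ 1]) auto
      have i2: "complex_integrable M (\<lambda>\<omega>. iexp (t * ?W n \<omega>))" by (rule integrable_const_bound[of _ 1]) auto
      have "cmod (expectation (\<lambda>\<omega>. iexp (t * ?V n \<omega>)) - expectation (\<lambda>\<omega>. iexp (t * ?W n \<omega>))) =
          cmod (expectation (\<lambda>\<omega>. iexp (t * ?V n \<omega>) - iexp (t * ?W n \<omega>)))"
        by (rule arg_cong[where f = cmod], rule Bochner_Integration.integral_diff[OF i1 i2, symmetric])
      also have "\<dots> \<le> expectation (\<lambda>\<omega>. cmod (iexp (t * ?V n \<omega>) - iexp (t * ?W n \<omega>)))"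
        by (rule integral_norm_bound)
      also have "\<dots> \<le> expectation (\<lambda>\<omega>. \<kappa> L * dev n \<omega> +
          \<bar>t\<bar> * ((\<rho> L * (\<bar>normalized_sum n \<omega>\<bar> + remainder n \<omega>) + remainder n \<omega>) / \<bar>?I\<bar>))"
      proof (rule integral_mono)
        show "integrable M (\<lambda>\<omega>. cmod (iexp (t * ?V n \<omega>) - iexp (t * ?W n \<omega>)))"
          by (intro integrable_norm Bochner_Integration.integrable_diff i1 i2)
        show "integrable M (\<lambda>\<omega>. \<kappa> L * dev n \<omega> + \<bar>t\<bar> * ((\<rho> L * (\<bar>normalized_sum n \<omega>\<bar> + remainder n \<omega>) + remainder n \<omega>) / \<bar>?I\<bar>))"
          by (intro Bochner_Integration.integrable_add integrable_mult_right integrable_divide ints)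
        show "cmod (iexp (t * ?V n \<omega>) - iexp (t * ?W n \<omega>)) \<le> \<kappa> L * dev n \<omega> +
            \<bar>t\<bar> * ((\<rho> L * (\<bar>normalized_sum n \<omega>\<bar> + remainder n \<omega>) + remainder n \<omega>) / \<bar>?I\<bar>)"
          if "\<omega> \<in> space M" for \<omega>
          using pointwise[of n \<omega> L] that elim by simp
      qed
      also have "\<dots> = \<kappa> L * expectation (dev n) +
          \<bar>t\<bar> * ((\<rho> L * (expectation (\<lambda>\<omega>. \<bar>normalized_sum n \<omega>\<bar>) + expectation (remainder n)) + expectation (remainder n)) / \<bar>?I\<bar>)"
        using ints by simp
      also have "\<dots> \<le> Bd L n"
        unfolding Bd_def C\<^sub>U_def using \<kappa>_nonneg[of L] \<rho>_nonneg[of L]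
        by (intro add_mono mult_left_mono divide_right_mono ints expectation_abs_normalized_sum) auto
      finally show ?case .
    qed
    show "Bd L \<longlonglongrightarrow> d L" for L
      unfolding Bd_def d_def by (intro tendsto_intros dev_bound_null remainder_bound_null) (use I0 in auto)
    have "\<rho> = (\<lambda>L. 2 * lin_const * (\<eta>0 * (1 / real (Suc L))) / \<bar>?I\<bar>)" unfolding \<rho>_def \<eta>_def by simp
    moreover have "(\<lambda>L. 2 * lin_const * (\<eta>0 * (1 / real (Suc L))) / \<bar>?I\<bar>) \<longlonglongrightarrow> 2 * lin_const * (\<eta>0 * 0) / \<bar>?I\<bar>"
      by (intro tendsto_intros LIMSEQ_Suc[OF lim_1_over_n]) (use I0 in auto)
    ultimately have "\<rho> \<longlonglongrightarrow> 0" by simp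
    then have "(\<lambda>L. \<bar>t\<bar> * (\<rho> L * C\<^sub>U / \<bar>?I\<bar>)) \<longlonglongrightarrow> \<bar>t\<bar> * (0 * C\<^sub>U / \<bar>?I\<bar>)"
      by (intro tendsto_intros) (use I0 in auto)
    then show "d \<longlonglongrightarrow> 0" unfolding d_def by simp
  qed simp
qed

text \<open>Evaluating the limit for the sum at \<open>- t / information\<close> divides the
  variance by the square of \<open>information\<close>; the sign disappears in the square.\<close>

theorem estimator_char_limit:
  "(\<lambda>n. expectation (\<lambda>\<omega>. iexp (t * (sqrt (real (Suc n)) * (\<theta>hat n \<omega> - \<theta>\<^sub>0)))))
    \<longlonglongrightarrow> complex_of_real (exp (- (t\<^sup>2 * (asymptotic_variance / information\<^sup>2) / 2)))"
proof -
  have "(\<lambda>n. expectation (\<lambda>\<omega>. iexp (t * (- (normalized_sum n \<omega> / information)))))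
      \<longlonglongrightarrow> complex_of_real (exp (- (t\<^sup>2 * (asymptotic_variance / information\<^sup>2) / 2)))"
    using normalized_sum_clt[of "- t / information"] by (simp add: power_divide)
  from Lim_transform[OF this] estimator_char_close[of t] show ?thesis
    by (simp add: tendsto_norm_zero_iff)
qed

end

section \<open>The diffusion model\<close>

lemma char_normal_density:
  assumes "0 < s"
  shows "char (density lborel (normal_density 0 s)) t = complex_of_real (exp (- (t\<^sup>2 * s\<^sup>2 / 2)))"
proof -
  interpret N: real_distribution std_normal_distribution by (rule real_dist_normal_dist)
  have "distributed std_normal_distribution lborel (\<lambda>x. x) (normal_density 0 1)"
    unfolding distributed_def by (auto simp: distr_id2)
  from N.normal_density_affine[OF this zero_less_one, of s 0] assms
  have "distributed std_normal_distribution lborel (\<lambda>x. s * x) (normal_density 0 s)" by simp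
  then have "density lborel (normal_density 0 s) = distr std_normal_distribution lborel (\<lambda>x. s * x)"
    by (simp add: distributed_distr_eq_density)
  then have "char (density lborel (normal_density 0 s)) t = (LINT x|std_normal_distribution. iexp (t * (s * x)))"
    unfolding char_def by (simp add: integral_distr)
  also have "\<dots> = char std_normal_distribution (t * s)"
    unfolding char_def by (simp add: mult.assoc)
  finally show ?thesis by (simp add: char_std_normal_distribution power_mult_distrib)
qed

text \<open>Nothing is known about \<open>Y 0\<close>, while the continuity theorem wants
  distributions at every index; it is applied to the shifted sequence, and weak limits ignore the
  shift.\<close>

lemma (in prob_space) weak_conv_m_normal:
  fixes Y :: "nat \<Rightarrow> 'a \<Rightarrow> real"
  assumes Y: "\<And>n. n \<ge> 1 \<Longrightarrow> Y n \<in> borel_measurable M" and v: "0 < v"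
    and lim: "\<And>t. (\<lambda>n. expectation (\<lambda>\<omega>. iexp (t * Y n \<omega>))) \<longlonglongrightarrow> complex_of_real (exp (- (t\<^sup>2 * v / 2)))"
  shows "weak_conv_m (\<lambda>n. distr M borel (Y n)) (density lborel (normal_density 0 (sqrt v)))"
proof -
  have s: "0 < sqrt v" using v by simp
  have "weak_conv_m (\<lambda>n. distr M borel (Y (Suc n))) (density lborel (normal_density 0 (sqrt v)))"
  proof (rule levy_continuity)
    show "real_distribution (distr M borel (Y (Suc n)))" for n
      by (rule real_distribution_distr) (use Y in simp)
    show "real_distribution (density lborel (normal_density 0 (sqrt v)))"
      using prob_space_normal_density[OF s] by (simp add: real_distribution_def real_distribution_axioms_def)
    fix t
    have "char (distr M borel (Y (Suc n))) t = expectation (\<lambda>\<omega>. iexp (t * Y (Suc n) \<omega>))" for n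
      unfolding char_def by (rule integral_distr) (use Y in simp_all)
    then show "(\<lambda>n. char (distr M borel (Y (Suc n))) t) \<longlonglongrightarrow> char (density lborel (normal_density 0 (sqrt v))) t"
      using LIMSEQ_Suc[OF lim[of t]] v by (simp add: char_normal_density[OF s])
  qed
  then show ?thesis
    unfolding weak_conv_m_def weak_conv_def by (blast intro: LIMSEQ_imp_Suc)
qed

text \<open>Augmentation adds only null sets that are already measurable, so the augmented
  filtration stays inside the sigma-algebra of \<open>M\<close>.\<close>

lemma strong_solution_measurable:
  assumes \<xi>: "\<xi> \<in> borel_measurable M" and W: "\<And>t. t \<ge> 0 \<Longrightarrow> W t \<in> borel_measurable M"
    and X: "strong_solution M W \<xi> \<mu> \<sigma> X" and t: "t \<ge> 0"
  shows "X t \<in> borel_measurable M"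
proof -
  let ?A = "sets (vimage_algebra (space M) \<xi> borel) \<union> sets (generated_algebra M W {0..t}) \<union> null_sets M"
  have "sets (vimage_algebra (space M) \<xi> borel) \<subseteq> sets M"
    using measurable_sets[OF \<xi>] by (auto simp: sets_vimage_algebra2)
  moreover have "sets (generated_algebra M W {0..t}) \<subseteq> sets M"
    by (rule sets_generated_algebra_subset) (use W in auto)
  ultimately have A: "?A \<subseteq> sets M" by (auto simp: null_sets_def)
  have "?A \<subseteq> Pow (space M)" using A sets.space_closed[of M] by (rule order.trans)
  then have "subalgebra M (augmented_filtration M \<xi> W t)"
    unfolding subalgebra_def augmented_filtration_def
    using sets.sigma_sets_subset[OF A] by (simp add: space_measure_of_conv)
  moreover have "X t \<in> borel_measurable (augmented_filtration M \<xi> W t)"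
    using X t unfolding strong_solution_def by blast
  ultimately show ?thesis by (rule measurable_from_subalg)
qed

text \<open>The laws of the sample segments are images, under a fixed reindexing map, of the laws of
  the path at the times \<open>j * \<Delta>\<close>; shifting \<open>j\<close> by \<open>m\<close>
  shifts time by \<open>m * \<Delta>\<close>.\<close>

lemma distr_skeleton_stationary:
  assumes X: "strictly_stationary M X" "\<And>t. t \<ge> 0 \<Longrightarrow> X t \<in> borel_measurable M" and \<Delta>: "\<Delta> > 0"
    and Z: "\<And>j. Z j = X (real j * \<Delta>)"
  shows "distr M (PiM {..<p} (\<lambda>_. borel)) (\<lambda>\<omega>. \<lambda>j\<in>{..<p}. Z (j + m) \<omega>) =
    distr M (PiM {..<p} (\<lambda>_. borel)) (\<lambda>\<omega>. \<lambda>j\<in>{..<p}. Z j \<omega>)"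
proof -
  define J where "J = (\<lambda>j. real j * \<Delta>) ` {..<p}"
  define \<Phi> where "\<Phi> = (\<lambda>y :: real \<Rightarrow> real. \<lambda>j\<in>{..<p}. y (real j * \<Delta>))"
  have J: "finite J" "J \<subseteq> {0..}" unfolding J_def using \<Delta> by auto
  have \<Phi>: "\<Phi> \<in> measurable (PiM J (\<lambda>_. borel)) (PiM {..<p} (\<lambda>_. borel))"
    unfolding \<Phi>_def by (rule measurable_restrict, rule measurable_component_singleton) (auto simp: J_def)
  have XJ: "(\<lambda>\<omega>. \<lambda>t\<in>J. X (t + s) \<omega>) \<in> measurable M (PiM J (\<lambda>_. borel))" if "s \<ge> 0" for s
    by (rule measurable_restrict, rule X(2)) (use J(2) that in auto)
  have eq: "(\<lambda>\<omega>. \<lambda>j\<in>{..<p}. Z (j + k) \<omega>) = \<Phi> \<circ> (\<lambda>\<omega>. \<lambda>t\<in>J. X (t + real k * \<Delta>) \<omega>)" for k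
    unfolding \<Phi>_def comp_def J_def Z by (intro ext) (auto simp: restrict_def algebra_simps)
  have push: "distr M (PiM {..<p} (\<lambda>_. borel)) (\<lambda>\<omega>. \<lambda>j\<in>{..<p}. Z (j + k) \<omega>) =
      distr (distr M (PiM J (\<lambda>_. borel)) (\<lambda>\<omega>. \<lambda>t\<in>J. X (t + real k * \<Delta>) \<omega>)) (PiM {..<p} (\<lambda>_. borel)) \<Phi>" for k
    unfolding eq by (rule distr_distr[OF \<Phi> XJ, symmetric]) (use \<Delta> in simp)
  have "distr M (PiM J (\<lambda>_. borel)) (\<lambda>\<omega>. \<lambda>t\<in>J. X (t + real m * \<Delta>) \<omega>) = distr M (PiM J (\<lambda>_. borel)) (\<lambda>\<omega>. \<lambda>t\<in>J. X t \<omega>)"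
    using X(1) J \<Delta> unfolding strictly_stationary_def by simp
  then show ?thesis using push[of m] push[of 0] by simp
qed

text \<open>Summing absolute values over a list yields one function that dominates all members and
  is again bounded and integrable.\<close>

lemma bounded_integrable_envelope:
  assumes "\<And>f. f \<in> set fs \<Longrightarrow> bounded_integrable f"
  shows "integrable lborel (\<lambda>x. \<Sum>f\<leftarrow>fs. \<bar>f x\<bar>)" "\<exists>B. \<forall>x. (\<Sum>f\<leftarrow>fs. \<bar>f x\<bar>) \<le> B"
    "f \<in> set fs \<Longrightarrow> \<bar>f x\<bar> \<le> (\<Sum>f\<leftarrow>fs. \<bar>f x\<bar>)"
proof -
  show "integrable lborel (\<lambda>x. \<Sum>f\<leftarrow>fs. \<bar>f x\<bar>)"
    using assms by (induction fs) (auto simp: bounded_integrable_def)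
  show "\<exists>B. \<forall>x. (\<Sum>f\<leftarrow>fs. \<bar>f x\<bar>) \<le> B"
    using assms
  proof (induction fs)
    case (Cons g fs)
    obtain C where "\<And>x. \<bar>g x\<bar> \<le> C"
      using Cons.prems[of g] unfolding bounded_integrable_def bounded_iff by auto
    moreover obtain B where "\<And>x. (\<Sum>f\<leftarrow>fs. \<bar>f x\<bar>) \<le> B" using Cons by auto
    ultimately show ?case by (auto intro!: exI[of _ "C + B"] add_mono)
  qed auto
  have nonneg: "0 \<le> (\<Sum>f\<leftarrow>gs. \<bar>f x\<bar>)" for gs :: "(real \<Rightarrow> real) list" by (induction gs) auto
  show "f \<in> set fs \<Longrightarrow> \<bar>f x\<bar> \<le> (\<Sum>f\<leftarrow>fs. \<bar>f x\<bar>)"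
  proof (induction fs)
    case (Cons g fs)
    then show ?case using nonneg[of fs] by (auto intro: add_increasing)
  qed simp
qed

section \<open>From the stated regularity conditions to the analytic setting\<close>

lemma param_deriv_has_real_derivative:
  assumes "param_times_differentiable n \<Theta> f" "k < n" "\<theta> \<in> \<Theta>"
  shows "((param_deriv \<Theta> ^^ k) f has_real_derivative (param_deriv \<Theta> ^^ Suc k) f \<theta>) (at \<theta> within \<Theta>)"
proof -
  have "(param_deriv \<Theta> ^^ k) f differentiable (at \<theta> within \<Theta>)"
    using assms unfolding param_times_differentiable_def by blast
  then have "((param_deriv \<Theta> ^^ k) f has_vector_derivative vector_derivative ((param_deriv \<Theta> ^^ k) f) (at \<theta> within \<Theta>)) (at \<theta> within \<Theta>)"
    by (simp only: vector_derivative_works)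
  then show ?thesis
    by (simp add: has_real_derivative_iff_has_vector_derivative param_deriv_def[symmetric])
qed

lemma continuous_on_section:
  assumes "continuous_on (UNIV \<times> S) (\<lambda>(x, \<theta>). f x \<theta>)" "\<theta> \<in> S"
  shows "continuous_on UNIV (\<lambda>x. f x \<theta>)"
  using continuous_on_compose2[OF assms(1), of UNIV "\<lambda>x. (x, \<theta>)"] assms(2)
  by (auto simp: continuous_on_Pair continuous_on_const continuous_on_id)

lemma continuously_differentiableD:
  assumes "continuously_differentiable f"
  shows "(f has_real_derivative deriv f x) (at x)" "continuous_on UNIV (deriv f)"
  using assms unfolding continuously_differentiable_def by (auto simp: DERIV_deriv_iff_real_differentiable)

text \<open>The envelope is the sum of the absolute values of the products in \<open>fs\<close>. Its
  bound \<open>B\<close> is returned as well, because it makes \<open>influence\<close>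
  bounded.\<close>

lemma drift_regression_of_conditions:
  fixes \<mu> :: "real \<Rightarrow> real \<Rightarrow> real" and \<sigma> w \<pi> \<pi>' :: "real \<Rightarrow> real"
  assumes \<theta>\<^sub>0: "\<theta>\<^sub>0 \<in> {a<..<b}" and coefficients: "coefficient_conditions {a..b} \<mu> \<sigma> w"
    and weight: "weight_function w" and density: "smooth_bounded \<pi> \<pi>'"
    and stationary: "\<And>x. \<mu> x \<theta>\<^sub>0 * \<pi> x - 1 / 2 * deriv (\<lambda>y. (\<sigma> y)\<^sup>2 * \<pi> y) x = 0"
  obtains P \<mu>1 \<mu>2 \<mu>3 G B where
    "drift_regression a b \<theta>\<^sub>0 P \<mu> (\<lambda>x. param_deriv {a..b} (\<mu> x)) (deriv (\<lambda>y. param_deriv {a..b} (\<mu> y) \<theta>\<^sub>0))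
       \<sigma> (deriv \<sigma>) w (deriv w) \<pi> \<pi>' \<mu>1 \<mu>2 \<mu>3 G"
    "\<And>x. G x \<le> B"
proof -
  let ?\<Theta> = "{a..b}" and ?m = "\<lambda>x. param_deriv {a..b} (\<mu> x)"
  let ?m' = "deriv (\<lambda>y. ?m y \<theta>\<^sub>0)" and ?\<sigma>' = "deriv \<sigma>" and ?w' = "deriv w"
  have \<theta>\<^sub>0_in: "\<theta>\<^sub>0 \<in> ?\<Theta>" using \<theta>\<^sub>0 by simp
  note cc = coefficients[unfolded coefficient_conditions_def]
  have diff3: "\<And>x. param_times_differentiable 3 ?\<Theta> (\<mu> x)"
    and m_diff: "\<And>\<theta> x. \<theta> \<in> ?\<Theta> \<Longrightarrow> (\<lambda>y. ?m y \<theta>) differentiable at x"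
    and cont: "\<And>i. i \<le> 3 \<Longrightarrow> continuous_on (UNIV \<times> ?\<Theta>) (\<lambda>(x, \<theta>). (param_deriv ?\<Theta> ^^ i) (\<mu> x) \<theta>)"
    and cont_m': "continuous_on (UNIV \<times> ?\<Theta>) (\<lambda>(x, \<theta>). deriv (\<lambda>y. ?m y \<theta>) x)"
    and \<sigma>: "continuously_differentiable \<sigma>"
    using cc by blast+
  obtain \<mu>1 \<mu>2 \<mu>3 \<mu>4 \<mu>5 :: "real \<Rightarrow> real" where
    env: "\<forall>\<theta>\<in>?\<Theta>. \<forall>x. \<bar>\<mu> x \<theta>\<bar> \<le> \<mu>1 x \<and> \<bar>?m x \<theta>\<bar> \<le> \<mu>2 x \<and> \<bar>(param_deriv ?\<Theta> ^^ 2) (\<mu> x) \<theta>\<bar> \<le> \<mu>3 x \<and>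
           \<bar>(param_deriv ?\<Theta> ^^ 3) (\<mu> x) \<theta>\<bar> \<le> \<mu>4 x \<and> \<bar>deriv (\<lambda>y. ?m y \<theta>) x\<bar> \<le> \<mu>5 x"
    and bi: "bounded_integrable (\<lambda>x. (\<mu>1 x)\<^sup>2 * w x)" "bounded_integrable (\<lambda>x. \<sigma> x ^ 4 * w x)"
        "bounded_integrable (\<lambda>x. (\<sigma> x)\<^sup>2 * (?\<sigma>' x)\<^sup>2 * w x)" "bounded_integrable (\<lambda>x. \<mu>2 x * \<mu>1 x * w x)"
        "bounded_integrable (\<lambda>x. \<mu>5 x * (\<sigma> x)\<^sup>2 * w x)" "bounded_integrable (\<lambda>x. (\<mu>2 x)\<^sup>2 * w x)"
        "bounded_integrable (\<lambda>x. \<mu>2 x * (\<sigma> x)\<^sup>2 * ?w' x)" "bounded_integrable (\<lambda>x. \<mu>3 x * \<mu>1 x * w x)"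
        "bounded_integrable (\<lambda>x. \<mu>3 x * \<sigma> x * ?\<sigma>' x * w x)" "bounded_integrable (\<lambda>x. \<mu>3 x * (\<sigma> x)\<^sup>2 * w x)"
        "bounded_integrable (\<lambda>x. \<mu>3 x * \<mu>2 x * w x)" "bounded_integrable (\<lambda>x. \<mu>2 x * (\<sigma> x)\<^sup>2 * w x)"
        "bounded_integrable (\<lambda>x. \<mu>2 x * \<sigma> x * ?\<sigma>' x * w x)"
    and decay: "((\<lambda>x. \<mu>2 x * w x * (\<sigma> x)\<^sup>2) \<longlongrightarrow> 0) at_infinity"
    using cc[THEN conjunct2, THEN conjunct2, THEN conjunct2, THEN conjunct2, THEN conjunct2]
    by (elim exE conjE) (rule that; assumption)
  define fs where "fs = [\<lambda>x. (\<mu>1 x)\<^sup>2 * w x, \<lambda>x. \<sigma> x ^ 4 * w x, \<lambda>x. (\<sigma> x)\<^sup>2 * (?\<sigma>' x)\<^sup>2 * w x,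
    \<lambda>x. \<mu>2 x * \<mu>1 x * w x, \<lambda>x. \<mu>5 x * (\<sigma> x)\<^sup>2 * w x, \<lambda>x. (\<mu>2 x)\<^sup>2 * w x, \<lambda>x. \<mu>2 x * (\<sigma> x)\<^sup>2 * ?w' x,
    \<lambda>x. \<mu>3 x * \<mu>1 x * w x, \<lambda>x. \<mu>3 x * \<sigma> x * ?\<sigma>' x * w x, \<lambda>x. \<mu>3 x * (\<sigma> x)\<^sup>2 * w x,
    \<lambda>x. \<mu>3 x * \<mu>2 x * w x, \<lambda>x. \<mu>2 x * (\<sigma> x)\<^sup>2 * w x, \<lambda>x. \<mu>2 x * \<sigma> x * ?\<sigma>' x * w x]"
  define G where "G = (\<lambda>x. \<Sum>f\<leftarrow>fs. \<bar>f x\<bar>)"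
  have fs_bi: "bounded_integrable f" if "f \<in> set fs" for f
    using that bi unfolding fs_def by auto
  have G_int: "integrable lborel G" unfolding G_def by (rule bounded_integrable_envelope(1)[OF fs_bi])
  obtain B where B: "\<And>x. G x \<le> B"
    using bounded_integrable_envelope(2)[OF fs_bi] unfolding G_def by blast
  have G: "\<bar>f x\<bar> \<le> G x" if "f \<in> set fs" for f x
    unfolding G_def by (rule bounded_integrable_envelope(3)[OF fs_bi that])
  have G': "f x \<le> G x" if "f \<in> set fs" for f x using G[OF that, of x] by linarith
  have w_nonneg: "0 \<le> w x" and w: "continuously_differentiable w" for x
    using weight unfolding weight_function_def by auto
  have \<mu>1: "\<bar>\<mu> x \<theta>\<bar> \<le> \<mu>1 x" and \<mu>2: "\<bar>?m x \<theta>\<bar> \<le> \<mu>2 x" and \<mu>3: "\<bar>(param_deriv ?\<Theta> ^^ 2) (\<mu> x) \<theta>\<bar> \<le> \<mu>3 x"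
    and \<mu>5: "\<bar>deriv (\<lambda>y. ?m y \<theta>) x\<bar> \<le> \<mu>5 x" if "\<theta> \<in> ?\<Theta>" for x \<theta>
    using env that by blast+
  have \<mu>2_nonneg: "0 \<le> \<mu>2 x" and \<mu>3_nonneg: "0 \<le> \<mu>3 x" for x
    using \<mu>2[OF \<theta>\<^sub>0_in, of x] \<mu>3[OF \<theta>\<^sub>0_in, of x] by linarith+
  obtain P where P: "P > 0" "\<And>x. \<bar>\<pi> x\<bar> \<le> P" "\<And>x. \<bar>\<pi>' x\<bar> \<le> P"
    by (rule smooth_bounded_bound[OF density]) blast
  have m_deriv: "(?m x has_real_derivative (param_deriv ?\<Theta> ^^ 2) (\<mu> x) \<theta>) (at \<theta> within ?\<Theta>)" if "\<theta> \<in> ?\<Theta>" for x \<theta>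
    using param_deriv_has_real_derivative[OF diff3, of 1 \<theta> x] that by (simp add: numeral_2_eq_2)
  have "drift_regression a b \<theta>\<^sub>0 P \<mu> ?m ?m' \<sigma> ?\<sigma>' w ?w' \<pi> \<pi>' \<mu>1 \<mu>2 \<mu>3 G"
  proof
    show "(\<mu> x has_real_derivative ?m x \<theta>) (at \<theta> within {a..b})" if "\<theta> \<in> {a..b}" for x \<theta>
      using param_deriv_has_real_derivative[OF diff3, of 0 \<theta> x] that by simp
    show "\<bar>?m x \<theta> - ?m x \<theta>\<^sub>0\<bar> \<le> \<mu>3 x * \<bar>\<theta> - \<theta>\<^sub>0\<bar>" if "\<theta> \<in> {a..b}" for x \<theta>
    proof -
      have "norm (?m x \<theta> - ?m x \<theta>\<^sub>0) \<le> \<mu>3 x * norm (\<theta> - \<theta>\<^sub>0)"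
        by (rule field_differentiable_bound[OF _ m_deriv]) (use \<mu>3 that \<theta>\<^sub>0_in in auto)
      then show ?thesis by simp
    qed
    show "continuous_on UNIV (\<lambda>x. \<mu> x \<theta>)" if "\<theta> \<in> {a..b}" for \<theta>
      using continuous_on_section[OF cont[of 0] that] by simp
    show "continuous_on UNIV (\<lambda>x. ?m x \<theta>)" if "\<theta> \<in> {a..b}" for \<theta>
      using continuous_on_section[OF cont[of 1] that] by simp
    show "((\<lambda>y. ?m y \<theta>\<^sub>0) has_real_derivative ?m' x) (at x)" for x
      using m_diff[OF \<theta>\<^sub>0_in] by (simp only: DERIV_deriv_iff_real_differentiable)
    show "continuous_on UNIV ?m'" using continuous_on_section[OF cont_m' \<theta>\<^sub>0_in] .
    show "\<mu> x \<theta>\<^sub>0 * \<pi> x = \<sigma> x * ?\<sigma>' x * \<pi> x + (\<sigma> x)\<^sup>2 / 2 * \<pi>' x" for x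
    proof -
      have "deriv (\<lambda>y. (\<sigma> y)\<^sup>2 * \<pi> y) x = 2 * \<sigma> x * ?\<sigma>' x * \<pi> x + (\<sigma> x)\<^sup>2 * \<pi>' x"
        by (rule DERIV_imp_deriv)
          (rule derivative_eq_intros continuously_differentiableD(1)[OF \<sigma>] smooth_boundedD(1)[OF density] refl | simp add: algebra_simps)+
      then show ?thesis using stationary[of x] by (simp add: field_simps)
    qed
    show "\<bar>?m' x\<bar> * (\<sigma> x)\<^sup>2 * w x \<le> G x" for x
    proof -
      have "\<bar>?m' x\<bar> * (\<sigma> x)\<^sup>2 * w x \<le> \<mu>5 x * (\<sigma> x)\<^sup>2 * w x"
        using \<mu>5[OF \<theta>\<^sub>0_in, of x] w_nonneg by (intro mult_right_mono) auto
      also have "\<dots> \<le> G x" by (rule G'[where f = "\<lambda>x. \<mu>5 x * (\<sigma> x)\<^sup>2 * w x"]) (simp add: fs_def)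
      finally show ?thesis .
    qed
    \<comment> \<open>The derivative of the weight has no sign, so the two-sided domination by the
      envelope is used here.\<close>
    show "\<mu>2 x * (\<sigma> x)\<^sup>2 * \<bar>?w' x\<bar> \<le> G x" for x
      using G[where f = "\<lambda>x. \<mu>2 x * (\<sigma> x)\<^sup>2 * ?w' x" and x = x] \<mu>2_nonneg[of x] by (simp add: fs_def abs_mult)
    show "\<mu>2 x * \<bar>\<sigma> x * ?\<sigma>' x\<bar> * w x \<le> G x" for x
      using G[where f = "\<lambda>x. \<mu>2 x * \<sigma> x * ?\<sigma>' x * w x" and x = x] \<mu>2_nonneg[of x] w_nonneg[of x]
      by (simp add: fs_def abs_mult mult.assoc)
    show "\<mu>3 x * \<bar>\<sigma> x * ?\<sigma>' x\<bar> * w x \<le> G x" for x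
      using G[where f = "\<lambda>x. \<mu>3 x * \<sigma> x * ?\<sigma>' x * w x" and x = x] \<mu>3_nonneg[of x] w_nonneg[of x]
      by (simp add: fs_def abs_mult mult.assoc)
    show "(\<mu>1 x)\<^sup>2 * w x \<le> G x" for x by (rule G'[where f = "\<lambda>x. (\<mu>1 x)\<^sup>2 * w x"]) (simp add: fs_def)
    show "\<sigma> x ^ 4 * w x \<le> G x" for x by (rule G'[where f = "\<lambda>x. \<sigma> x ^ 4 * w x"]) (simp add: fs_def)
    show "(\<sigma> x)\<^sup>2 * (?\<sigma>' x)\<^sup>2 * w x \<le> G x" for x
      by (rule G'[where f = "\<lambda>x. (\<sigma> x)\<^sup>2 * (?\<sigma>' x)\<^sup>2 * w x"]) (simp add: fs_def)
    show "\<mu>2 x * \<mu>1 x * w x \<le> G x" for x by (rule G'[where f = "\<lambda>x. \<mu>2 x * \<mu>1 x * w x"]) (simp add: fs_def)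
    show "\<mu>2 x * (\<sigma> x)\<^sup>2 * w x \<le> G x" for x by (rule G'[where f = "\<lambda>x. \<mu>2 x * (\<sigma> x)\<^sup>2 * w x"]) (simp add: fs_def)
    show "(\<mu>2 x)\<^sup>2 * w x \<le> G x" for x by (rule G'[where f = "\<lambda>x. (\<mu>2 x)\<^sup>2 * w x"]) (simp add: fs_def)
    show "\<mu>3 x * \<mu>1 x * w x \<le> G x" for x by (rule G'[where f = "\<lambda>x. \<mu>3 x * \<mu>1 x * w x"]) (simp add: fs_def)
    show "\<mu>3 x * (\<sigma> x)\<^sup>2 * w x \<le> G x" for x by (rule G'[where f = "\<lambda>x. \<mu>3 x * (\<sigma> x)\<^sup>2 * w x"]) (simp add: fs_def)
    show "\<mu>3 x * \<mu>2 x * w x \<le> G x" for x by (rule G'[where f = "\<lambda>x. \<mu>3 x * \<mu>2 x * w x"]) (simp add: fs_def)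
  qed (use \<theta>\<^sub>0 \<mu>1 \<mu>2 \<mu>3_nonneg w_nonneg P density decay G_int continuously_differentiableD[OF \<sigma>] continuously_differentiableD[OF w] in \<open>simp_all\<close>)
  then show ?thesis using that B by blast
qed

text \<open>The lower bound on \<open>\<gamma>\<close> makes the exponent
  \<open>1 / 2 - \<gamma> * \<alpha>\<close> negative; passing from \<open>n + 1\<close> to
  \<open>n\<close> under the root costs the factor \<open>sqrt 2\<close>.\<close>

lemma bandwidth_bias_rate:
  fixes h :: "nat \<Rightarrow> real"
  assumes h: "h \<in> O(\<lambda>n. real n powr (- \<gamma>))" "\<forall>n\<ge>1. h n > 0" and \<alpha>: "1 / (2 * real \<alpha>) < \<gamma>" "\<alpha> > 0"
  shows "(\<lambda>n. sqrt (real (Suc n)) * h n ^ \<alpha>) \<longlonglongrightarrow> 0"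
proof -
  obtain c where c: "c > 0" "eventually (\<lambda>n. norm (h n) \<le> c * norm (real n powr (- \<gamma>))) sequentially"
    using landau_o.bigE[OF h(1)] by blast
  have "1 / 2 - \<gamma> * real \<alpha> < 0" using \<alpha> by (simp add: field_simps)
  then have "(\<lambda>n. real n powr (1 / 2 - \<gamma> * real \<alpha>)) \<longlonglongrightarrow> 0"
    by (rule tendsto_neg_powr[OF _ filterlim_real_sequentially])
  then have lim: "(\<lambda>n. sqrt 2 * c ^ \<alpha> * real n powr (1 / 2 - \<gamma> * real \<alpha>)) \<longlonglongrightarrow> 0"
    by (rule tendsto_mult_right_zero)
  show ?thesis
  proof (rule tendsto_sandwich[OF _ _ tendsto_const lim])
    show "eventually (\<lambda>n. 0 \<le> sqrt (real (Suc n)) * h n ^ \<alpha>) sequentially"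
      using eventually_ge_at_top[of 1] by eventually_elim (use h(2) in \<open>auto intro!: mult_nonneg_nonneg less_imp_le\<close>)
    show "eventually (\<lambda>n. sqrt (real (Suc n)) * h n ^ \<alpha> \<le> sqrt 2 * c ^ \<alpha> * real n powr (1 / 2 - \<gamma> * real \<alpha>)) sequentially"
      using c(2) eventually_ge_at_top[of 1]
    proof eventually_elim
      case (elim n)
      have n: "0 < real n" and h0: "0 < h n" using elim h(2) by auto
      have "h n \<le> c * real n powr (- \<gamma>)" using elim h0 by simp
      then have "h n ^ \<alpha> \<le> (c * real n powr (- \<gamma>)) ^ \<alpha>" using h0 by (intro power_mono) auto
      also have "\<dots> = c ^ \<alpha> * real n powr (- \<gamma> * real \<alpha>)"
        using n by (simp add: power_mult_distrib powr_power mult.commute)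
      finally have hn: "h n ^ \<alpha> \<le> c ^ \<alpha> * real n powr (- \<gamma> * real \<alpha>)" .
      have "sqrt (real (Suc n)) \<le> sqrt (2 * real n)" using elim by simp
      then have "sqrt (real (Suc n)) \<le> sqrt 2 * real n powr (1 / 2)"
        using n by (simp add: real_sqrt_mult powr_half_sqrt)
      then have "sqrt (real (Suc n)) * h n ^ \<alpha> \<le> (sqrt 2 * real n powr (1 / 2)) * (c ^ \<alpha> * real n powr (- \<gamma> * real \<alpha>))"
        using hn h0 by (intro mult_mono) auto
      also have "\<dots> = sqrt 2 * c ^ \<alpha> * (real n powr (1 / 2) * real n powr (- \<gamma> * real \<alpha>))" by simp
      also have "real n powr (1 / 2) * real n powr (- \<gamma> * real \<alpha>) = real n powr (1 / 2 - \<gamma> * real \<alpha>)"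
        by (simp flip: powr_add)
      finally show ?case .
    qed
  qed
qed

theorem theorem3:
  fixes M :: "'a measure"
    and W X :: "real \<Rightarrow> 'a \<Rightarrow> real" and \<xi> :: "'a \<Rightarrow> real"
    and Z :: "nat \<Rightarrow> 'a \<Rightarrow> real" and \<theta>hat :: "nat \<Rightarrow> 'a \<Rightarrow> real"
    and \<Theta> :: "real set" and a b \<theta>\<^sub>0 \<Delta> \<gamma> \<delta> :: real and \<alpha> :: nat
    and \<mu> \<pi> :: "real \<Rightarrow> real \<Rightarrow> real" and p :: "real \<Rightarrow> real \<Rightarrow> real \<Rightarrow> real \<Rightarrow> real"
    and \<sigma> w K R v :: "real \<Rightarrow> real" and h :: "nat \<Rightarrow> real"
  assumes Brownian: "brownian_motion M W"
    and initial_indep: "independent_of_process M \<xi> W"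
    and initial_density: "distributed M lborel \<xi> (\<lambda>x. ennreal (\<pi> x \<theta>\<^sub>0))"
    and solution: "strong_solution M W \<xi> (\<lambda>x. \<mu> x \<theta>\<^sub>0) \<sigma> X"
    and sampling: "\<Delta> > 0" "\<And>j. Z j = X (real j * \<Delta>)"
    and parameters: "a < b" "\<Theta> = {a..b}" "\<theta>\<^sub>0 \<in> interior \<Theta>"
    and model: "ergodic_diffusion_model M W \<Theta> \<mu> \<sigma> p \<pi>"
    and mixing: "alpha_mixing M Z" "summable (alpha_coeff M Z)"
    and order: "\<alpha> > 4"
    and densities: "smooth_invariant_densities \<Theta> \<alpha> \<pi>"
    and kernel: "kernel_of_order \<alpha> K"
    and bandwidth: "\<forall>n\<ge>1. h n > 0" "antimono_on {1..} h" "h \<longlonglongrightarrow> 0"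
      "filterlim (\<lambda>n. real n * h n ^ 4) at_top sequentially"
    and weight: "weight_function w"
    and stationary_equation: "\<And>x. \<sigma> differentiable at x"
      "\<And>x. \<mu> x \<theta>\<^sub>0 * \<pi> x \<theta>\<^sub>0 - 1 / 2 * deriv (\<lambda>y. (\<sigma> y)\<^sup>2 * \<pi> y \<theta>\<^sub>0) x = 0"
    and coefficients: "coefficient_conditions \<Theta> \<mu> \<sigma> w"
    and estimator: "\<And>n. n \<ge> 1 \<Longrightarrow> \<theta>hat n \<in> borel_measurable M"
      "\<And>n \<omega>. n \<ge> 1 \<Longrightarrow> \<omega> \<in> space M \<Longrightarrow>
         is_arg_min (criterion \<mu> \<sigma> w (kernel_estimator K h Z n \<omega>)) (\<lambda>\<theta>. \<theta> \<in> \<Theta>) (\<theta>hat n \<omega>)"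
    and R: "R = criterion \<mu> \<sigma> w (\<lambda>x. \<pi> x \<theta>\<^sub>0)"
    and identifiability:
      "\<And>\<epsilon>. \<epsilon> > 0 \<Longrightarrow> (INF \<theta>\<in>{\<theta>\<in>\<Theta>. \<bar>\<theta> - \<theta>\<^sub>0\<bar> \<ge> \<epsilon>}. ereal (R \<theta>)) > ereal (R \<theta>\<^sub>0)"
    and rate: "h \<in> bigtheta sequentially (\<lambda>n. real n powr (- \<gamma>))" "1 / (2 * real \<alpha>) < \<gamma>" "\<gamma> < 1 / 8"
    and v: "v = limit_score \<Theta> \<mu> \<sigma> w \<pi> \<theta>\<^sub>0"
    and second_derivative: "(param_deriv \<Theta> ^^ 2) R \<theta>\<^sub>0 \<noteq> 0"
    and variance: "long_run_variance M v Z > 0"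
    and smooth_v: "times_differentiable \<alpha> v" "bounded (range ((deriv ^^ \<alpha>) v))"
    and moments: "\<delta> > 0" "\<And>j. integrable M (\<lambda>\<omega>. \<bar>Z j \<omega>\<bar> powr (2 + \<delta>))"
      "summable (\<lambda>k. alpha_coeff M Z (Suc k) powr (\<delta> / (2 + \<delta>)))"
  shows "weak_conv_m
           (\<lambda>n. distr M borel (\<lambda>\<omega>. sqrt (real n + 1) * (\<theta>hat n \<omega> - \<theta>\<^sub>0)))
           (density lborel (normal_density 0
              (sqrt (long_run_variance M v Z / ((param_deriv \<Theta> ^^ 2) R \<theta>\<^sub>0)\<^sup>2))))"
proof -
  define f where "f = (\<lambda>x. \<pi> x \<theta>\<^sub>0)"
  let ?m = "\<lambda>x. param_deriv {a..b} (\<mu> x)"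
  have \<theta>\<^sub>0: "\<theta>\<^sub>0 \<in> {a<..<b}" using parameters by (simp add: interior_atLeastAtMost_real)
  then have \<theta>\<^sub>0_in: "\<theta>\<^sub>0 \<in> \<Theta>" using parameters(2) by simp
  have M: "prob_space M" and W: "\<And>t. t \<ge> 0 \<Longrightarrow> W t \<in> borel_measurable M"
    using Brownian unfolding brownian_motion_def by auto
  have \<xi>: "\<xi> \<in> borel_measurable M" using distributed_measurable[OF initial_density] by simp
  have X_meas: "\<And>t. t \<ge> 0 \<Longrightarrow> X t \<in> borel_measurable M"
    using strong_solution_measurable[OF \<xi> W solution] .
  note model_\<theta>\<^sub>0 = model[unfolded ergodic_diffusion_model_def, rule_format, OF \<theta>\<^sub>0_in]
  have X_stat: "strictly_stationary M X"
    using model_\<theta>\<^sub>0 initial_indep solution initial_density by blast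
  have f_nonneg: "0 \<le> f x" for x
    using model_\<theta>\<^sub>0 unfolding invariant_density_def f_def by blast
  have f_smooth: "smooth_bounded f (deriv f)"
  proof -
    have cd: "continuously_differentiable f" and "bounded (range f)" "bounded (range (deriv f))"
      using model_\<theta>\<^sub>0 unfolding bounded_integrable_def f_def by blast+
    then obtain B C where "\<And>x. \<bar>f x\<bar> \<le> B" "\<And>x. \<bar>deriv f x\<bar> \<le> C" unfolding bounded_iff by auto
    then have "\<forall>x. \<bar>f x\<bar> \<le> max B C \<and> \<bar>deriv f x\<bar> \<le> max B C" by (auto intro: max.coboundedI1 max.coboundedI2)
    then show ?thesis
      unfolding smooth_bounded_def using continuously_differentiableD[OF cd] by blast
  qed
  interpret prob_space M by (rule M)
  have Z_meas: "Z j \<in> borel_measurable M" for j unfolding sampling(2) using sampling(1) by (intro X_meas) simp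
  interpret stationary_mixing M Z
  proof
    show "Z j \<in> borel_measurable M" for j by (rule Z_meas)
    show "distr M (PiM {..<p} (\<lambda>_. borel)) (\<lambda>\<omega>. \<lambda>j\<in>{..<p}. Z (j + m) \<omega>) =
        distr M (PiM {..<p} (\<lambda>_. borel)) (\<lambda>\<omega>. \<lambda>j\<in>{..<p}. Z j \<omega>)" for p m
      using X_stat X_meas sampling by (rule distr_skeleton_stationary)
    show "summable (alpha_coeff M Z)" by (rule mixing(2))
  qed
  interpret smoothing_kernel \<alpha> K by unfold_locales (rule kernel)
  have law: "distributed M lborel (Z 0) (\<lambda>x. ennreal (f x))"
  proof -
    \<comment> \<open>The solution starts at \<xi> only almost surely, so the law of
      \<open>Z 0\<close> is obtained from that of \<xi> by almost sure equality.\<close>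
    have "AE \<omega> in M. Z 0 \<omega> = \<xi> \<omega>"
      using solution unfolding strong_solution_def sampling(2) by simp
    then have "distr M lborel (Z 0) = distr M lborel \<xi>"
      by (intro distr_cong_AE) (use Z_meas \<xi> in auto)
    then show ?thesis
      using initial_density Z_meas[of 0] unfolding distributed_def f_def by simp
  qed
  obtain L where diff_f: "times_differentiable \<alpha> f"
    and shift: "\<And>t. integrable lborel (\<lambda>x. ((deriv ^^ \<alpha>) f (x + t) - (deriv ^^ \<alpha>) f x)\<^sup>2)"
      "\<And>t. sqrt (LINT x|lborel. ((deriv ^^ \<alpha>) f (x + t) - (deriv ^^ \<alpha>) f x)\<^sup>2) \<le> L"
    using densities \<theta>\<^sub>0_in unfolding smooth_invariant_densities_def f_def by blast
  obtain D where D: "D \<ge> 0"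
    "\<And>x h. 0 \<le> h \<Longrightarrow> h \<le> 1 / 2 \<Longrightarrow> \<bar>(LINT u|lborel. K u * f (x - h * u)) - f x\<bar> \<le> D * h ^ (\<alpha> - 1)"
    "\<And>x h. 0 \<le> h \<Longrightarrow> h \<le> 1 / 2 \<Longrightarrow> \<bar>(LINT u|lborel. K u * deriv f (x - h * u)) - deriv f x\<bar> \<le> D * h ^ (\<alpha> - 2)"
    by (rule density_smoothing_bias[OF diff_f _ shift]) (use order in auto)
  interpret kernel_density_estimation M Z \<alpha> K f "deriv f" D
    by unfold_locales (rule law f_nonneg f_smooth D | assumption)+
  have stat_eq: "\<And>x. \<mu> x \<theta>\<^sub>0 * f x - 1 / 2 * deriv (\<lambda>y. (\<sigma> y)\<^sup>2 * f y) x = 0"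
    using stationary_equation(2) unfolding f_def .
  obtain P \<mu>1 \<mu>2 \<mu>3 G B where
    dr: "drift_regression a b \<theta>\<^sub>0 P \<mu> ?m (deriv (\<lambda>y. ?m y \<theta>\<^sub>0)) \<sigma> (deriv \<sigma>) w (deriv w) f (deriv f) \<mu>1 \<mu>2 \<mu>3 G"
    and B: "\<And>x. G x \<le> B"
    by (rule drift_regression_of_conditions[OF \<theta>\<^sub>0 coefficients[unfolded parameters(2)] weight f_smooth stat_eq]) (rule that)
  interpret drift_regression a b \<theta>\<^sub>0 P \<mu> ?m "deriv (\<lambda>y. ?m y \<theta>\<^sub>0)" \<sigma> "deriv \<sigma>" w "deriv w" f "deriv f" \<mu>1 \<mu>2 \<mu>3 G
    by (rule dr)
  have v_eq: "v = influence"
  proof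
    fix x
    have "deriv (\<lambda>y. ?m y \<theta>\<^sub>0 * f y * w y) x =
        deriv (\<lambda>y. ?m y \<theta>\<^sub>0) x * f x * w x + ?m x \<theta>\<^sub>0 * deriv f x * w x + ?m x \<theta>\<^sub>0 * f x * deriv w x"
      by (rule DERIV_imp_deriv)
        (rule derivative_eq_intros m_deriv(1) smooth_boundedD(1)[OF f_smooth] w_deriv(1) refl | simp add: algebra_simps)+
    moreover have "v x = 2 * ?m x \<theta>\<^sub>0 * \<mu> x \<theta>\<^sub>0 * f x * w x + deriv (\<lambda>y. ?m y \<theta>\<^sub>0 * f y * w y) x * (\<sigma> x)\<^sup>2"
      unfolding v limit_score_def parameters(2) f_def ..
    ultimately show "v x = influence x"
      unfolding influence_def by simp
  qed
  obtain D\<^sub>v where D\<^sub>v: "\<And>x h. \<bar>(LINT u|lborel. K u * influence (x + h * u)) - influence x\<bar> \<le> D\<^sub>v * \<bar>h\<bar> ^ \<alpha>"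
    by (rule bounded_derivative_smoothing_bias[OF smooth_v(1)[unfolded v_eq] _ smooth_v(2)[unfolded v_eq]]) (use order in auto)
  have R_eq: "R = criterion \<mu> \<sigma> w f" unfolding R f_def ..
  have info: "(param_deriv \<Theta> ^^ 2) R \<theta>\<^sub>0 = information"
    unfolding R_eq parameters(2) by (rule criterion_second_derivative)
  have R0: "R \<theta>\<^sub>0 = 0" unfolding R_eq criterion_eq[OF f_smooth] residual_density by simp
  interpret minimum_distance_estimation M Z \<alpha> K f "deriv f" D a b \<theta>\<^sub>0 P \<mu> ?m "deriv (\<lambda>y. ?m y \<theta>\<^sub>0)" \<sigma> "deriv \<sigma>" w "deriv w"
    \<mu>1 \<mu>2 \<mu>3 G h \<theta>hat "5 * P * B" D\<^sub>v
  proof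
    show "\<alpha> > 4" by (rule order)
    \<comment> \<open>\<open>P\<close> bounds the density and its derivative, \<open>B\<close> the
      envelope.\<close>
    show "\<bar>influence x\<bar> \<le> 5 * P * B" for x
      by (rule order.trans[OF influence_bound]) (use B P in simp)
    show "\<bar>(LINT u|lborel. K u * influence (x + h * u)) - influence x\<bar> \<le> D\<^sub>v * \<bar>h\<bar> ^ \<alpha>" for x h by (rule D\<^sub>v)
    show "h n > 0" if "n \<ge> 1" for n using bandwidth(1) that by blast
    show "(\<lambda>n. sqrt (real (Suc n)) * h n ^ \<alpha>) \<longlonglongrightarrow> 0"
      by (rule bandwidth_bias_rate[OF bigthetaD1[OF rate(1)] bandwidth(1) rate(2)]) (use order in simp)
    show "is_arg_min (criterion \<mu> \<sigma> w (kernel_estimator K h Z n \<omega>)) (\<lambda>\<theta>. \<theta> \<in> {a..b}) (\<theta>hat n \<omega>)"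
      if "n \<ge> 1" "\<omega> \<in> space M" for n \<omega>
      using estimator(2)[OF that] unfolding parameters(2) .
    show "\<exists>c>0. \<forall>\<theta>\<in>{a..b}. \<epsilon> \<le> \<bar>\<theta> - \<theta>\<^sub>0\<bar> \<longrightarrow> c \<le> criterion \<mu> \<sigma> w f \<theta>" if \<epsilon>: "\<epsilon> > 0" for \<epsilon>
    proof -
      let ?I = "INF \<theta>\<in>{\<theta>\<in>\<Theta>. \<bar>\<theta> - \<theta>\<^sub>0\<bar> \<ge> \<epsilon>}. ereal (R \<theta>)"
      \<comment> \<open>The infimum may be infinite, when no parameter is that far away; a real
        number strictly between 0 and it provides the gap in either case.\<close>
      have "ereal 0 < ?I" using identifiability[OF \<epsilon>] unfolding R0 .
      then obtain c where c: "ereal 0 < ereal c" "ereal c < ?I" using ereal_dense2 by blast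
      have "c \<le> R \<theta>" if "\<theta> \<in> {a..b}" "\<epsilon> \<le> \<bar>\<theta> - \<theta>\<^sub>0\<bar>" for \<theta>
      proof -
        have "?I \<le> ereal (R \<theta>)" by (rule INF_lower) (use that parameters(2) in simp)
        with c(2) have "ereal c < ereal (R \<theta>)" by (rule order.strict_trans2)
        then show ?thesis by simp
      qed
      then show ?thesis using c(1) unfolding R_eq by auto
    qed
    show "information \<noteq> 0" using second_derivative unfolding info .
  qed (use bandwidth estimator in auto)
  have lrv: "long_run_variance M v Z = asymptotic_variance"
  proof -
    \<comment> \<open>With centred variables the variance and the covariances reduce to the plain
      product moments of \<open>asymptotic_variance\<close>.\<close>
    have mean: "expectation (\<lambda>\<omega>. influence (Z j \<omega>)) = 0" for j
      unfolding stationary_mean[OF influence_measurable, of j] by (rule influence_mean_zero)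
    show ?thesis
      unfolding long_run_variance_def covariance_def asymptotic_variance_def v_eq mean by simp
  qed
  show ?thesis
    unfolding lrv info
  proof (rule weak_conv_m_normal)
    show "(\<lambda>\<omega>. sqrt (real n + 1) * (\<theta>hat n \<omega> - \<theta>\<^sub>0)) \<in> borel_measurable M" if "n \<ge> 1" for n
    proof -
      note [measurable] = estimator_measurable[OF that]
      show ?thesis by measurable
    qed
    show "0 < asymptotic_variance / information\<^sup>2"
      using variance information_nonzero unfolding lrv by simp
    show "(\<lambda>n. expectation (\<lambda>\<omega>. iexp (t * (sqrt (real n + 1) * (\<theta>hat n \<omega> - \<theta>\<^sub>0)))))
        \<longlonglongrightarrow> complex_of_real (exp (- (t\<^sup>2 * (asymptotic_variance / information\<^sup>2) / 2)))" for t
      using estimator_char_limit[of t] by (simp add: add.commute)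
  qed
qed

end
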